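(* Let $p$ be a prime and let $K$ be a field complete with respect to a non-Archimedean absolute value $|\cdot|$ with $|p|=1/p$. Let $S=K\langle x_1,\ldots,x_d\rangle$ be the Tate algebra over $K$. Suppose $\sigma:S\to S$ is a $K$-algebra automorphism such that $|\sigma(x_i)-x_i|<p^{-c}$ for $i=1,\ldots,d$, for some real $c>1/(p-1)$, where $|\cdot|$ on $S$ is the Gauss norm. If $M$ and $N$ are finitely generated $S$-modules and $i\ge 1$, then the set of $n\in\mathbb{Z}$ for which $\mathrm{Tor}_i^S((\sigma^n)^*M,N)\neq 0$ is, up to addition and removal of a finite set, a finite union of arithmetic progressions of difference $p^r$ for some $r\ge 0$.
   Context: The Tate algebra $K\langle x_1,\ldots,x_d\rangle$ is the ring of power series $\sum_\alpha a_\alpha x^\alpha$ over $K$ with $|a_\alpha|\to 0$; its Gauss norm is $|\sum a_\alpha x^\alpha|=\max_\alpha|a_\alpha|$. For a ring automorphism $\tau$ of $S$ and an $S$-module $M$, $\tau^*M=S\otimes_{\tau,S}M$ is the base change of $M$ along $\tau$; concretely, if $M=S^e/\langle r_1,\ldots,r_m\rangle$ then $\tau^*M=S^e/\langle\tau(r_1),\ldots,\tau(r_m)\rangle$ (with $\tau$ applied coordinatewise). *)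

theory Defs
  imports Complex_Main "HOL-Library.Function_Algebras" "HOL-Computational_Algebra.Primes"
begin

text \<open>Concrete model. K is a field of type 'k with absolute value av.
Multi-indices in d variables are functions nat => nat vanishing at indices >= d.
An element of the Tate algebra is its coefficient function (nat => nat) => 'k.
Addition/subtraction of Tate elements is pointwise (Function_Algebras);
the ring multiplication is tmul (NOT the pointwise product).\<close>

type_synonym 'k tate = "(nat \<Rightarrow> nat) \<Rightarrow> 'k"
type_synonym 'k tvec = "nat \<Rightarrow> 'k tate"
type_synonym 'k tmat = "nat \<Rightarrow> nat \<Rightarrow> 'k tate"

definition nonarch_abs :: "('k::field \<Rightarrow> real) \<Rightarrow> bool" where
  "nonarch_abs av \<longleftrightarrow> (\<forall>x. 0 \<le> av x) \<and> (\<forall>x. av x = 0 \<longleftrightarrow> x = 0)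
     \<and> (\<forall>x y. av (x * y) = av x * av y) \<and> (\<forall>x y. av (x + y) \<le> max (av x) (av y))"

definition complete_abs :: "('k::field \<Rightarrow> real) \<Rightarrow> bool" where
  "complete_abs av \<longleftrightarrow> (\<forall>X :: nat \<Rightarrow> 'k.
     (\<forall>\<epsilon>>0. \<exists>N. \<forall>m\<ge>N. \<forall>n\<ge>N. av (X m - X n) < \<epsilon>) \<longrightarrow>
     (\<exists>L. \<forall>\<epsilon>>0. \<exists>N. \<forall>n\<ge>N. av (X n - L) < \<epsilon>))"

definition multi_idx :: "nat \<Rightarrow> (nat \<Rightarrow> nat) \<Rightarrow> bool" where
  "multi_idx d \<alpha> \<longleftrightarrow> (\<forall>i\<ge>d. \<alpha> i = 0)"

definition tate :: "('k::field \<Rightarrow> real) \<Rightarrow> nat \<Rightarrow> 'k tate set" where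
  "tate av d = {f. (\<forall>\<alpha>. \<not> multi_idx d \<alpha> \<longrightarrow> f \<alpha> = 0)
                 \<and> (\<forall>\<epsilon>>0. finite {\<alpha>. \<epsilon> \<le> av (f \<alpha>)})}"

definition tmul :: "'k::field tate \<Rightarrow> 'k tate \<Rightarrow> 'k tate" where
  "tmul f g = (\<lambda>\<alpha>. \<Sum>\<beta>\<in>{\<beta>. \<forall>i. \<beta> i \<le> \<alpha> i}. f \<beta> * g (\<lambda>i. \<alpha> i - \<beta> i))"

definition tconst :: "'k::field \<Rightarrow> 'k tate" where
  "tconst c = (\<lambda>\<alpha>. if \<alpha> = (\<lambda>_. 0) then c else 0)"

definition tvar :: "nat \<Rightarrow> 'k::field tate" where
  "tvar i = (\<lambda>\<alpha>. if \<alpha> = (\<lambda>j. if j = i then 1 else 0) then 1 else 0)"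

definition gauss :: "('k::field \<Rightarrow> real) \<Rightarrow> 'k tate \<Rightarrow> real" where
  "gauss av f = Sup (range (\<lambda>\<alpha>. av (f \<alpha>)))"

definition K_alg_aut :: "('k::field \<Rightarrow> real) \<Rightarrow> nat \<Rightarrow> ('k tate \<Rightarrow> 'k tate) \<Rightarrow> bool" where
  "K_alg_aut av d \<sigma> \<longleftrightarrow> bij_betw \<sigma> (tate av d) (tate av d)
     \<and> (\<forall>f\<in>tate av d. \<forall>g\<in>tate av d. \<sigma> (f + g) = \<sigma> f + \<sigma> g \<and> \<sigma> (tmul f g) = tmul (\<sigma> f) (\<sigma> g))
     \<and> (\<forall>c. \<sigma> (tconst c) = tconst c)"

definition spow :: "('k::field \<Rightarrow> real) \<Rightarrow> nat \<Rightarrow> ('k tate \<Rightarrow> 'k tate) \<Rightarrow> int \<Rightarrow> 'k tate \<Rightarrow> 'k tate" where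
  "spow av d \<sigma> n = (if 0 \<le> n then \<sigma> ^^ nat n else (inv_into (tate av d) \<sigma>) ^^ nat (- n))"

definition vecs :: "('k::field \<Rightarrow> real) \<Rightarrow> nat \<Rightarrow> nat \<Rightarrow> 'k tvec set" where
  "vecs av d k = {v. (\<forall>j<k. v j \<in> tate av d) \<and> (\<forall>j\<ge>k. v j = 0)}"

definition smul_vec :: "'k::field tate \<Rightarrow> 'k tvec \<Rightarrow> 'k tvec" where
  "smul_vec c v = (\<lambda>j. tmul c (v j))"

definition span :: "('k::field \<Rightarrow> real) \<Rightarrow> nat \<Rightarrow> 'k tvec set \<Rightarrow> 'k tvec set" where
  "span av d R = {v. \<exists>n (c :: nat \<Rightarrow> 'k tate) (r :: nat \<Rightarrow> 'k tvec).
       (\<forall>j<n. c j \<in> tate av d \<and> r j \<in> R) \<and> v = (\<Sum>j<n. smul_vec (c j) (r j))}"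

definition mats :: "('k::field \<Rightarrow> real) \<Rightarrow> nat \<Rightarrow> nat \<Rightarrow> nat \<Rightarrow> 'k tmat set" where
  "mats av d b a = {A. \<forall>l j. (l < b \<and> j < a \<longrightarrow> A l j \<in> tate av d)
                              \<and> (\<not> (l < b \<and> j < a) \<longrightarrow> A l j = 0)}"

definition mat_app :: "'k::field tmat \<Rightarrow> nat \<Rightarrow> 'k tvec \<Rightarrow> 'k tvec" where
  "mat_app A a v = (\<lambda>l. \<Sum>j<a. tmul (A l j) (v j))"

text \<open>Free resolution ... -> S^(k 2) --A 1--> S^(k 1) --A 0--> S^(k 0) -> M -> 0
  of M = S^e / span R.\<close>
definition free_res :: "('k::field \<Rightarrow> real) \<Rightarrow> nat \<Rightarrow> nat \<Rightarrow> 'k tvec set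
    \<Rightarrow> (nat \<Rightarrow> nat) \<Rightarrow> (nat \<Rightarrow> 'k tmat) \<Rightarrow> bool" where
  "free_res av d e R k A \<longleftrightarrow> k 0 = e
     \<and> (\<forall>j. A j \<in> mats av d (k j) (k (Suc j)))
     \<and> span av d R = mat_app (A 0) (k 1) ` vecs av d (k 1)
     \<and> (\<forall>j. {v \<in> vecs av d (k (Suc j)). mat_app (A j) (k (Suc j)) v = 0}
            = mat_app (A (Suc j)) (k (Suc (Suc j))) ` vecs av d (k (Suc (Suc j))))"

text \<open>Elements of F_j tensor N = N^(k j), N = S^f / span Q, represented by lifts in (S^f)^(k j).\<close>
definition nvecs :: "('k::field \<Rightarrow> real) \<Rightarrow> nat \<Rightarrow> nat \<Rightarrow> nat \<Rightarrow> (nat \<Rightarrow> 'k tvec) set" where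
  "nvecs av d k f = {u. (\<forall>l<k. u l \<in> vecs av d f) \<and> (\<forall>l\<ge>k. u l = 0)}"

definition tens_app :: "'k::field tmat \<Rightarrow> nat \<Rightarrow> (nat \<Rightarrow> 'k tvec) \<Rightarrow> (nat \<Rightarrow> 'k tvec)" where
  "tens_app A a u = (\<lambda>l. \<Sum>j<a. smul_vec (A l j) (u j))"

definition in_sub :: "('k::field \<Rightarrow> real) \<Rightarrow> nat \<Rightarrow> 'k tvec set \<Rightarrow> nat \<Rightarrow> (nat \<Rightarrow> 'k tvec) \<Rightarrow> bool" where
  "in_sub av d Q k u \<longleftrightarrow> (\<forall>l<k. u l \<in> span av d Q)"

text \<open>Tor_i^S(S^e/span R, S^f/span Q) is nonzero (i >= 1): homology at F_i of F tensor N,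
  computed from a free resolution F of the first module (independent of the choice).\<close>
definition tor_nonzero :: "('k::field \<Rightarrow> real) \<Rightarrow> nat \<Rightarrow> nat \<Rightarrow> 'k tvec set
    \<Rightarrow> nat \<Rightarrow> 'k tvec set \<Rightarrow> nat \<Rightarrow> bool" where
  "tor_nonzero av d e R f Q i \<longleftrightarrow> (\<exists>k A. free_res av d e R k A \<and>
     (\<exists>u\<in>nvecs av d (k i) f.
        in_sub av d Q (k (i - 1)) (tens_app (A (i - 1)) (k i) u)
        \<and> \<not> (\<exists>w\<in>nvecs av d (k (Suc i)) f. in_sub av d Q (k i) (u - tens_app (A i) (k (Suc i)) w))))"

text \<open>Base change tau^* M of M = S^e/span R: S^e/span(tau R).\<close>
definition pull_rel :: "('k tate \<Rightarrow> 'k tate) \<Rightarrow> 'k tvec set \<Rightarrow> 'k tvec set" where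
  "pull_rel \<tau> R = (\<lambda>r. (\<lambda>j. \<tau> (r j))) ` R"

end

(* The binomial series expresses the iterates sigma^n on the Tate algebra S as the values at z = n of
elements of S<z>: the difference operator sigma - 1 contracts by a factor below p^(-1/(p-1)), which
beats the denominators m!, and a K-algebra automorphism is automatically an isometry since the
Gauss norm can be read off from the units of S.

A free resolution of M, twisted by sigma^n and tensored with N, is therefore the fibre at z = n of a
single complex over S<z>. Up to finitely many n, its homology at z = n is the fibre H/(z - n)H of one
finitely generated S<z>-module H. After (z - a)-power torsion has been removed from H, multiplication
by z - a is strict for the quotient norm, and a Neumann series argument shows that the vanishing of
H/(z - n)H does not depend on n in a punctured neighbourhood of a. Compactness of the p-adic integers
turns this local constancy into finitely many residue classes modulo a power of p. *)
theory Submission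
  imports Defs "HOL-Library.Multiset"
begin

section \<open>Power series as a commutative ring\<close>

text \<open>The absolute value may be dense, so there is no uniformizer to reduce by, and all
  algebra over the Tate algebras is done with norm bounds. The engine is a theory of leading terms
  in which size comes first and a monomial order breaks ties. It yields finite generating sets that
  express every element with coefficients no larger than the element; closedness of submodules and
  the open-mapping estimates follow from them.

  The finitely many exceptional n come from torsion: a cycle of the fibre at n lifts to a cycle over
  S<z> if the cokernel of the outgoing map has no (z - n)-torsion, and fibres of cycles behave well
  if (z - n) w is a cycle only for cycles w. The neighbourhood of a is punctured because (z -
  a)-power torsion of H is seen by the fibre at a alone. The centre a ranges over all of K, since
  nested residue classes may converge to a p-adic number that is no integer.

  Nonvanishing of Tor is stated through the existence of some resolution, so the comparison theorem
  has to move it to one resolution whose twists serve every n at once.\<close>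

abbreviation fin_idx :: "(nat \<Rightarrow> nat) \<Rightarrow> bool" where
  "fin_idx \<alpha> \<equiv> finite {i. \<alpha> i \<noteq> 0}"

text \<open>A box of finite support is finite. For infinite support the one-point truncations of
  \<alpha> already form an infinite family below it.\<close>

lemma finite_below_iff: "finite {\<beta>. \<forall>i. \<beta> i \<le> (\<alpha> :: nat \<Rightarrow> nat) i} \<longleftrightarrow> fin_idx \<alpha>"
proof
  assume fin: "finite {\<beta>. \<forall>i. \<beta> i \<le> \<alpha> i}"
  let ?g = "\<lambda>i. (\<lambda>j. if j = i then \<alpha> j else 0)"
  have "inj_on ?g {i. \<alpha> i \<noteq> 0}"
  proof (rule inj_onI)
    fix x y assume "x \<in> {i. \<alpha> i \<noteq> 0}" and e: "?g x = ?g y"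
    thus "x = y" using fun_cong[OF e, of x] by (auto split: if_splits)
  qed
  moreover have "?g ` {i. \<alpha> i \<noteq> 0} \<subseteq> {\<beta>. \<forall>i. \<beta> i \<le> \<alpha> i}" by auto
  ultimately show "fin_idx \<alpha>" using fin by (meson finite_imageD finite_subset)
next
  assume fin: "fin_idx \<alpha>"
  define N where "N = Max (insert 0 (\<alpha> ` {i. \<alpha> i \<noteq> 0}))"
  have N: "\<alpha> i \<le> N" for i
    by (cases "\<alpha> i = 0") (simp_all add: N_def finite_imageI[OF fin] Max_ge_iff, use finite_imageI[OF fin] in \<open>auto intro!: Max_ge\<close>)
  have "{\<beta>. \<forall>i. \<beta> i \<le> \<alpha> i} \<subseteq> {f. \<forall>x. (x \<in> {i. \<alpha> i \<noteq> 0} \<longrightarrow> f x \<in> {..N}) \<and> (x \<notin> {i. \<alpha> i \<noteq> 0} \<longrightarrow> f x = 0)}"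
    using N by (auto intro: le_trans) (metis le_zero_eq)
  thus "finite {\<beta>. \<forall>i. \<beta> i \<le> \<alpha> i}"
    using finite_set_of_finite_funs[OF fin, of "{..N}" 0] finite_subset by blast
qed

lemma tmul_infinite: "\<not> fin_idx \<alpha> \<Longrightarrow> tmul f g \<alpha> = 0"
  unfolding tmul_def using finite_below_iff[of \<alpha>] by simp

lemma tmul_comm: "tmul f g = tmul g f"
proof
  fix \<alpha> :: "nat \<Rightarrow> nat"
  show "tmul f g \<alpha> = tmul g f \<alpha>"
    unfolding tmul_def
    by (rule sum.reindex_bij_witness[of _ "\<lambda>\<beta> i. \<alpha> i - \<beta> i" "\<lambda>\<beta> i. \<alpha> i - \<beta> i"])
       (auto simp: fun_eq_iff mult.commute)
qed

lemma tmul_assoc: "tmul (tmul f g) h = tmul f (tmul g h)"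
proof
  fix \<alpha> :: "nat \<Rightarrow> nat"
  show "tmul (tmul f g) h \<alpha> = tmul f (tmul g h) \<alpha>"
  proof (cases "fin_idx \<alpha>")
    case False thus ?thesis by (simp add: tmul_infinite)
  next
    case True
    let ?B = "\<lambda>\<alpha>::nat\<Rightarrow>nat. {\<beta>::nat\<Rightarrow>nat. \<forall>i. \<beta> i \<le> \<alpha> i}"
    have fB: "finite (?B \<beta>)" if "\<beta> \<in> ?B \<alpha>" for \<beta>
    proof -
      have "\<beta> i \<le> \<alpha> i" for i using that by simp
      hence "{i. \<beta> i \<noteq> 0} \<subseteq> {i. \<alpha> i \<noteq> 0}" by (auto intro: Suc_le_lessD less_le_trans)
      thus ?thesis using True finite_below_iff finite_subset by blast
    qed
    have fB': "finite (?B (\<lambda>i. \<alpha> i - \<beta> i))" for \<beta> by (rule fB) auto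
    have "tmul (tmul f g) h \<alpha> = (\<Sum>\<beta>\<in>?B \<alpha>. \<Sum>\<gamma>\<in>?B \<beta>. f \<gamma> * g (\<lambda>i. \<beta> i - \<gamma> i) * h (\<lambda>i. \<alpha> i - \<beta> i))"
      by (simp add: tmul_def sum_distrib_right)
    also have "\<dots> = (\<Sum>(\<beta>,\<gamma>)\<in>Sigma (?B \<alpha>) ?B. f \<gamma> * g (\<lambda>i. \<beta> i - \<gamma> i) * h (\<lambda>i. \<alpha> i - \<beta> i))"
      by (rule sum.Sigma) (use True fB finite_below_iff in blast)+
    also have "\<dots> = (\<Sum>(\<beta>,\<gamma>)\<in>Sigma (?B \<alpha>) (\<lambda>\<beta>. ?B (\<lambda>i. \<alpha> i - \<beta> i)).
        f \<beta> * (g \<gamma> * h (\<lambda>i. \<alpha> i - \<beta> i - \<gamma> i)))"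
    \<comment> \<open>Both sums run over the ways to write \<alpha> as an ordered sum of three
      indices: a pair \<gamma> \<le> \<beta> \<le> \<alpha> stands for the parts \<gamma>, \<beta> -
      \<gamma> and \<alpha> - \<beta>.\<close>
    proof (rule sum.reindex_bij_witness[of _ "\<lambda>(\<beta>,\<gamma>). ((\<lambda>i. \<beta> i + \<gamma> i), \<beta>)"
          "\<lambda>(\<beta>,\<gamma>). (\<gamma>, (\<lambda>i. \<beta> i - \<gamma> i))"], goal_cases)
      case (1 x) thus ?case by (auto simp: fun_eq_iff)
    next
      case (2 x) thus ?case by (auto simp: fun_eq_iff diff_le_mono) (meson le_trans)
    next
      case (3 x) thus ?case by (auto simp: fun_eq_iff)
    next
      case (4 x) thus ?case
        by (auto simp: fun_eq_iff) (metis (no_types) add.commute le_diff_conv2 le_trans diff_le_self le_add_diff_inverse2 add_le_mono1)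
    next
      case (5 x) thus ?case by (auto simp: mult.assoc)
    qed
    also have "\<dots> = (\<Sum>\<beta>\<in>?B \<alpha>. \<Sum>\<gamma>\<in>?B (\<lambda>i. \<alpha> i - \<beta> i). f \<beta> * (g \<gamma> * h (\<lambda>i. \<alpha> i - \<beta> i - \<gamma> i)))"
      by (rule sum.Sigma[symmetric]) (use True fB' finite_below_iff in blast)+
    also have "\<dots> = tmul f (tmul g h) \<alpha>"
      by (simp add: tmul_def sum_distrib_left)
    finally show ?thesis .
  qed
qed

lemma tmul_add_left: "tmul (f + g) h = tmul f h + tmul g h"
  by (rule ext) (simp add: tmul_def algebra_simps sum.distrib)

definition tmon :: "'k::field \<Rightarrow> (nat \<Rightarrow> nat) \<Rightarrow> 'k tate" where
  "tmon c \<gamma> = (\<lambda>\<alpha>. if \<alpha> = \<gamma> then c else 0)"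

lemma tmul_tmon:
  "tmul (tmon c \<gamma>) g \<alpha> = (if fin_idx \<alpha> \<and> (\<forall>i. \<gamma> i \<le> \<alpha> i) then c * g (\<lambda>i. \<alpha> i - \<gamma> i) else 0)"
proof (cases "fin_idx \<alpha>")
  case True
  hence "finite {\<beta>. \<forall>i. \<beta> i \<le> \<alpha> i}" by (simp add: finite_below_iff)
  have "tmul (tmon c \<gamma>) g \<alpha> = (\<Sum>\<beta>\<in>{\<beta>. \<forall>i. \<beta> i \<le> \<alpha> i}. if \<beta> = \<gamma> then c * g (\<lambda>i. \<alpha> i - \<beta> i) else 0)"
    unfolding tmul_def tmon_def by (rule sum.cong) auto
  also have "\<dots> = (if (\<forall>i. \<gamma> i \<le> \<alpha> i) then c * g (\<lambda>i. \<alpha> i - \<gamma> i) else 0)"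
    by (subst sum.delta) (use True finite_below_iff in auto)
  finally show ?thesis using True by simp
qed (simp add: tmul_infinite)

text \<open>At an index of infinite support \<^const>\<open>tmul\<close> sums over an infinite set and is 0, so \<open>tmul\<close> has a unit
  only on functions that vanish at such indices.\<close>
typedef (overloaded) 'k ps = "{f :: ('k::field) tate. \<forall>\<alpha>. \<not> fin_idx \<alpha> \<longrightarrow> f \<alpha> = 0}"
  morphisms cf Abs_ps
  by (rule exI[of _ "\<lambda>_. 0"]) auto

lemma cf_infinite: "\<not> fin_idx \<alpha> \<Longrightarrow> cf f \<alpha> = 0"
  using cf[of f] by auto

lemma ps_eqI: "(\<And>\<alpha>. cf f \<alpha> = cf g \<alpha>) \<Longrightarrow> f = g"
  by (metis cf_inject ext)

setup_lifting type_definition_ps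

instantiation ps :: (field) comm_ring_1
begin

lift_definition zero_ps :: "'a ps" is "0" by (simp add: zero_fun_def)
lift_definition one_ps :: "'a ps" is "tmon 1 (\<lambda>_. 0)" by (auto simp: tmon_def)
lift_definition plus_ps :: "'a ps \<Rightarrow> 'a ps \<Rightarrow> 'a ps" is "(+)" by (simp add: plus_fun_def)
lift_definition minus_ps :: "'a ps \<Rightarrow> 'a ps \<Rightarrow> 'a ps" is "(-)" by (simp add: fun_diff_def)
lift_definition uminus_ps :: "'a ps \<Rightarrow> 'a ps" is "uminus" by (simp add: fun_Compl_def)
lift_definition times_ps :: "'a ps \<Rightarrow> 'a ps \<Rightarrow> 'a ps" is tmul by (simp add: tmul_infinite)

instance
proof
  fix a b c :: "'a ps"
  show "a * b * c = a * (b * c)" by transfer (rule tmul_assoc)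
  show "a * b = b * a" by transfer (rule tmul_comm)
  show "1 * a = a" by transfer (auto simp: tmul_tmon fun_eq_iff)
  show "(a + b) * c = a * c + b * c" by transfer (rule tmul_add_left)
  show "(0::'a ps) \<noteq> 1" by transfer (auto simp: fun_eq_iff tmon_def)
qed (transfer; simp add: algebra_simps)+

end

lemma cf_0 [simp]: "cf 0 \<alpha> = 0" by transfer simp
lemma cf_1: "cf 1 \<alpha> = (if \<alpha> = (\<lambda>_. 0) then 1 else 0)" by transfer (simp add: tmon_def)
lemma cf_add [simp]: "cf (f + g) \<alpha> = cf f \<alpha> + cf g \<alpha>" by transfer simp
lemma cf_diff [simp]: "cf (f - g) \<alpha> = cf f \<alpha> - cf g \<alpha>" by transfer simp
lemma cf_uminus [simp]: "cf (- f) \<alpha> = - cf f \<alpha>" by transfer simp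
lemma cf_mult: "cf (f * g) = tmul (cf f) (cf g)" by transfer simp
lemma cf_sum [simp]: "cf (sum f A) \<alpha> = (\<Sum>x\<in>A. cf (f x) \<alpha>)"
  by (induction A rule: infinite_finite_induct) auto

lift_definition mon :: "'k::field \<Rightarrow> (nat \<Rightarrow> nat) \<Rightarrow> 'k ps"
  is "\<lambda>c \<gamma>. if fin_idx \<gamma> then tmon c \<gamma> else 0"
  by (auto simp: tmon_def)

lemma cf_mon: "cf (mon c \<gamma>) \<alpha> = (if \<alpha> = \<gamma> \<and> fin_idx \<gamma> then c else 0)"
  by transfer (simp add: tmon_def)

lemma cf_mon_mult:
  assumes "fin_idx \<gamma>"
  shows "cf (mon c \<gamma> * f) \<alpha> = (if \<forall>i. \<gamma> i \<le> \<alpha> i then c * cf f (\<lambda>i. \<alpha> i - \<gamma> i) else 0)"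
proof (cases "fin_idx \<alpha>")
  case True thus ?thesis using assms by transfer (simp add: tmul_tmon)
next
  case False
  have "\<not> fin_idx (\<lambda>i. \<alpha> i - \<gamma> i)"
  proof
    assume "fin_idx (\<lambda>i. \<alpha> i - \<gamma> i)"
    hence "finite ({i. \<alpha> i - \<gamma> i \<noteq> 0} \<union> {i. \<gamma> i \<noteq> 0})" using assms by simp
    hence "fin_idx \<alpha>" by (rule rev_finite_subset) auto
    thus False using False by simp
  qed
  thus ?thesis using False by (simp add: cf_infinite)
qed

definition Cc :: "'k::field \<Rightarrow> 'k ps" where "Cc c = mon c (\<lambda>_. 0)"
definition X :: "nat \<Rightarrow> 'k::field ps" where "X i = mon 1 (\<lambda>j. if j = i then 1 else 0)"

lemma cf_Cc: "cf (Cc c) \<alpha> = (if \<alpha> = (\<lambda>_. 0) then c else 0)"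
  by (simp add: Cc_def cf_mon)
lemma cf_Cc_mult [simp]: "cf (Cc c * f) \<alpha> = c * cf f \<alpha>"
  by (simp add: Cc_def cf_mon_mult)
lemma Cc_0 [simp]: "Cc 0 = 0" by (rule ps_eqI) (simp add: cf_Cc)
lemma Cc_1 [simp]: "Cc 1 = 1" by (rule ps_eqI) (simp add: cf_Cc cf_1)
lemma Cc_add: "Cc (a + b) = Cc a + Cc b" by (rule ps_eqI) (simp add: cf_Cc)
lemma Cc_diff: "Cc (a - b) = Cc a - Cc b" by (rule ps_eqI) (simp add: cf_Cc)
lemma Cc_uminus: "Cc (- a) = - Cc a" by (rule ps_eqI) (simp add: cf_Cc)
lemma Cc_mult: "Cc (a * b) = Cc a * Cc b" by (rule ps_eqI) (simp add: cf_Cc)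
lemma Cc_power: "Cc (a ^ n) = Cc a ^ n" by (induction n) (simp_all add: Cc_mult)
lemma Cc_prod: "Cc (prod g A) = (\<Prod>x\<in>A. Cc (g x))"
  by (induction A rule: infinite_finite_induct) (auto simp: Cc_mult)
lemma Cc_inverse: "c \<noteq> 0 \<Longrightarrow> Cc (inverse c) * Cc c = 1" by (simp flip: Cc_mult)

lemma mon_mult: "fin_idx \<alpha> \<Longrightarrow> fin_idx \<beta> \<Longrightarrow> mon a \<alpha> * mon b \<beta> = mon (a * b) (\<lambda>i. \<alpha> i + \<beta> i)"
proof (rule ps_eqI)
  fix \<gamma> assume f: "fin_idx \<alpha>" "fin_idx \<beta>"
  have f': "fin_idx (\<lambda>i. \<alpha> i + \<beta> i)"
    using finite_UnI[OF f] by (rule rev_finite_subset) auto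
  have "((\<forall>i. \<alpha> i \<le> \<gamma> i) \<and> (\<lambda>i. \<gamma> i - \<alpha> i) = \<beta>) = (\<gamma> = (\<lambda>i. \<alpha> i + \<beta> i))"
    by (auto simp: fun_eq_iff) (metis le_add_diff_inverse)
  thus "cf (mon a \<alpha> * mon b \<beta>) \<gamma> = cf (mon (a * b) (\<lambda>i. \<alpha> i + \<beta> i)) \<gamma>"
    using f f' by (auto simp: cf_mon_mult cf_mon)
qed

lemma mon_eq_Cc_mult: "mon c \<alpha> = Cc c * mon 1 \<alpha>"
  by (rule ps_eqI) (simp add: cf_mon)

section \<open>The Tate subrings\<close>

lemma multi_idx_fin: "multi_idx d \<alpha> \<Longrightarrow> fin_idx \<alpha>"
  unfolding multi_idx_def by (rule finite_subset[of _ "{..<d}"]) (auto simp: not_less[symmetric])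

lemma multi_idx_add: "multi_idx d \<alpha> \<Longrightarrow> multi_idx d \<beta> \<Longrightarrow> multi_idx d (\<lambda>i. \<alpha> i + \<beta> i)"
  by (simp add: multi_idx_def)

lemma multi_idx_mono: "multi_idx d \<alpha> \<Longrightarrow> d \<le> d' \<Longrightarrow> multi_idx d' \<alpha>"
  by (simp add: multi_idx_def)

locale nonarch =
  fixes av :: "'k::field \<Rightarrow> real"
  assumes na: "nonarch_abs av" and complete: "complete_abs av"
begin

lemma av_nonneg [simp]: "0 \<le> av x" using na by (simp add: nonarch_abs_def)
lemma av_eq_0 [simp]: "av x = 0 \<longleftrightarrow> x = 0" using na by (simp add: nonarch_abs_def)
lemma av_0 [simp]: "av 0 = 0" by simp
lemma av_pos [simp]: "0 < av x \<longleftrightarrow> x \<noteq> 0"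
  by (metis av_eq_0 av_nonneg less_eq_real_def order_less_irrefl)
lemma av_le_0 [simp]: "av x \<le> 0 \<longleftrightarrow> x = 0"
proof -
  have "av x \<le> 0 \<longleftrightarrow> av x = 0" using av_nonneg[of x] by linarith
  thus ?thesis by simp
qed
lemma av_mult: "av (x * y) = av x * av y" using na by (simp add: nonarch_abs_def)
lemma av_add: "av (x + y) \<le> max (av x) (av y)" using na by (simp add: nonarch_abs_def)
lemma av_1 [simp]: "av 1 = 1"
  by (metis av_eq_0 av_mult mult_cancel_left2 mult_1_right zero_neq_one)
lemma av_minus [simp]: "av (- x) = av x"
proof -
  have "av (- 1) * av (- 1) = 1" by (simp flip: av_mult)
  hence "av (- 1) = 1" by (metis av_nonneg abs_of_nonneg abs_1 real_sqrt_abs2 real_sqrt_one)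
  thus ?thesis using av_mult[of "- 1" x] by simp
qed
lemma av_diff: "av (x - y) \<le> max (av x) (av y)" using av_add[of x "- y"] by simp
lemma av_diff_commute: "av (x - y) = av (y - x)" using av_minus[of "x - y"] by simp
lemma av_power: "av (x ^ n) = av x ^ n" by (induction n) (simp_all add: av_mult)
lemma av_inverse: "av (inverse x) = inverse (av x)"
proof (cases "x = 0")
  case False
  hence "av (inverse x) * av x = 1" by (simp flip: av_mult)
  thus ?thesis by (metis inverse_unique inverse_inverse_eq)
qed simp

lemma av_add_le: "av x \<le> r \<Longrightarrow> av y \<le> r \<Longrightarrow> av (x + y) \<le> r" using av_add[of x y] by linarith
lemma av_diff_le: "av x \<le> r \<Longrightarrow> av y \<le> r \<Longrightarrow> av (x - y) \<le> r" using av_diff[of x y] by linarith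
lemma av_add_less: "av x < r \<Longrightarrow> av y < r \<Longrightarrow> av (x + y) < r" using av_add[of x y] by linarith
lemma av_sum_le: "0 \<le> r \<Longrightarrow> (\<And>x. x \<in> A \<Longrightarrow> av (f x) \<le> r) \<Longrightarrow> av (sum f A) \<le> r"
  by (induction A rule: infinite_finite_induct) (auto intro: av_add_le)
lemma av_sum_less: "0 < r \<Longrightarrow> (\<And>x. x \<in> A \<Longrightarrow> av (f x) < r) \<Longrightarrow> av (sum f A) < r"
  by (induction A rule: infinite_finite_induct) (auto intro: av_add_less)
text \<open>The isosceles principle; the lower bound comes from writing \<open>x\<close> as
  \<open>(x + y) - y\<close>.\<close>

lemma av_add_eq: assumes "av y < av x" shows "av (x + y) = av x"
  using av_add[of x y] av_diff[of "x + y" y] assms by simp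
lemma av_of_nat: "av (of_nat n) \<le> 1" by (induction n) (auto intro: av_add_le)
lemma av_of_int: "av (of_int n) \<le> 1"
  by (cases n rule: int_cases2) (auto simp: av_of_nat)

text \<open>An upper bound on the Gauss norm, read coefficientwise; it avoids suprema and makes
  sense for every power series, also outside the Tate algebra.\<close>

definition bd :: "real \<Rightarrow> 'k ps \<Rightarrow> bool" where "bd r f \<longleftrightarrow> (\<forall>\<alpha>. av (cf f \<alpha>) \<le> r)"

lemma bdD: "bd r f \<Longrightarrow> av (cf f \<alpha>) \<le> r" by (simp add: bd_def)
lemma bd_nonneg: "bd r f \<Longrightarrow> 0 \<le> r" by (meson av_nonneg bdD order_trans)
lemma bd_mono: "bd r f \<Longrightarrow> r \<le> s \<Longrightarrow> bd s f" by (meson bd_def order_trans)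
lemma bd_zero [simp]: "bd r 0 \<longleftrightarrow> 0 \<le> r" by (simp add: bd_def)
lemma bd_add: "bd r f \<Longrightarrow> bd r g \<Longrightarrow> bd r (f + g)" by (simp add: bd_def av_add_le)
lemma bd_diff: "bd r f \<Longrightarrow> bd r g \<Longrightarrow> bd r (f - g)" by (simp add: bd_def av_diff_le)
lemma bd_uminus [simp]: "bd r (- f) = bd r f" by (simp add: bd_def)
lemma bd_sum: "0 \<le> r \<Longrightarrow> (\<And>x. x \<in> A \<Longrightarrow> bd r (f x)) \<Longrightarrow> bd r (sum f A)"
  by (simp add: bd_def av_sum_le)
lemma bd_mult: assumes "bd r f" "bd s g" shows "bd (r * s) (f * g)"
  unfolding bd_def cf_mult tmul_def
  using assms bd_nonneg[OF assms(1)] bd_nonneg[OF assms(2)]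
  by (auto intro!: av_sum_le mult_mono bdD simp: av_mult)
lemma bd_mult1: "bd r f \<Longrightarrow> bd 1 g \<Longrightarrow> bd r (f * g)" using bd_mult[of r f 1 g] by simp
lemma bd_mon [simp]: "av c \<le> r \<Longrightarrow> bd r (mon c \<alpha>)"
  by (auto simp: bd_def cf_mon intro: order_trans[OF av_nonneg])
lemma bd_Cc: "av c \<le> r \<Longrightarrow> bd r (Cc c)" by (simp add: Cc_def)
lemma bd_one [simp]: "bd 1 1" using bd_Cc[of 1 1] by simp
lemma bd_X [simp]: "bd 1 (X i)" by (simp add: X_def)
lemma bd_prod: "(\<And>x. x \<in> A \<Longrightarrow> bd 1 (f x)) \<Longrightarrow> bd 1 (prod f A)"
  by (induction A rule: infinite_finite_induct) (auto intro: bd_mult1)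
lemma bd_Cc_mult: "bd r f \<Longrightarrow> bd (av c * r) (Cc c * f)" by (simp add: bd_mult bd_Cc)

lemma bd_all_zero: assumes "\<And>\<epsilon>. \<epsilon> > 0 \<Longrightarrow> bd \<epsilon> f" shows "f = 0"
proof (rule ps_eqI)
  fix \<alpha>
  have "av (cf f \<alpha>) \<le> 0" by (rule field_le_epsilon) (use assms bdD in simp)
  thus "cf f \<alpha> = cf 0 \<alpha>" by simp
qed

lemma geom_small: assumes "0 \<le> \<theta>" "\<theta> < 1" "\<epsilon> > 0" shows "\<exists>k. \<theta> ^ k * (r::real) < \<epsilon>"
proof -
  have "(\<lambda>k. \<theta> ^ k * r) \<longlonglongrightarrow> 0 * r" by (intro tendsto_intros LIMSEQ_power_zero) (use assms in simp)
  hence "eventually (\<lambda>k. \<theta> ^ k * r < \<epsilon>) sequentially" using assms(3) by (simp add: order_tendstoD(2))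
  thus ?thesis by (auto simp: eventually_sequentially)
qed

lemma bd_geom_zero: assumes "0 \<le> \<theta>" "\<theta> < 1" "\<And>k::nat. bd (\<theta> ^ k * r) f" shows "f = 0"
  by (rule bd_all_zero) (meson assms bd_mono geom_small less_imp_le)

text \<open>One type carries all numbers of variables: S is \<open>T d\<close>, and S<z> is
  \<open>T (Suc d)\<close> with z = \<open>X d\<close>, so that S is literally a subset of
  S<z>.\<close>

definition T :: "nat \<Rightarrow> 'k ps set" where "T D = {f. cf f \<in> tate av D}"

lemma T_iff: "f \<in> T D \<longleftrightarrow> (\<forall>\<alpha>. \<not> multi_idx D \<alpha> \<longrightarrow> cf f \<alpha> = 0) \<and> (\<forall>\<epsilon>>0. finite {\<alpha>. \<epsilon> \<le> av (cf f \<alpha>)})"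
  by (simp add: T_def tate_def)
lemma T_idx: "f \<in> T D \<Longrightarrow> cf f \<alpha> \<noteq> 0 \<Longrightarrow> multi_idx D \<alpha>" by (auto simp: T_iff)
lemma T_fin: "f \<in> T D \<Longrightarrow> \<epsilon> > 0 \<Longrightarrow> finite {\<alpha>. \<epsilon> \<le> av (cf f \<alpha>)}" by (simp add: T_iff)
lemma T_mono: "D \<le> D' \<Longrightarrow> T D \<subseteq> T D'" by (auto simp: T_iff) (meson multi_idx_mono)
lemma T_mon: "multi_idx D \<gamma> \<Longrightarrow> mon c \<gamma> \<in> T D"
  by (auto simp: T_iff cf_mon intro: finite_subset[of _ "{\<gamma>}"])
lemma T_Cc [simp]: "Cc c \<in> T D" by (simp add: Cc_def T_mon multi_idx_def)
lemma T_0 [simp]: "0 \<in> T D" using T_Cc[of 0 D] by simp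
lemma T_1 [simp]: "1 \<in> T D" using T_Cc[of 1 D] by simp
lemma T_X: "i < D \<Longrightarrow> X i \<in> T D" by (simp add: X_def T_mon multi_idx_def)
lemma T_add: assumes "f \<in> T D" "g \<in> T D" shows "f + g \<in> T D"
proof -
  have "finite {\<alpha>. \<epsilon> \<le> av (cf (f + g) \<alpha>)}" if "\<epsilon> > 0" for \<epsilon>
  proof (rule finite_subset)
    show "{\<alpha>. \<epsilon> \<le> av (cf (f + g) \<alpha>)} \<subseteq> {\<alpha>. \<epsilon> \<le> av (cf f \<alpha>)} \<union> {\<alpha>. \<epsilon> \<le> av (cf g \<alpha>)}"
    proof
      fix \<alpha> assume "\<alpha> \<in> {\<alpha>. \<epsilon> \<le> av (cf (f + g) \<alpha>)}"
      thus "\<alpha> \<in> {\<alpha>. \<epsilon> \<le> av (cf f \<alpha>)} \<union> {\<alpha>. \<epsilon> \<le> av (cf g \<alpha>)}"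
        using av_add_less[of "cf f \<alpha>" \<epsilon> "cf g \<alpha>"] by fastforce
    qed
  qed (use assms that in \<open>simp add: T_fin\<close>)
  thus ?thesis using assms by (auto simp: T_iff)
qed
lemma T_uminus: "f \<in> T D \<Longrightarrow> - f \<in> T D" by (simp add: T_iff)
lemma T_diff: "f \<in> T D \<Longrightarrow> g \<in> T D \<Longrightarrow> f - g \<in> T D" using T_add[of f D "- g"] T_uminus by simp
lemma T_sum: "(\<And>x. x \<in> A \<Longrightarrow> f x \<in> T D) \<Longrightarrow> sum f A \<in> T D"
  by (induction A rule: infinite_finite_induct) (auto intro: T_add)

lemma T_bdd: assumes "f \<in> T D" shows "\<exists>r>0. bd r f"
proof -
  let ?S = "insert 1 ((\<lambda>\<alpha>. av (cf f \<alpha>)) ` {\<alpha>. 1 \<le> av (cf f \<alpha>)})"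
  have fin: "finite ?S" using T_fin[OF assms, of 1] by simp
  have "av (cf f \<alpha>) \<le> Max ?S" for \<alpha>
  proof (cases "1 \<le> av (cf f \<alpha>)")
    case False
    have "1 \<le> Max ?S" using fin by (intro Max_ge) auto
    thus ?thesis using False by linarith
  qed (intro Max_ge fin, auto)
  moreover have "1 \<le> Max ?S" using fin by (intro Max_ge) auto
  ultimately show ?thesis by (intro exI[of _ "Max ?S"]) (auto simp: bd_def)
qed

text \<open>A large coefficient of the product needs a summand that is at least as large. Since both
  factors are bounded, the two coefficients in that summand are large as well, and there are
  finitely many such pairs.\<close>

lemma T_mult: assumes f: "f \<in> T D" and g: "g \<in> T D" shows "f * g \<in> T D"
proof -
  obtain r s where r: "r > 0" "bd r f" and s: "s > 0" "bd s g" using T_bdd f g by blast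
  have "cf (f * g) \<alpha> = 0" if "\<not> multi_idx D \<alpha>" for \<alpha>
    unfolding cf_mult tmul_def
  proof (intro sum.neutral ballI)
    fix \<beta> assume \<beta>: "\<beta> \<in> {\<beta>. \<forall>i. \<beta> i \<le> \<alpha> i}"
    have "\<not> (multi_idx D \<beta> \<and> multi_idx D (\<lambda>i. \<alpha> i - \<beta> i))"
    proof
      assume m: "multi_idx D \<beta> \<and> multi_idx D (\<lambda>i. \<alpha> i - \<beta> i)"
      have "\<alpha> = (\<lambda>i. \<beta> i + (\<alpha> i - \<beta> i))" using \<beta> by auto
      thus False using multi_idx_add[of D \<beta> "\<lambda>i. \<alpha> i - \<beta> i"] m that by simp
    qed
    thus "cf f \<beta> * cf g (\<lambda>i. \<alpha> i - \<beta> i) = 0" using T_idx f g by fastforce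
  qed
  moreover have "finite {\<alpha>. \<epsilon> \<le> av (cf (f * g) \<alpha>)}" if \<epsilon>: "\<epsilon> > 0" for \<epsilon>
  proof (rule finite_subset)
    let ?F = "{\<alpha>. \<epsilon> / s \<le> av (cf f \<alpha>)}" and ?G = "{\<alpha>. \<epsilon> / r \<le> av (cf g \<alpha>)}"
    show "finite ((\<lambda>(\<beta>,\<gamma>) i. \<beta> i + \<gamma> i) ` (?F \<times> ?G))"
      using T_fin[OF f, of "\<epsilon> / s"] T_fin[OF g, of "\<epsilon> / r"] \<epsilon> r s by auto
    show "{\<alpha>. \<epsilon> \<le> av (cf (f * g) \<alpha>)} \<subseteq> (\<lambda>(\<beta>,\<gamma>) i. \<beta> i + \<gamma> i) ` (?F \<times> ?G)"
    proof
      fix \<alpha> assume "\<alpha> \<in> {\<alpha>. \<epsilon> \<le> av (cf (f * g) \<alpha>)}"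
      hence "\<not> av (cf (f * g) \<alpha>) < \<epsilon>" by auto
      then obtain \<beta> where \<beta>: "\<forall>i. \<beta> i \<le> \<alpha> i" "\<epsilon> \<le> av (cf f \<beta>) * av (cf g (\<lambda>i. \<alpha> i - \<beta> i))"
        unfolding cf_mult tmul_def using av_sum_less[OF \<epsilon>]
        by (smt (verit, best) av_mult mem_Collect_eq)
      have "\<epsilon> \<le> av (cf f \<beta>) * s"
        using \<beta>(2) bdD[OF s(2)] by (meson av_nonneg mult_left_mono order_trans)
      moreover have "\<epsilon> \<le> r * av (cf g (\<lambda>i. \<alpha> i - \<beta> i))"
        using \<beta>(2) bdD[OF r(2)] by (meson av_nonneg mult_right_mono order_trans)
      ultimately have "(\<beta>, \<lambda>i. \<alpha> i - \<beta> i) \<in> ?F \<times> ?G" using r s by (auto simp: field_simps)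
      moreover have "\<alpha> = (\<lambda>i. \<beta> i + (\<alpha> i - \<beta> i))" using \<beta> by auto
      ultimately show "\<alpha> \<in> (\<lambda>(\<beta>,\<gamma>) i. \<beta> i + \<gamma> i) ` (?F \<times> ?G)"
        by (auto intro!: image_eqI[of _ _ "(\<beta>, \<lambda>i. \<alpha> i - \<beta> i)"])
    qed
  qed
  ultimately show ?thesis by (auto simp: T_iff)
qed
lemma T_prod: "(\<And>x. x \<in> A \<Longrightarrow> f x \<in> T D) \<Longrightarrow> prod f A \<in> T D"
  by (induction A rule: infinite_finite_induct) (auto intro: T_mult)
lemma T_power: "f \<in> T D \<Longrightarrow> f ^ n \<in> T D"
  by (induction n) (auto intro: T_mult)

text \<open>Density of the polynomials with an explicit approximation; statements about monomials
  extend to \<open>T D\<close> through it.\<close>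

lemma T_trunc:
  assumes "f \<in> T D" "\<epsilon> > 0"
  defines "F \<equiv> {\<alpha>. \<epsilon> \<le> av (cf f \<alpha>)}"
  shows "finite F" "\<And>\<alpha>. \<alpha> \<in> F \<Longrightarrow> multi_idx D \<alpha>" "bd \<epsilon> (f - (\<Sum>\<alpha>\<in>F. mon (cf f \<alpha>) \<alpha>))"
proof -
  show fin: "finite F" using T_fin assms by simp
  show mi: "multi_idx D \<alpha>" if "\<alpha> \<in> F" for \<alpha>
  proof -
    have "cf f \<alpha> \<noteq> 0" using that assms(2) by (auto simp: F_def)
    thus ?thesis using T_idx assms(1) by blast
  qed
  have "(\<Sum>\<alpha>\<in>F. cf (mon (cf f \<alpha>) \<alpha>) \<beta>) = (\<Sum>\<alpha>\<in>F. if \<alpha> = \<beta> then cf f \<alpha> else 0)" for \<beta>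
    using mi multi_idx_fin by (intro sum.cong) (auto simp: cf_mon)
  hence "cf (\<Sum>\<alpha>\<in>F. mon (cf f \<alpha>) \<alpha>) \<beta> = (if \<beta> \<in> F then cf f \<beta> else 0)" for \<beta>
    using fin by simp
  thus "bd \<epsilon> (f - (\<Sum>\<alpha>\<in>F. mon (cf f \<alpha>) \<alpha>))"
    using assms(2) by (auto simp: bd_def F_def)
qed

text \<open>Only finitely many coefficients are as large as a given nonzero one, so the Gauss norm
  is attained and is the absolute value of a scalar.\<close>

lemma T_max:
  assumes "f \<in> T D" "f \<noteq> 0"
  obtains \<alpha> where "cf f \<alpha> \<noteq> 0" "bd (av (cf f \<alpha>)) f"
proof -
  obtain \<beta> where \<beta>: "cf f \<beta> \<noteq> 0" using assms(2) by (metis cf_0 ps_eqI)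
  let ?S = "(\<lambda>\<alpha>. av (cf f \<alpha>)) ` {\<alpha>. av (cf f \<beta>) \<le> av (cf f \<alpha>)}"
  have fin: "finite ?S" and "?S \<noteq> {}" using T_fin[OF assms(1), of "av (cf f \<beta>)"] \<beta> by auto
  hence "Max ?S \<in> ?S" by (rule Max_in)
  then obtain \<alpha> where \<alpha>: "Max ?S = av (cf f \<alpha>)" "av (cf f \<beta>) \<le> av (cf f \<alpha>)" by auto
  have "av (cf f \<gamma>) \<le> av (cf f \<alpha>)" for \<gamma>
    using Max_ge[OF fin, of "av (cf f \<gamma>)"] \<alpha> by (cases "av (cf f \<beta>) \<le> av (cf f \<gamma>)") auto
  moreover have "cf f \<alpha> \<noteq> 0" using \<alpha>(2) \<beta> by (metis av_0 av_le_0)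
  ultimately show ?thesis using that by (auto simp: bd_def)
qed

text \<open>Completeness of \<open>T D\<close> for series of geometric decay; completeness of the
  field enters the development only here. The estimate of the tails is part of the result because
  later arguments need norm bounds for the limit.\<close>

lemma T_series:
  assumes \<theta>: "0 \<le> \<theta>" "\<theta> < 1" and a: "\<And>k::nat. a k \<in> T D" "\<And>k. bd (\<theta> ^ k * r) (a k)"
  obtains s where "s \<in> T D" "\<And>k. bd (\<theta> ^ k * r) (s - (\<Sum>i<k. a i))"
proof -
  have r: "0 \<le> r" using bd_nonneg[OF a(2)[of 0]] by simp
  define S where "S \<alpha> n = (\<Sum>i<n. cf (a i) \<alpha>)" for \<alpha> n
  have dec: "\<theta> ^ k * r \<le> \<theta> ^ N * r" if "N \<le> k" for k N
    using \<theta> r that by (intro mult_right_mono power_decreasing) auto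
  have S1: "av (S \<alpha> n - S \<alpha> k) \<le> \<theta> ^ k * r" if "k \<le> n" for \<alpha> n k
  proof -
    have "S \<alpha> n - S \<alpha> k = (\<Sum>i=k..<n. cf (a i) \<alpha>)"
      unfolding S_def lessThan_atLeast0 using that by (simp add: sum_diff_nat_ivl)
    also have "av \<dots> \<le> \<theta> ^ k * r"
      using \<theta> r by (intro av_sum_le) (auto intro: order_trans[OF bdD[OF a(2)] dec])
    finally show ?thesis .
  qed
  have "\<exists>L. \<forall>\<epsilon>>0. \<exists>N. \<forall>n\<ge>N. av (S \<alpha> n - L) < \<epsilon>" for \<alpha>
  proof -
    have "\<exists>N. \<forall>m\<ge>N. \<forall>n\<ge>N. av (S \<alpha> m - S \<alpha> n) < \<epsilon>" if "\<epsilon> > 0" for \<epsilon>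
    proof -
      obtain N where N: "\<theta> ^ N * r < \<epsilon>" using geom_small[OF \<theta> \<open>\<epsilon> > 0\<close>] by blast
      have "av (S \<alpha> m - S \<alpha> n) < \<epsilon>" if "m \<ge> N" "n \<ge> N" for m n
        using S1[of N m \<alpha>] S1[of N n \<alpha>] av_diff[of "S \<alpha> m - S \<alpha> N" "S \<alpha> n - S \<alpha> N"] N that by simp
      thus ?thesis by blast
    qed
    thus ?thesis using complete unfolding complete_abs_def by blast
  qed
  then obtain L where L: "\<And>\<alpha> \<epsilon>. \<epsilon> > 0 \<Longrightarrow> \<exists>N. \<forall>n\<ge>N. av (S \<alpha> n - L \<alpha>) < \<epsilon>" by metis
  have L1: "av (L \<alpha> - S \<alpha> k) \<le> \<theta> ^ k * r" for \<alpha> k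
  proof (rule field_le_epsilon)
    fix \<epsilon> :: real assume "\<epsilon> > 0"
    then obtain N where N: "\<And>n. n \<ge> N \<Longrightarrow> av (S \<alpha> n - L \<alpha>) < \<epsilon>" using L by blast
    have "av (L \<alpha> - S \<alpha> k) \<le> max (av (L \<alpha> - S \<alpha> (max N k))) (av (S \<alpha> (max N k) - S \<alpha> k))"
      using av_add[of "L \<alpha> - S \<alpha> (max N k)" "S \<alpha> (max N k) - S \<alpha> k"] by simp
    moreover have "av (L \<alpha> - S \<alpha> (max N k)) < \<epsilon>" using N by (subst av_diff_commute) simp
    moreover have "0 \<le> \<theta> ^ k * r" using \<theta> r by simp
    ultimately show "av (L \<alpha> - S \<alpha> k) \<le> \<theta> ^ k * r + \<epsilon>" using S1[of k "max N k" \<alpha>] \<open>\<epsilon> > 0\<close> by simp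
  qed
  have L0: "L \<alpha> = 0" if "\<not> multi_idx D \<alpha>" for \<alpha>
  proof -
    have "S \<alpha> k = 0" for k using that a(1) T_idx by (fastforce simp: S_def intro!: sum.neutral)
    hence "av (L \<alpha>) \<le> \<theta> ^ k * r" for k using L1[of \<alpha> k] by simp
    hence "\<not> av (L \<alpha>) > 0" using geom_small[OF \<theta>, of "av (L \<alpha>)" r] by (metis leD)
    thus ?thesis by simp
  qed
  define s where "s = Abs_ps L"
  have cs: "cf s = L" unfolding s_def using L0 multi_idx_fin by (subst Abs_ps_inverse) auto
  have b: "bd (\<theta> ^ k * r) (s - (\<Sum>i<k. a i))" for k
    using L1[of _ k] by (simp add: bd_def cs S_def)
  \<comment> \<open>The tail stays below \<epsilon>, so a large coefficient of the limit is a large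
    coefficient of one fixed partial sum.\<close>
  have "finite {\<alpha>. \<epsilon> \<le> av (L \<alpha>)}" if \<epsilon>: "\<epsilon> > 0" for \<epsilon>
  proof -
    obtain k where k: "\<theta> ^ k * r < \<epsilon>" using geom_small[OF \<theta> \<epsilon>] by blast
    have "\<epsilon> \<le> av (S \<alpha> k)" if "\<epsilon> \<le> av (L \<alpha>)" for \<alpha>
      using av_add[of "L \<alpha> - S \<alpha> k" "S \<alpha> k"] L1[of \<alpha> k] k that by simp
    moreover have "finite {\<alpha>. \<epsilon> \<le> av (S \<alpha> k)}"
      using T_fin[OF T_sum[of "{..<k}" a D] \<epsilon>] a(1) by (simp add: S_def)
    ultimately show ?thesis
      using finite_subset[of "{\<alpha>. \<epsilon> \<le> av (L \<alpha>)}" "{\<alpha>. \<epsilon> \<le> av (S \<alpha> k)}"] by blast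
  qed
  hence "s \<in> T D" using L0 by (auto simp: T_iff cs)
  thus ?thesis using b that by blast
qed

end

section \<open>Dickson's lemma and leading terms\<close>

text \<open>There is always a monotone subsequence; one that decreases in the naturals is constant
  from its minimum on.\<close>

lemma nat_monoseq_inc:
  fixes t :: "nat \<Rightarrow> nat"
  shows "\<exists>\<phi>::nat \<Rightarrow> nat. strict_mono \<phi> \<and> (\<forall>m n. m \<le> n \<longrightarrow> t (\<phi> m) \<le> t (\<phi> n))"
proof -
  obtain f where f: "strict_mono f" "monoseq (\<lambda>n. t (f n))" using seq_monosub by blast
  show ?thesis
  proof (cases "\<forall>m n. m \<le> n \<longrightarrow> t (f m) \<le> t (f n)")
    case False
    hence dec: "m \<le> n \<Longrightarrow> t (f n) \<le> t (f m)" for m n using f(2) by (auto simp: monoseq_def)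
    obtain N where N: "\<And>n. t (f N) \<le> t (f n)" using ex_has_least_nat[of "\<lambda>_. True" _ "\<lambda>n. t (f n)"] by auto
    have "strict_mono (\<lambda>n. f (n + N))" using f(1) by (simp add: strict_mono_def)
    moreover have "t (f (n + N)) = t (f N)" for n using N[of "n + N"] dec[of N "n + N"] by simp
    ultimately have "strict_mono (\<lambda>n. f (n + N)) \<and> (\<forall>m n. m \<le> n \<longrightarrow> t (f (m + N)) \<le> t (f (n + N)))" by simp
    thus ?thesis by (rule exI[of _ "\<lambda>n. f (n + N)"])
  qed (use f in blast)
qed

text \<open>Induction on the number of variables: the first D coordinates are made increasing along
  \<phi>, and a further subsequence \<psi> takes care of the last one.\<close>

lemma dickson_seq:
  "(\<And>n. multi_idx D (s n)) \<Longrightarrow>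
    \<exists>\<phi>::nat \<Rightarrow> nat. strict_mono \<phi> \<and> (\<forall>m n i. m \<le> n \<longrightarrow> s (\<phi> m) i \<le> s (\<phi> n) i)"
proof (induction D arbitrary: s)
  case 0
  hence "s n i = 0" for n i by (simp add: multi_idx_def)
  thus ?case by (auto simp: strict_mono_def intro!: exI[of _ id])
next
  case (Suc D)
  have "multi_idx D ((s n)(D := 0))" for n
    using Suc.prems[of n] by (auto simp: multi_idx_def)
  from Suc.IH[of "\<lambda>n. (s n)(D := 0)", OF this]
  obtain \<phi> :: "nat \<Rightarrow> nat" where \<phi>': "strict_mono \<phi> \<and>
      (\<forall>m n i. m \<le> n \<longrightarrow> ((s (\<phi> m))(D := 0)) i \<le> ((s (\<phi> n))(D := 0)) i)" ..
  have \<phi>: "strict_mono \<phi>" using \<phi>' ..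
  from nat_monoseq_inc[of "\<lambda>n. s (\<phi> n) D"]
  obtain \<psi> :: "nat \<Rightarrow> nat" where \<psi>': "strict_mono \<psi> \<and> (\<forall>m n. m \<le> n \<longrightarrow> s (\<phi> (\<psi> m)) D \<le> s (\<phi> (\<psi> n)) D)" ..
  have \<psi>: "strict_mono \<psi>" "\<And>m n. m \<le> n \<Longrightarrow> s (\<phi> (\<psi> m)) D \<le> s (\<phi> (\<psi> n)) D" using \<psi>' by auto
  have "s (\<phi> (\<psi> m)) i \<le> s (\<phi> (\<psi> n)) i" if "m \<le> n" for m n i
  proof (cases "i = D")
    case False
    have "\<psi> m \<le> \<psi> n" using \<psi>(1) that by (simp add: strict_mono_less_eq)
    hence "((s (\<phi> (\<psi> m)))(D := 0)) i \<le> ((s (\<phi> (\<psi> n)))(D := 0)) i" using \<phi>' by (elim conjE allE impE)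
    thus ?thesis using False by simp
  qed (use \<psi> that in simp)
  moreover have "strict_mono (\<lambda>n. \<phi> (\<psi> n))" using \<phi> \<psi>(1) by (simp add: strict_mono_def)
  ultimately show ?case by (intro exI[of _ "\<lambda>n. \<phi> (\<psi> n)"] conjI allI impI)
qed

text \<open>\<open>F\<close> is the set of minimal elements. It is an antichain, and an infinite
  antichain would contradict the increasing subsequence; below each \<alpha> an element of least
  total degree is minimal.\<close>

lemma dickson:
  assumes L: "\<And>\<alpha>. \<alpha> \<in> L \<Longrightarrow> multi_idx D \<alpha>"
  shows "\<exists>F. finite F \<and> F \<subseteq> L \<and> (\<forall>\<alpha>\<in>L. \<exists>\<beta>\<in>F. \<forall>i. \<beta> i \<le> \<alpha> i)"
proof -
  define F where "F = {\<alpha>\<in>L. \<forall>\<beta>\<in>L. (\<forall>i. \<beta> i \<le> \<alpha> i) \<longrightarrow> \<beta> = \<alpha>}"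
  have "finite F"
  proof (rule ccontr)
    assume "infinite F"
    then obtain s :: "nat \<Rightarrow> nat \<Rightarrow> nat" where s: "inj s" "range s \<subseteq> F"
      using infinite_countable_subset by blast
    have sF: "s n \<in> F" for n using s(2) by auto
    hence "multi_idx D (s n)" for n using L by (simp add: F_def)
    from dickson_seq[of D s, OF this]
    obtain \<phi> :: "nat \<Rightarrow> nat" where \<phi>': "strict_mono \<phi> \<and> (\<forall>m n i. m \<le> n \<longrightarrow> s (\<phi> m) i \<le> s (\<phi> n) i)" ..
    have \<phi>: "strict_mono \<phi>" "\<And>i. s (\<phi> 0) i \<le> s (\<phi> 1) i" using \<phi>' by auto
    have "s (\<phi> 0) = s (\<phi> 1)" using sF[of "\<phi> 0"] sF[of "\<phi> 1"] \<phi>(2) by (auto simp: F_def)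
    hence "\<phi> 0 = \<phi> 1" using s(1) by (simp add: inj_eq)
    thus False using strict_mono_less[OF \<phi>(1), of 0 1] by simp
  qed
  moreover have "\<exists>\<beta>\<in>F. \<forall>i. \<beta> i \<le> \<alpha> i" if "\<alpha> \<in> L" for \<alpha>
  proof -
    obtain \<beta> where \<beta>: "\<beta> \<in> L" "\<forall>i. \<beta> i \<le> \<alpha> i"
        "\<And>\<gamma>. \<gamma> \<in> L \<Longrightarrow> \<forall>i. \<gamma> i \<le> \<alpha> i \<Longrightarrow> (\<Sum>i<D. \<beta> i) \<le> (\<Sum>i<D. \<gamma> i)"
      using ex_has_least_nat[of "\<lambda>\<beta>. \<beta> \<in> L \<and> (\<forall>i. \<beta> i \<le> \<alpha> i)" \<alpha> "\<lambda>\<beta>. \<Sum>i<D. \<beta> i"] \<open>\<alpha> \<in> L\<close> by auto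
    have "\<gamma> = \<beta>" if \<gamma>: "\<gamma> \<in> L" "\<forall>i. \<gamma> i \<le> \<beta> i" for \<gamma>
    proof
      fix i
      have "(\<Sum>i<D. \<gamma> i) = (\<Sum>i<D. \<beta> i)"
      proof (rule antisym)
        show "(\<Sum>i<D. \<gamma> i) \<le> (\<Sum>i<D. \<beta> i)" using \<gamma>(2) by (intro sum_mono) simp
        show "(\<Sum>i<D. \<beta> i) \<le> (\<Sum>i<D. \<gamma> i)"
          using \<beta>(2) \<gamma> by (intro \<beta>(3)) (auto intro: order_trans)
      qed
      hence "i < D \<Longrightarrow> \<gamma> i = \<beta> i" using sum_mono_inv[of \<gamma> "{..<D}" \<beta> i] \<gamma> by simp
      moreover have "i \<ge> D \<Longrightarrow> \<gamma> i = \<beta> i" using L[OF \<gamma>(1)] L[OF \<beta>(1)] by (simp add: multi_idx_def)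
      ultimately show "\<gamma> i = \<beta> i" by linarith
    qed
    thus ?thesis using \<beta> by (auto simp: F_def)
  qed
  ultimately show ?thesis unfolding F_def by blast
qed

section \<open>Monomial orders and their well-foundedness\<close>

definition lex_less :: "(nat \<Rightarrow> nat) \<Rightarrow> (nat \<Rightarrow> nat) \<Rightarrow> bool" where
  "lex_less \<alpha> \<beta> \<longleftrightarrow> (\<exists>i. \<alpha> i < \<beta> i \<and> (\<forall>j<i. \<alpha> j = \<beta> j))"

lemma lex_less_irrefl [simp]: "\<not> lex_less \<alpha> \<alpha>" by (simp add: lex_less_def)

lemma lex_less_trans: assumes "lex_less \<alpha> \<beta>" "lex_less \<beta> \<gamma>" shows "lex_less \<alpha> \<gamma>"
proof -
  obtain i where i: "\<alpha> i < \<beta> i" "\<forall>j<i. \<alpha> j = \<beta> j" using assms(1) by (auto simp: lex_less_def)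
  obtain i' where i': "\<beta> i' < \<gamma> i'" "\<forall>j<i'. \<beta> j = \<gamma> j" using assms(2) by (auto simp: lex_less_def)
  show ?thesis unfolding lex_less_def
    using i i' by (intro exI[of _ "min i i'"]) (cases i i' rule: linorder_cases; auto)
qed

lemma lex_less_total: assumes "\<alpha> \<noteq> \<beta>" shows "lex_less \<alpha> \<beta> \<or> lex_less \<beta> \<alpha>"
proof -
  obtain i where "\<alpha> i \<noteq> \<beta> i" using assms by (auto simp: fun_eq_iff)
  then obtain i where "\<alpha> i \<noteq> \<beta> i" "\<forall>j<i. \<alpha> j = \<beta> j"
    using ex_least_nat_le[of "\<lambda>i. \<alpha> i \<noteq> \<beta> i"] by (metis (no_types, lifting))
  thus ?thesis unfolding lex_less_def by (metis linorder_neqE_nat)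
qed

lemma lex_less_add [simp]: "lex_less (\<lambda>i. \<gamma> i + \<alpha> i) (\<lambda>i. \<gamma> i + \<beta> i) \<longleftrightarrow> lex_less \<alpha> \<beta>"
  by (simp add: lex_less_def)

text \<open>With D coordinates this is the lexicographic order on lists of length D. The restriction
  matters: the unit vectors with increasing index descend forever.\<close>

lemma wf_lex_less: "wf {(\<alpha>, \<beta>). lex_less \<alpha> \<beta> \<and> multi_idx D \<alpha> \<and> multi_idx D \<beta>}"
proof (rule wf_subset)
  show "wf (inv_image (lexn less_than D) (\<lambda>\<alpha>. map \<alpha> [0..<D]))"
    by (intro wf_inv_image wf_lexn wf_less_than)
  show "{(\<alpha>, \<beta>). lex_less \<alpha> \<beta> \<and> multi_idx D \<alpha> \<and> multi_idx D \<beta>} \<subseteq> \<dots>"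
  proof clarify
    fix \<alpha> \<beta> assume "lex_less \<alpha> \<beta>" and m: "multi_idx D \<alpha>" "multi_idx D \<beta>"
    then obtain i where i: "\<alpha> i < \<beta> i" "\<forall>j<i. \<alpha> j = \<beta> j" by (auto simp: lex_less_def)
    have "i < D" using i(1) m by (metis multi_idx_def less_irrefl not_le)
    hence split: "[0..<D] = [0..<i] @ i # [Suc i..<D]" 
      by (metis id_take_nth_drop length_upt diff_zero nth_upt add_0 take_upt drop_upt less_imp_le_nat)
    have "map \<alpha> [0..<i] = map \<beta> [0..<i]" using i(2) by simp
    thus "(\<alpha>, \<beta>) \<in> inv_image (lexn less_than D) (\<lambda>\<alpha>. map \<alpha> [0..<D])"
      using i(1) unfolding in_inv_image lexn_conv
      by (auto simp: split intro!: exI[of _ "map \<beta> [0..<i]"]) (use \<open>i < D\<close> in auto)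
  qed
qed

type_synonym mterm = "(nat \<Rightarrow> nat) \<times> nat \<times> nat"

text \<open>The term-over-position order of Groebner basis theory, with a matrix position (row,
  column) in place of a basis vector.\<close>

definition term_less :: "mterm \<Rightarrow> mterm \<Rightarrow> bool" where
  "term_less x y \<longleftrightarrow> lex_less (fst x) (fst y) \<or> fst x = fst y \<and>
    (fst (snd x) < fst (snd y) \<or> fst (snd x) = fst (snd y) \<and> snd (snd x) < snd (snd y))"

lemma term_less_irrefl [simp]: "\<not> term_less x x" by (simp add: term_less_def)
lemma term_less_trans: "term_less x y \<Longrightarrow> term_less y z \<Longrightarrow> term_less x z"
  by (auto simp: term_less_def dest: lex_less_trans)
lemma term_less_total: "x \<noteq> y \<Longrightarrow> term_less x y \<or> term_less y x"
  using lex_less_total[of "fst x" "fst y"] by (cases x; cases y) (auto simp: term_less_def)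
lemma term_less_add: "term_less (\<lambda>i. \<gamma> i + \<alpha> i, s) (\<lambda>i. \<gamma> i + \<beta> i, t) \<longleftrightarrow> term_less (\<alpha>, s) (\<beta>, t)"
  by (auto simp: term_less_def fun_eq_iff)

lemma wf_term_less: "wf {(x, y). term_less x y \<and> multi_idx D (fst x) \<and> multi_idx D (fst y)}"
proof (rule wf_subset)
  show "wf ({(\<alpha>, \<beta>). lex_less \<alpha> \<beta> \<and> multi_idx D \<alpha> \<and> multi_idx D \<beta>} <*lex*> (less_than <*lex*> less_than))"
    by (intro wf_lex_prod wf_lex_less wf_less_than)
qed (auto simp: term_less_def)

text \<open>The Dershowitz--Manna order on finite sets: an element is traded for smaller ones.\<close>
lemma wf_finite_sets:
  assumes "wf r"
  shows "wf {(A', A). finite A \<and> finite A' \<and> (\<exists>\<mu>\<in>A. \<mu> \<notin> A' \<and> (\<forall>x\<in>A'. x \<in> A \<or> (x, \<mu>) \<in> r))}"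
proof (rule wf_subset)
  show "wf (inv_image (mult r) mset_set)" using assms by (intro wf_inv_image wf_mult)
  show "{(A', A). finite A \<and> finite A' \<and> (\<exists>\<mu>\<in>A. \<mu> \<notin> A' \<and> (\<forall>x\<in>A'. x \<in> A \<or> (x, \<mu>) \<in> r))} \<subseteq> \<dots>"
  proof clarify
    fix A' A \<mu> assume A: "finite A" "finite A'" "\<mu> \<in> A" "\<mu> \<notin> A'" "\<forall>x\<in>A'. x \<in> A \<or> (x, \<mu>) \<in> r"
    have "mset_set (A \<inter> A') + mset_set (A - A') = mset_set A"
         "mset_set (A \<inter> A') + mset_set (A' - A) = mset_set A'"
      using A by (subst mset_set_Union[symmetric]; auto intro: arg_cong[of _ _ mset_set])+
    moreover have "(mset_set (A \<inter> A') + mset_set (A' - A), mset_set (A \<inter> A') + mset_set (A - A')) \<in> mult r"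
      by (rule one_step_implies_mult) (use A in \<open>auto simp: mset_set_empty_iff\<close>)
    ultimately show "(A', A) \<in> inv_image (mult r) mset_set" by simp
  qed
qed

text \<open>One type serves for the maps of a complex and for module elements: an element of (S^f)^k
  is a matrix with k rows and f columns, and maps act by multiplication from the left.\<close>

type_synonym 'k pmat = "nat \<Rightarrow> nat \<Rightarrow> 'k ps"

definition scal :: "'k::field ps \<Rightarrow> 'k pmat \<Rightarrow> 'k pmat" where "scal c M = (\<lambda>l j. c * M l j)"
definition lin_comb :: "nat \<Rightarrow> (nat \<Rightarrow> 'k::field ps) \<Rightarrow> (nat \<Rightarrow> 'k pmat) \<Rightarrow> 'k pmat" where
  "lin_comb m h g = (\<lambda>l t. \<Sum>j<m. h j * g j l t)"
definition mcoeff :: "'k::field pmat \<Rightarrow> mterm \<Rightarrow> 'k" where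
  "mcoeff M t = cf (M (fst (snd t)) (snd (snd t))) (fst t)"

lemma lin_comb_0 [simp]: "lin_comb 0 h g = 0" by (simp add: lin_comb_def fun_eq_iff)
lemma lin_comb_Suc: "lin_comb (Suc m) h g = lin_comb m h g + scal (h m) (g m)"
  by (simp add: lin_comb_def scal_def fun_eq_iff)
lemma lin_comb_zero [simp]: "lin_comb m (\<lambda>_. 0) g = 0" by (simp add: lin_comb_def fun_eq_iff)
lemma lin_comb_upd: "k < m \<Longrightarrow> lin_comb m (h(k := h k + c)) g = lin_comb m h g + scal c (g k)"
proof (rule ext, rule ext)
  fix l t assume k: "k < m"
  have "(\<Sum>j<m. (h(k := h k + c)) j * g j l t) = (\<Sum>j<m. h j * g j l t + (if j = k then c * g k l t else 0))"
    by (intro sum.cong) (auto simp: algebra_simps)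
  thus "lin_comb m (h(k := h k + c)) g l t = (lin_comb m h g + scal c (g k)) l t"
    using k by (simp add: lin_comb_def scal_def sum.distrib)
qed
lemma lin_comb_diff_left: "lin_comb m (\<lambda>j. h j - h' j) g = lin_comb m h g - lin_comb m h' g"
  by (simp add: lin_comb_def fun_eq_iff algebra_simps sum_subtractf)
lemma lin_comb_add_left: "lin_comb m (\<lambda>j. h j + h' j) g = lin_comb m h g + lin_comb m h' g"
  by (simp add: lin_comb_def fun_eq_iff algebra_simps sum.distrib)
lemma lin_comb_diff_right: "lin_comb m h (\<lambda>j. g j - g' j) = lin_comb m h g - lin_comb m h g'"
  by (simp add: lin_comb_def fun_eq_iff algebra_simps sum_subtractf)
lemma scal_simps:
  "scal c (u + v) = scal c u + scal c v" "scal c (u - v) = scal c u - scal c v"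
  "scal (a + b) u = scal a u + scal b u" "scal (a - b) u = scal a u - scal b u"
  "scal (a * b) u = scal a (scal b u)" "scal 1 u = u" "scal 0 u = 0" "scal c 0 = 0"
  by (auto simp: scal_def fun_eq_iff algebra_simps)
lemma scal_minus1: "scal (- 1) u = - u" by (simp add: scal_def fun_eq_iff)
lemma mcoeff_diff: "mcoeff (u - v) t = mcoeff u t - mcoeff v t" by (simp add: mcoeff_def)

section \<open>Bounded matrices, submodules and leading terms\<close>

context nonarch
begin

definition Mat :: "nat \<Rightarrow> nat \<Rightarrow> nat \<Rightarrow> 'k pmat set" where
  "Mat D a b = {M. (\<forall>l j. l < a \<and> j < b \<longrightarrow> M l j \<in> T D) \<and> (\<forall>l j. \<not> (l < a \<and> j < b) \<longrightarrow> M l j = 0)}"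
definition mbd :: "real \<Rightarrow> 'k pmat \<Rightarrow> bool" where "mbd r M \<longleftrightarrow> (\<forall>l j. bd r (M l j))"
definition submod :: "nat \<Rightarrow> nat \<Rightarrow> nat \<Rightarrow> 'k pmat set \<Rightarrow> bool" where
  "submod D a b P \<longleftrightarrow> P \<subseteq> Mat D a b \<and> 0 \<in> P \<and> (\<forall>u\<in>P. \<forall>v\<in>P. u + v \<in> P) \<and> (\<forall>c\<in>T D. \<forall>u\<in>P. scal c u \<in> P)"

lemma Mat_T: "M \<in> Mat D a b \<Longrightarrow> M l j \<in> T D" by (cases "l < a \<and> j < b") (auto simp: Mat_def)
lemma MatI: "(\<And>l j. l < a \<Longrightarrow> j < b \<Longrightarrow> M l j \<in> T D) \<Longrightarrow> (\<And>l j. \<not> (l < a \<and> j < b) \<Longrightarrow> M l j = 0) \<Longrightarrow> M \<in> Mat D a b"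
  by (simp add: Mat_def)
lemma Mat_out: "M \<in> Mat D a b \<Longrightarrow> \<not> (l < a \<and> j < b) \<Longrightarrow> M l j = 0" by (simp add: Mat_def)
lemma submod_Mat: "submod D a b (Mat D a b)"
  by (auto simp: submod_def Mat_def scal_def intro: T_add T_mult)
lemma submodD:
  assumes "submod D a b P"
  shows "u \<in> P \<Longrightarrow> u \<in> Mat D a b" "0 \<in> P" "u \<in> P \<Longrightarrow> v \<in> P \<Longrightarrow> u + v \<in> P"
    "c \<in> T D \<Longrightarrow> u \<in> P \<Longrightarrow> scal c u \<in> P" "u \<in> P \<Longrightarrow> - u \<in> P" "u \<in> P \<Longrightarrow> v \<in> P \<Longrightarrow> u - v \<in> P"
proof -
  show neg: "u \<in> P \<Longrightarrow> - u \<in> P" for u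
    using assms T_uminus[OF T_1] by (auto simp: submod_def simp flip: scal_minus1)
  show "u \<in> P \<Longrightarrow> v \<in> P \<Longrightarrow> u - v \<in> P"
    using neg[of v] assms unfolding submod_def by (metis add_uminus_conv_diff)
qed (use assms in \<open>auto simp: submod_def\<close>)
lemma submod_lin_comb:
  assumes "submod D a b P" "\<And>j. j < m \<Longrightarrow> h j \<in> T D" "\<And>j. j < m \<Longrightarrow> g j \<in> P"
  shows "lin_comb m h g \<in> P"
  using assms(2,3) by (induction m) (auto simp: lin_comb_Suc intro: submodD[OF assms(1)])

lemma mbdD: "mbd r M \<Longrightarrow> bd r (M l j)" by (simp add: mbd_def)
lemma mbd_mono: "mbd r M \<Longrightarrow> r \<le> s \<Longrightarrow> mbd s M" by (meson bd_mono mbd_def)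
lemma mbd_nonneg: "mbd r M \<Longrightarrow> 0 \<le> r" by (meson bd_nonneg mbd_def)
lemma mbd_add: "mbd r u \<Longrightarrow> mbd r v \<Longrightarrow> mbd r (u + v)" by (simp add: mbd_def bd_add)
lemma mbd_diff: "mbd r u \<Longrightarrow> mbd r v \<Longrightarrow> mbd r (u - v)" by (simp add: mbd_def bd_diff)
lemma mbd_zero [simp]: "mbd r 0 \<longleftrightarrow> 0 \<le> r" by (simp add: mbd_def)
lemma mbd_scal: "bd r c \<Longrightarrow> mbd s u \<Longrightarrow> mbd (r * s) (scal c u)" by (simp add: mbd_def scal_def bd_mult)
lemma mbd_lin_comb:
  assumes "0 \<le> r" "0 \<le> s" "\<And>j. j < m \<Longrightarrow> bd r (h j)" "\<And>j. j < m \<Longrightarrow> mbd s (g j)"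
  shows "mbd (r * s) (lin_comb m h g)"
proof -
  have "bd (r * s) (lin_comb m h g l t)" for l t
    unfolding lin_comb_def using assms(1-3) mbdD[OF assms(4)] by (intro bd_sum bd_mult) auto
  thus ?thesis by (simp add: mbd_def)
qed
lemma mbd_iff: "mbd r M \<longleftrightarrow> (\<forall>t. av (mcoeff M t) \<le> r)" by (auto simp: mbd_def bd_def mcoeff_def)
lemma mbd_zero_iff: "mbd 0 M \<longleftrightarrow> M = 0"
  by (auto simp: mbd_def bd_def fun_eq_iff intro!: ps_eqI)

lemma Mat_fin:
  assumes "M \<in> Mat D a b" "\<epsilon> > 0"
  shows "finite {t. \<epsilon> \<le> av (mcoeff M t)}"
proof (rule finite_subset)
  let ?S = "\<lambda>l j. {\<alpha>. \<epsilon> \<le> av (cf (M l j) \<alpha>)}"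
  show "finite (\<Union>l<a. \<Union>j<b. (\<lambda>\<alpha>. (\<alpha>, l, j)) ` ?S l j)"
    using T_fin[OF Mat_T[OF assms(1)] assms(2)] by auto
  show "{t. \<epsilon> \<le> av (mcoeff M t)} \<subseteq> (\<Union>l<a. \<Union>j<b. (\<lambda>\<alpha>. (\<alpha>, l, j)) ` ?S l j)"
  proof clarify
    fix \<alpha> l j assume t: "\<epsilon> \<le> av (mcoeff M (\<alpha>, l, j))"
    have "l < a \<and> j < b"
    proof (rule ccontr)
      assume "\<not> (l < a \<and> j < b)"
      thus False using Mat_out[OF assms(1)] t assms(2) by (auto simp: mcoeff_def)
    qed
    thus "(\<alpha>, l, j) \<in> (\<Union>l<a. \<Union>j<b. (\<lambda>\<alpha>. (\<alpha>, l, j)) ` ?S l j)" using t by (auto simp: mcoeff_def)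
  qed
qed

lemma Mat_trm:
  assumes "M \<in> Mat D a b" "mcoeff M (\<alpha>, l, j) \<noteq> 0"
  shows "multi_idx D \<alpha>" "l < a" "j < b"
proof -
  have nz: "cf (M l j) \<alpha> \<noteq> 0" using assms(2) by (simp add: mcoeff_def)
  thus "multi_idx D \<alpha>" using T_idx Mat_T[OF assms(1)] by blast
  show "l < a" "j < b" using Mat_out[OF assms(1), of l j] nz by (cases "l < a \<and> j < b"; force)+
qed

lemma Mat_bdd: assumes "M \<in> Mat D a b" obtains r where "r > 0" "mbd r M"
proof -
  let ?S = "insert 1 ((\<lambda>t. av (mcoeff M t)) ` {t. 1 \<le> av (mcoeff M t)})"
  have fin: "finite ?S" using Mat_fin[OF assms, of 1] by simp
  have 1: "1 \<le> Max ?S" using fin by (intro Max_ge) auto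
  have "av (mcoeff M t) \<le> Max ?S" for t
  proof (cases "1 \<le> av (mcoeff M t)")
    case False
    thus ?thesis using 1 by linarith
  qed (intro Max_ge fin, auto)
  thus ?thesis using 1 that[of "Max ?S"] by (auto simp: mbd_iff)
qed

text \<open>The leading index in the sense suited to Tate algebras: size decides first, and among
  coefficients of maximal size the order \<open>lt\<close> picks the largest index. The index type
  is left open so that the notion covers both series and matrices.\<close>

definition is_lm :: "('x \<Rightarrow> 'x \<Rightarrow> bool) \<Rightarrow> ('x \<Rightarrow> 'k) \<Rightarrow> 'x \<Rightarrow> bool" where
  "is_lm lt w \<mu> \<longleftrightarrow> w \<mu> \<noteq> 0 \<and> (\<forall>x. av (w x) \<le> av (w \<mu>)) \<and> (\<forall>x. lt \<mu> x \<longrightarrow> av (w x) < av (w \<mu>))"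

text \<open>The coefficients of maximal size are finite in number, and a transitive irreflexive
  relation has a maximal element on a finite nonempty set.\<close>

lemma ex_is_lm:
  assumes fin: "\<And>\<epsilon>. \<epsilon> > 0 \<Longrightarrow> finite {x. \<epsilon> \<le> av (w x)}" and x0: "w x0 \<noteq> 0"
    and irr: "\<And>x. \<not> lt x x" and trans: "\<And>x y z. lt x y \<Longrightarrow> lt y z \<Longrightarrow> lt x z"
  shows "\<exists>\<mu>. is_lm lt w \<mu>"
proof -
  define S where "S = {x. av (w x0) \<le> av (w x)}"
  have S: "finite S" "x0 \<in> S" using fin[of "av (w x0)"] x0 by (auto simp: S_def)
  define M where "M = Max ((\<lambda>x. av (w x)) ` S)"
  have M: "av (w x) \<le> M" for x
  proof (cases "x \<in> S")
    case True thus ?thesis using S by (auto simp: M_def)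
  next
    case False
    have "av (w x0) \<le> M" using S by (auto simp: M_def)
    thus ?thesis using False by (simp add: S_def)
  qed
  have "M \<in> (\<lambda>x. av (w x)) ` S" unfolding M_def using S by (intro Max_in) auto
  then obtain x1 where x1: "x1 \<in> S" "av (w x1) = M" by auto
  define S' where "S' = {x \<in> S. av (w x) = M}"
  have "finite S'" "S' \<noteq> {}" using S x1 by (auto simp: S'_def)
  moreover have "transp_on S' lt" "asymp_on S' lt"
    using irr trans unfolding transp_on_def asymp_on_def by blast+
  ultimately obtain \<mu> where \<mu>: "\<mu> \<in> S'" "\<forall>x\<in>S'. x \<noteq> \<mu> \<longrightarrow> \<not> lt \<mu> x"
    using Finite_Set.bex_max_element[of S' lt] by blast
  have "is_lm lt w \<mu>"
    unfolding is_lm_def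
  proof (intro conjI allI impI)
    show "w \<mu> \<noteq> 0" using \<mu>(1) x0 by (auto simp: S'_def S_def)
    show "av (w x) \<le> av (w \<mu>)" for x using M \<mu>(1) by (auto simp: S'_def)
    fix x assume lt: "lt \<mu> x"
    hence "x \<notin> S'" using \<mu>(2) irr by auto
    hence "av (w x) \<noteq> M" using \<mu>(1) M[of x0] by (auto simp: S'_def S_def)
    thus "av (w x) < av (w \<mu>)" using M[of x] \<mu>(1) by (auto simp: S'_def)
  qed
  thus ?thesis ..
qed

text \<open>The coefficient rings may differ: in the division by \<open>X d - Cc n\<close> the remainder is taken from
  \<open>T d\<close> and the quotient from \<open>T (Suc d)\<close>.\<close>
lemma lin_comb_iterate:
  fixes g :: "nat \<Rightarrow> 'k pmat"
  assumes g: "\<And>j. j < m \<Longrightarrow> mbd 1 (g j)" and \<theta>: "0 \<le> \<theta>" "\<theta> < 1"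
    and step: "\<And>v r. v \<in> P \<Longrightarrow> mbd r v \<Longrightarrow>
        \<exists>h. (\<forall>j<m. h j \<in> T (D j) \<and> bd r (h j)) \<and> v - lin_comb m h g \<in> P \<and> mbd (\<theta> * r) (v - lin_comb m h g)"
    and v: "v \<in> P" "mbd r v"
  shows "\<exists>h. (\<forall>j<m. h j \<in> T (D j) \<and> bd r (h j)) \<and> v = lin_comb m h g"
proof -
  obtain H where H: "\<And>v r. v \<in> P \<Longrightarrow> mbd r v \<Longrightarrow> (\<forall>j<m. H v r j \<in> T (D j) \<and> bd r (H v r j)) \<and>
      v - lin_comb m (H v r) g \<in> P \<and> mbd (\<theta> * r) (v - lin_comb m (H v r) g)"
    using step by metis
  \<comment> \<open>\<open>V k\<close> is the remainder after k rounds, and the corrections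
    \<open>h k\<close> of all rounds are summed, for each generator separately, by
    \<open>T_series\<close>.\<close>
  define V where "V = rec_nat v (\<lambda>k V. V - lin_comb m (H V (\<theta> ^ k * r)) g)"
  define h where "h k = H (V k) (\<theta> ^ k * r)" for k
  have V0: "V 0 = v" and VS: "V (Suc k) = V k - lin_comb m (h k) g" for k by (simp_all add: V_def h_def)
  have V: "V k \<in> P \<and> mbd (\<theta> ^ k * r) (V k)" for k
  proof (induction k)
    case (Suc k)
    thus ?case using H[of "V k" "\<theta> ^ k * r"] unfolding VS h_def power_Suc mult.assoc by blast
  qed (simp add: V0 v)
  have h: "h k j \<in> T (D j)" "bd (\<theta> ^ k * r) (h k j)" if "j < m" for k j
    using H[of "V k" "\<theta> ^ k * r"] V[of k] that by (auto simp: h_def)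
  have "\<exists>s. s \<in> T (D j) \<and> (\<forall>k. bd (\<theta> ^ k * r) (s - (\<Sum>i<k. h i j)))" if "j < m" for j
    by (rule T_series[OF \<theta>, of "\<lambda>k. h k j" "D j" r, OF h(1)[OF that] h(2)[OF that]]) blast
  then obtain s where s: "\<And>j. j < m \<Longrightarrow> s j \<in> T (D j)"
      "\<And>j k. j < m \<Longrightarrow> bd (\<theta> ^ k * r) (s j - (\<Sum>i<k. h i j))" by metis
  have r: "0 \<le> r" using v mbd_nonneg by blast
  have sum: "v - V k = lin_comb m (\<lambda>j. \<Sum>i<k. h i j) g" for k
  proof (induction k)
    case (Suc k)
    have "v - V (Suc k) = (v - V k) + lin_comb m (h k) g" by (simp add: VS)
    thus ?case unfolding Suc.IH by (simp flip: lin_comb_add_left)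
  qed (simp add: V0)
  have "mbd (\<theta> ^ k * r) (v - lin_comb m s g)" for k
  proof -
    have "v - lin_comb m s g = V k - lin_comb m (\<lambda>j. s j - (\<Sum>i<k. h i j)) g"
      unfolding lin_comb_diff_left sum[symmetric] by simp
    moreover have "mbd (\<theta> ^ k * r * 1) (lin_comb m (\<lambda>j. s j - (\<Sum>i<k. h i j)) g)"
      using s(2) g r \<theta> by (intro mbd_lin_comb) auto
    ultimately show ?thesis using V[of k] by (simp add: mbd_diff)
  qed
  hence "(v - lin_comb m s g) l t = 0" for l t
    by (intro bd_geom_zero[OF \<theta>, of r] mbdD)
  hence "v - lin_comb m s g = 0" by (intro ext) (simp only: zero_fun_apply)
  hence "v = lin_comb m s g" by simp
  moreover have "bd r (s j)" if "j < m" for j using s(2)[OF that, of 0] by simp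
  ultimately show ?thesis using s(1) by blast
qed

end

section \<open>Submodules of free modules\<close>

context nonarch
begin

lemma mcoeff_scal: "mcoeff (scal (Cc c) M) t = c * mcoeff M t"
  by (simp add: mcoeff_def scal_def)

lemma mcoeff_scal_mon:
  assumes "fin_idx \<gamma>"
  shows "mcoeff (scal (mon c \<gamma>) M) (\<alpha>, s) = (if \<forall>i. \<gamma> i \<le> \<alpha> i then c * mcoeff M (\<lambda>i. \<alpha> i - \<gamma> i, s) else 0)"
  by (simp add: mcoeff_def scal_def cf_mon_mult[OF assms])

text \<open>The analogue of a Groebner basis. Dickson's lemma is applied at each of the finitely
  many matrix positions to the leading exponents that occur in \<open>P\<close>; scaling by the
  inverse of the leading coefficient gives norm 1.\<close>

lemma ex_standard_basis:
  assumes P: "submod D a b P"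
  obtains m :: nat and e :: "nat \<Rightarrow> mterm" and g :: "nat \<Rightarrow> 'k pmat"
  where "\<And>k. k < m \<Longrightarrow> g k \<in> P" "\<And>k. k < m \<Longrightarrow> is_lm term_less (mcoeff (g k)) (e k)"
    "\<And>k. k < m \<Longrightarrow> mcoeff (g k) (e k) = 1"
    "\<And>v \<mu>. v \<in> P \<Longrightarrow> is_lm term_less (mcoeff v) \<mu> \<Longrightarrow> \<exists>k<m. snd (e k) = snd \<mu> \<and> (\<forall>i. fst (e k) i \<le> fst \<mu> i)"
proof -
  define L where "L s = {\<alpha>. \<exists>v\<in>P. is_lm term_less (mcoeff v) (\<alpha>, s)}" for s
  have L: "multi_idx D \<alpha>" if "\<alpha> \<in> L s" for \<alpha> s
    using that submodD(1)[OF P] Mat_trm(1) by (cases s) (fastforce simp: L_def is_lm_def)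
  have "\<forall>s. \<exists>F. finite F \<and> F \<subseteq> L s \<and> (\<forall>\<alpha>\<in>L s. \<exists>\<beta>\<in>F. \<forall>i. \<beta> i \<le> \<alpha> i)"
    by (intro allI dickson) (rule L)
  then obtain F where F: "\<And>s. finite (F s)" "\<And>s. F s \<subseteq> L s"
      "\<And>s \<alpha>. \<alpha> \<in> L s \<Longrightarrow> \<exists>\<beta>\<in>F s. \<forall>i. \<beta> i \<le> \<alpha> i" by metis
  define E where "E = (\<Union>s\<in>{..<a} \<times> {..<b}. (\<lambda>\<beta>. (\<beta>, s)) ` F s)"
  have "finite E" using F(1) by (auto simp: E_def)
  then obtain e :: "nat \<Rightarrow> mterm" and m where e: "E = e ` {i. i < m}"
    using finite_imp_nat_seg_image_inj_on[of E] by blast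
  have ek: "e k \<in> E" if "k < m" for k using that e by auto
  have "\<exists>v. v \<in> P \<and> is_lm term_less (mcoeff v) (e k) \<and> mcoeff v (e k) = 1" if "k < m" for k
  proof -
    have "fst (e k) \<in> L (snd (e k))" using ek[OF that] F(2) unfolding E_def by fastforce
    then obtain v where v: "v \<in> P" "is_lm term_less (mcoeff v) (e k)" by (auto simp: L_def)
    define c where "c = mcoeff v (e k)"
    have c: "c \<noteq> 0" using v(2) by (simp add: is_lm_def c_def)
    let ?v = "scal (Cc (inverse c)) v"
    have "?v \<in> P" using submodD(4)[OF P] v(1) T_Cc by blast
    moreover have "mcoeff ?v (e k) = 1" using c by (simp add: mcoeff_scal c_def)
    moreover have "is_lm term_less (mcoeff ?v) (e k)"
      using v(2) c by (auto simp: is_lm_def mcoeff_scal av_mult)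
    ultimately show ?thesis by blast
  qed
  then obtain g where g: "\<And>k. k < m \<Longrightarrow> g k \<in> P \<and> is_lm term_less (mcoeff (g k)) (e k) \<and> mcoeff (g k) (e k) = 1"
    by metis
  have "\<exists>k<m. snd (e k) = snd \<mu> \<and> (\<forall>i. fst (e k) i \<le> fst \<mu> i)" if v: "v \<in> P" "is_lm term_less (mcoeff v) \<mu>" for v \<mu>
  proof -
    obtain \<alpha> s where \<mu>: "\<mu> = (\<alpha>, s)" by (rule prod.exhaust)
    have "\<alpha> \<in> L s" using v \<mu> by (auto simp: L_def)
    then obtain \<beta> where \<beta>: "\<beta> \<in> F s" "\<forall>i. \<beta> i \<le> \<alpha> i" using F(3) by blast
    have "mcoeff v (\<alpha>, s) \<noteq> 0" using v \<mu> by (auto simp: is_lm_def)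
    hence "s \<in> {..<a} \<times> {..<b}"
      using Mat_trm[OF submodD(1)[OF P v(1)], of \<alpha> "fst s" "snd s"] by (cases s) auto
    hence "(\<beta>, s) \<in> E" using \<beta>(1) by (auto simp: E_def)
    then obtain k where k: "k < m" "e k = (\<beta>, s)" using e by (metis (mono_tags, lifting) imageE mem_Collect_eq)
    show ?thesis using k \<beta>(2) \<mu> by (intro exI[of _ k]) simp
  qed
  thus ?thesis using that g by blast
qed

text \<open>The values between 1/2 and 1 are attained by finitely many terms, so they have a maximum
  below 1 even when \<open>av\<close> has dense image.\<close>

lemma gap_below_1:
  assumes "M \<in> Mat D a b"
  shows "\<exists>\<epsilon><1. \<forall>t. av (mcoeff M t) < 1 \<longrightarrow> av (mcoeff M t) \<le> \<epsilon>"
proof -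
  let ?S = "insert (1/2) ((\<lambda>t. av (mcoeff M t)) ` {t. 1/2 \<le> av (mcoeff M t) \<and> av (mcoeff M t) < 1})"
  have "finite {t. 1/2 \<le> av (mcoeff M t) \<and> av (mcoeff M t) < 1}"
    by (rule finite_subset[OF _ Mat_fin[OF assms, of "1/2"]]) auto
  hence fin: "finite ?S" by simp
  have "Max ?S < 1" using fin by (subst Max_less_iff) auto
  moreover have "av (mcoeff M t) \<le> Max ?S" if "av (mcoeff M t) < 1" for t
  proof (cases "1/2 \<le> av (mcoeff M t)")
    case False
    have "1/2 \<le> Max ?S" using fin by (intro Max_ge) auto
    thus ?thesis using False by linarith
  qed (use that fin in \<open>auto intro!: Max_ge\<close>)
  ultimately show ?thesis by blast
qed

text \<open>Noetherianity in a quantitative form. Terms of absolute value above \<open>\<epsilon> r\<close> are eliminated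
  one leading term at a time. Elimination of a leading term only brings in smaller terms of
  that size, so the finite set of large terms descends in the Dershowitz--Manna order although
  the values of \<open>av\<close> may be dense.\<close>
theorem strict_generators:
  assumes P: "submod D a b P"
  obtains m :: nat and g :: "nat \<Rightarrow> 'k pmat"
  where "\<And>k. k < m \<Longrightarrow> g k \<in> P" "\<And>k. k < m \<Longrightarrow> mbd 1 (g k)"
    "\<And>v r. v \<in> P \<Longrightarrow> mbd r v \<Longrightarrow> \<exists>h. (\<forall>k<m. h k \<in> T D \<and> bd r (h k)) \<and> v = lin_comb m h g"
proof -
  obtain m and e :: "nat \<Rightarrow> mterm" and g where g: "\<And>k. k < m \<Longrightarrow> g k \<in> P"
      "\<And>k. k < m \<Longrightarrow> is_lm term_less (mcoeff (g k)) (e k)" "\<And>k. k < m \<Longrightarrow> mcoeff (g k) (e k) = 1"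
      "\<And>v \<mu>. v \<in> P \<Longrightarrow> is_lm term_less (mcoeff v) \<mu> \<Longrightarrow> \<exists>k<m. snd (e k) = snd \<mu> \<and> (\<forall>i. fst (e k) i \<le> fst \<mu> i)"
    using ex_standard_basis[OF P] by metis
  have g1: "mbd 1 (g k)" if "k < m" for k
    using g(2,3)[OF that] by (auto simp: mbd_iff is_lm_def)
  have "\<exists>\<epsilon>. k < m \<longrightarrow> \<epsilon> < 1 \<and> (\<forall>t. av (mcoeff (g k) t) < 1 \<longrightarrow> av (mcoeff (g k) t) \<le> \<epsilon>)" for k
    using gap_below_1[OF submodD(1)[OF P g(1)], of k] by blast
  then obtain \<epsilon>' where \<epsilon>': "\<And>k. k < m \<Longrightarrow> \<epsilon>' k < 1"
      "\<And>k t. k < m \<Longrightarrow> av (mcoeff (g k) t) < 1 \<Longrightarrow> av (mcoeff (g k) t) \<le> \<epsilon>' k" by metis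
  \<comment> \<open>A common gap for all generators; it becomes the contraction factor of the
    iteration.\<close>
  define \<epsilon> where "\<epsilon> = Max (insert (1/2) (\<epsilon>' ` {..<m}))"
  have \<epsilon>: "0 < \<epsilon>" "\<epsilon> < 1"
  proof -
    have "1/2 \<le> \<epsilon>" unfolding \<epsilon>_def by (intro Max_ge) auto
    thus "0 < \<epsilon>" by simp
    show "\<epsilon> < 1" unfolding \<epsilon>_def using \<epsilon>'(1) by (subst Max_less_iff) auto
  qed
  have gap: "av (mcoeff (g k) t) \<le> \<epsilon>" if "k < m" "av (mcoeff (g k) t) < 1" for k t
  proof -
    have "\<epsilon>' k \<le> \<epsilon>" unfolding \<epsilon>_def using that(1) by (intro Max_ge) auto
    thus ?thesis using \<epsilon>'(2)[OF that] by simp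
  qed
  have red: "\<exists>h. (\<forall>k<m. h k \<in> T D \<and> bd r (h k)) \<and> v - lin_comb m h g \<in> P \<and> mbd (\<epsilon> * r) (v - lin_comb m h g)"
    if "v \<in> P" "mbd r v" for v r
  proof (cases "r = 0")
    case True
    thus ?thesis using that by (intro exI[of _ "\<lambda>_. 0"]) simp
  next
    case False
    hence r: "r > 0" using mbd_nonneg[OF that(2)] by simp
    define A where "A v = {t. \<epsilon> * r < av (mcoeff v t)}" for v
    have fA: "finite (A v)" if "v \<in> P" for v
      by (rule finite_subset[OF _ Mat_fin[OF submodD(1)[OF P that], of "\<epsilon> * r"]]) (use \<epsilon> r in \<open>auto simp: A_def\<close>)
    define R where "R = {(x, y). term_less x y \<and> multi_idx D (fst x) \<and> multi_idx D (fst y)}"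
    have wfR: "wf {(A', A). finite A \<and> finite A' \<and> (\<exists>\<mu>\<in>A. \<mu> \<notin> A' \<and> (\<forall>x\<in>A'. x \<in> A \<or> (x, \<mu>) \<in> R))}"
      unfolding R_def by (intro wf_finite_sets wf_term_less)
    have "\<forall>v. A v = S \<longrightarrow> v \<in> P \<longrightarrow> mbd r v \<longrightarrow>
        (\<exists>h. (\<forall>k<m. h k \<in> T D \<and> bd r (h k)) \<and> v - lin_comb m h g \<in> P \<and> mbd (\<epsilon> * r) (v - lin_comb m h g))" for S
    proof (induction S rule: wf_induct_rule[OF wfR])
      case (1 S)
      show ?case
      proof (intro allI impI)
      fix v assume AS: "A v = S" and vP: "v \<in> P" and vr: "mbd r v"
      show "\<exists>h. (\<forall>k<m. h k \<in> T D \<and> bd r (h k)) \<and> v - lin_comb m h g \<in> P \<and> mbd (\<epsilon> * r) (v - lin_comb m h g)"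
      proof (cases "mbd (\<epsilon> * r) v")
        case True
        thus ?thesis using vP r by (intro exI[of _ "\<lambda>_. 0"]) simp
      next
        case False
        then obtain t where t: "\<epsilon> * r < av (mcoeff v t)" by (auto simp: mbd_iff not_le)
        hence "mcoeff v t \<noteq> 0" using \<epsilon> r by (metis av_0 less_le_not_le less_imp_le mult_pos_pos)
        then obtain \<mu> where \<mu>: "is_lm term_less (mcoeff v) \<mu>"
          using ex_is_lm[of "mcoeff v" t term_less, OF Mat_fin[OF submodD(1)[OF P vP]]] term_less_irrefl term_less_trans by blast
        obtain k where k: "k < m" "snd (e k) = snd \<mu>" "\<forall>i. fst (e k) i \<le> fst \<mu> i"
          using g(4)[OF vP \<mu>] by blast
        obtain \<alpha> s where \<mu>': "\<mu> = (\<alpha>, s)" by (rule prod.exhaust)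
        obtain \<beta> where ek: "e k = (\<beta>, s)" using k(2) \<mu>' by (cases "e k") auto
        have \<beta>: "\<beta> i \<le> \<alpha> i" for i using k(3) ek \<mu>' by simp
        \<comment> \<open>The correction \<open>u\<close> is the multiple of \<open>g k\<close> by a
          monomial that reproduces the leading term of \<open>v\<close> exactly.\<close>
        define \<gamma> where "\<gamma> = (\<lambda>i. \<alpha> i - \<beta> i)"
        have \<alpha>\<gamma>: "\<alpha> = (\<lambda>i. \<gamma> i + \<beta> i)" using \<beta> by (simp add: \<gamma>_def)
        define c where "c = mcoeff v \<mu>"
        have mv: "v \<in> Mat D a b" using submodD(1)[OF P vP] .
        have ca: "\<epsilon> * r < av c" 
          using t \<mu> less_le_trans[of "\<epsilon> * r" "av (mcoeff v t)" "av c"] unfolding is_lm_def c_def by blast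
        have cr: "av c \<le> r" using vr unfolding mbd_iff c_def by blast
        have "c \<noteq> 0" using \<mu> by (auto simp: is_lm_def c_def)
        hence mi: "multi_idx D \<alpha>" using Mat_trm(1)[OF mv, of \<alpha> "fst s" "snd s"] \<mu>' by (simp add: c_def)
        have mi\<gamma>: "multi_idx D \<gamma>" using mi by (simp add: multi_idx_def \<gamma>_def)
        define u where "u = scal (mon c \<gamma>) (g k)"
        have mT: "mon c \<gamma> \<in> T D" using T_mon mi\<gamma> .
        have uP: "u \<in> P" unfolding u_def using submodD(4)[OF P mT g(1)[OF k(1)]] .
        have ubd: "mbd r u" using mbd_scal[of r "mon c \<gamma>" 1 "g k"] g1[OF k(1)] cr by (simp add: u_def)
        have mu: "mcoeff u (\<delta>, s') = (if \<forall>i. \<gamma> i \<le> \<delta> i then c * mcoeff (g k) (\<lambda>i. \<delta> i - \<gamma> i, s') else 0)" for \<delta> s'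
          unfolding u_def using multi_idx_fin[OF mi\<gamma>] by (rule mcoeff_scal_mon)
        have u\<mu>: "mcoeff u \<mu> = c"
          using g(3)[OF k(1)] unfolding \<mu>' mu ek by (simp add: \<alpha>\<gamma>)
        \<comment> \<open>Beyond its leading term \<open>g k\<close> has coefficients below 1, hence
          at most \<epsilon>. So \<open>u\<close> adds nothing above \<mu> that counts as large, and
          every new large term is smaller than \<mu>.\<close>
        have usmall: "av (mcoeff u x) \<le> \<epsilon> * r" if "term_less \<mu> x" for x
        proof -
          obtain \<delta> s' where x: "x = (\<delta>, s')" by (rule prod.exhaust)
          show ?thesis
          proof (cases "\<forall>i. \<gamma> i \<le> \<delta> i")
            case True
            define \<delta>' where "\<delta>' = (\<lambda>i. \<delta> i - \<gamma> i)"
            have "\<delta> = (\<lambda>i. \<gamma> i + \<delta>' i)" using True by (simp add: \<delta>'_def)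
            hence "term_less (e k) (\<delta>', s')" using that unfolding x \<mu>' \<alpha>\<gamma> ek by (simp add: term_less_add)
            hence "av (mcoeff (g k) (\<delta>', s')) < 1" 
              using g(2)[OF k(1)] unfolding is_lm_def g(3)[OF k(1)] av_1 by blast
            hence "av (mcoeff (g k) (\<delta>', s')) \<le> \<epsilon>" using gap[OF k(1)] by blast
            hence "av c * av (mcoeff (g k) (\<delta>', s')) \<le> r * \<epsilon>" using cr r by (intro mult_mono) auto
            thus ?thesis using True by (simp add: x mu av_mult \<delta>'_def mult.commute)
          next
            case False
            hence "mcoeff u x = 0" unfolding x mu by (rule if_not_P)
            thus ?thesis using \<epsilon> r by simp
          qed
        qed
        have v'P: "v - u \<in> P" using submodD(6)[OF P vP uP] .
        have "(A (v - u), A v) \<in> {(A', A). finite A \<and> finite A' \<and> (\<exists>\<mu>\<in>A. \<mu> \<notin> A' \<and> (\<forall>x\<in>A'. x \<in> A \<or> (x, \<mu>) \<in> R))}"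
        proof (clarify, intro conjI bexI[of _ \<mu>] ballI)
          show "finite (A v)" "finite (A (v - u))" using fA vP v'P by auto
          show "\<mu> \<in> A v" using ca by (simp add: A_def c_def)
          show \<mu>n: "\<mu> \<notin> A (v - u)" using u\<mu> mult_pos_pos[OF \<epsilon>(1) r] by (simp add: A_def mcoeff_diff c_def)
          fix x assume x: "x \<in> A (v - u)"
          show "x \<in> A v \<or> (x, \<mu>) \<in> R"
          proof (cases "term_less x \<mu>")
            case True
            have "mcoeff (v - u) x \<noteq> 0" using x \<epsilon> r by (auto simp: A_def) (metis av_0 less_le_not_le less_imp_le mult_pos_pos)
            hence "multi_idx D (fst x)"
              using Mat_trm(1)[OF submodD(1)[OF P v'P], of "fst x" "fst (snd x)" "snd (snd x)"] by simp
            thus ?thesis using True mi \<mu>' by (simp add: R_def)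
          next
            case False
            hence "term_less \<mu> x" using term_less_total[of x \<mu>] x \<mu>n by auto
            hence "av (mcoeff u x) \<le> \<epsilon> * r" by (rule usmall)
            hence "x \<in> A v" using x av_diff_le[of "mcoeff v x" "\<epsilon> * r" "mcoeff u x"]
              by (force simp: A_def mcoeff_diff)
            thus ?thesis ..
          qed
        qed
        hence "\<exists>h. (\<forall>k<m. h k \<in> T D \<and> bd r (h k)) \<and> (v - u) - lin_comb m h g \<in> P \<and> mbd (\<epsilon> * r) ((v - u) - lin_comb m h g)"
          using 1[of "A (v - u)"] v'P mbd_diff[OF vr ubd] unfolding AS by blast
        then obtain h where h: "\<forall>k<m. h k \<in> T D \<and> bd r (h k)"
          "(v - u) - lin_comb m h g \<in> P" "mbd (\<epsilon> * r) ((v - u) - lin_comb m h g)" by blast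
        let ?h = "h(k := h k + mon c \<gamma>)"
        have "v - lin_comb m ?h g = (v - u) - lin_comb m h g" unfolding lin_comb_upd[OF k(1)] u_def[symmetric] by simp
        moreover have "\<forall>k<m. ?h k \<in> T D \<and> bd r (?h k)"
          using h(1) mT cr by (auto intro!: T_add bd_add)
        ultimately show ?thesis using h by metis
      qed
      qed
    qed
    thus ?thesis using that by blast
  qed
  have "\<exists>h. (\<forall>k<m. h k \<in> T D \<and> bd r (h k)) \<and> v = lin_comb m h g" if "v \<in> P" "mbd r v" for v r
    using \<epsilon> g1 red that by (intro lin_comb_iterate[where \<theta> = \<epsilon> and P = P and D = "\<lambda>_. D"]) auto
  thus ?thesis using that g(1) g1 by blast
qed

text \<open>An approximation argument in the style of Nakayama: strict generators of the closure
  \<open>Q\<close> are replaced by elements of \<open>P\<close> within distance 1/2. The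
  replacements still generate \<open>Q\<close>, because each division halves the remainder.\<close>

theorem submod_closed:
  assumes P: "submod D a b P" and v: "v \<in> Mat D a b"
    and lim: "\<And>\<epsilon>. \<epsilon> > 0 \<Longrightarrow> \<exists>w\<in>P. mbd \<epsilon> (v - w)"
  shows "v \<in> P"
proof -
  define Q where "Q = {v \<in> Mat D a b. \<forall>\<epsilon>>0. \<exists>w\<in>P. mbd \<epsilon> (v - w)}"
  have PQ: "P \<subseteq> Q" using submodD(1)[OF P] by (force simp: Q_def)
  have Q: "submod D a b Q"
    unfolding submod_def
  proof (intro conjI ballI)
    show "Q \<subseteq> Mat D a b" by (auto simp: Q_def)
    show "0 \<in> Q" using PQ submodD(2)[OF P] by blast
    fix u assume u: "u \<in> Q"
    show "u + v \<in> Q" if "v \<in> Q" for v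
    proof -
      have "\<exists>w\<in>P. mbd \<epsilon> (u + v - w)" if \<epsilon>: "\<epsilon> > 0" for \<epsilon>
      proof -
        obtain w w' where w: "w \<in> P" "mbd \<epsilon> (u - w)" "w' \<in> P" "mbd \<epsilon> (v - w')"
          using u \<open>v \<in> Q\<close> \<epsilon> unfolding Q_def by blast
        have "u + v - (w + w') = (u - w) + (v - w')" by simp
        hence "mbd \<epsilon> (u + v - (w + w'))" using mbd_add[OF w(2,4)] by (simp only:)
        thus ?thesis using submodD(3)[OF P w(1,3)] by blast
      qed
      thus ?thesis using u \<open>v \<in> Q\<close> submodD(3)[OF submod_Mat] by (auto simp: Q_def)
    qed
    fix c assume c: "c \<in> T D"
    obtain s where s: "s > 0" "bd s c" using T_bdd[OF c] by blast
    have "\<exists>w\<in>P. mbd \<epsilon> (scal c u - w)" if \<epsilon>: "\<epsilon> > 0" for \<epsilon>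
    proof -
      obtain w where w: "w \<in> P" "mbd (\<epsilon> / s) (u - w)"
        using u divide_pos_pos[OF \<epsilon> s(1)] unfolding Q_def by blast
      have "mbd \<epsilon> (scal c u - scal c w)" using mbd_scal[OF s(2) w(2)] s by (simp add: scal_simps)
      thus ?thesis using submodD(4)[OF P c w(1)] by blast
    qed
    thus "scal c u \<in> Q" using u submodD(4)[OF submod_Mat c] by (auto simp: Q_def)
  qed
  obtain m and g where g: "\<And>k. k < m \<Longrightarrow> g k \<in> Q" "\<And>k. k < m \<Longrightarrow> mbd 1 (g k)"
    "\<And>v r. v \<in> Q \<Longrightarrow> mbd r v \<Longrightarrow> \<exists>h. (\<forall>k<m. h k \<in> T D \<and> bd r (h k)) \<and> v = lin_comb m h g"
    using strict_generators[OF Q] by metis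
  have "\<exists>w. w \<in> P \<and> mbd (1/2) (g k - w)" if "k < m" for k
  proof -
    have "\<forall>\<epsilon>>0. \<exists>w\<in>P. mbd \<epsilon> (g k - w)" using g(1)[OF that] by (simp add: Q_def)
    from this[rule_format, of "1/2"] show ?thesis by auto
  qed
  then obtain g' where g': "\<And>k. k < m \<Longrightarrow> g' k \<in> P" "\<And>k. k < m \<Longrightarrow> mbd (1/2) (g k - g' k)" by metis
  have g'1: "mbd 1 (g' k)" if "k < m" for k
  proof -
    have "g' k = g k - (g k - g' k)" by simp
    thus ?thesis using mbd_diff[OF g(2)[OF that] mbd_mono[OF g'(2)[OF that], of 1]] by simp
  qed
  have red: "\<exists>h. (\<forall>k<m. h k \<in> T D \<and> bd r (h k)) \<and> v - lin_comb m h g' \<in> Q \<and> mbd (1/2 * r) (v - lin_comb m h g')"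
    if v: "v \<in> Q" "mbd r v" for v r
  proof -
    obtain h where h: "\<forall>k<m. h k \<in> T D \<and> bd r (h k)" "v = lin_comb m h g" using g(3)[OF v] by blast
    have "mbd (r * (1/2)) (lin_comb m h (\<lambda>k. g k - g' k))"
      using h(1) g'(2) mbd_nonneg[OF v(2)] by (intro mbd_lin_comb) auto
    hence "mbd (1/2 * r) (v - lin_comb m h g')" by (simp only: h(2) lin_comb_diff_right mult.commute)
    moreover have "lin_comb m h g' \<in> P" using h(1) g'(1) by (intro submod_lin_comb[OF P]) auto
    hence "v - lin_comb m h g' \<in> Q" using submodD(6)[OF Q v(1)] PQ by blast
    ultimately show ?thesis using h(1) by blast
  qed
  obtain r where r: "mbd r v" using Mat_bdd[OF v] .
  have "v \<in> Q" using v lim by (simp add: Q_def)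
  hence "\<exists>h. (\<forall>k<m. h k \<in> T D \<and> bd r (h k)) \<and> v = lin_comb m h g'"
    using r g'1 red by (intro lin_comb_iterate[where \<theta> = "1/2" and P = Q and D = "\<lambda>_. D"]) auto
  then obtain h where h: "\<forall>k<m. h k \<in> T D \<and> bd r (h k)" "v = lin_comb m h g'" by blast
  show ?thesis unfolding h(2) using h(1) g'(1) by (intro submod_lin_comb[OF P]) auto
qed

end

section \<open>Units and division by linear polynomials\<close>

lemma lex_less_0: "\<alpha> \<noteq> (\<lambda>_. 0) \<Longrightarrow> lex_less (\<lambda>_. 0) \<alpha>"
  using lex_less_total[of \<alpha> "\<lambda>_. 0"] by (auto simp: lex_less_def)

lemma X_power: "X i ^ l = mon 1 (\<lambda>j. if j = i then l else 0)"
proof (induction l)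
  case 0
  show ?case by (rule ps_eqI) (simp add: cf_1 cf_mon)
next
  case (Suc l)
  have "fin_idx (\<lambda>j. if j = i then n else (0::nat))" for n
    by (rule finite_subset[of _ "{i}"]) auto
  note fin = this
  show ?case unfolding power_Suc Suc unfolding X_def mon_mult[OF fin fin]
    by (rule arg_cong2[of _ _ _ _ mon]) auto
qed

context nonarch
begin

lemma is_lm_unique: "is_lm lex_less w \<mu> \<Longrightarrow> is_lm lex_less w \<nu> \<Longrightarrow> \<mu> = \<nu>"
  unfolding is_lm_def using lex_less_total[of \<mu> \<nu>] by (meson linorder_not_less)

lemma T_is_lm: "f \<in> T D \<Longrightarrow> f \<noteq> 0 \<Longrightarrow> \<exists>\<mu>. is_lm lex_less (cf f) \<mu>"
proof -
  assume f: "f \<in> T D" "f \<noteq> 0"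
  then obtain \<alpha> where \<alpha>: "cf f \<alpha> \<noteq> 0" by (metis cf_0 ps_eqI)
  show ?thesis
  proof (rule ex_is_lm)
    show "cf f \<alpha> \<noteq> 0" by (rule \<alpha>)
    show "lex_less x y \<Longrightarrow> lex_less y z \<Longrightarrow> lex_less x z" for x y z by (rule lex_less_trans)
  qed (use T_fin[OF f(1)] in simp_all)
qed

text \<open>If an index sum reaches \<mu> + \<nu> by other summands, one of them lies above the
  respective leading index, where coefficients are strictly smaller.\<close>

lemma lm_mult_less:
  assumes f: "is_lm lex_less (cf f) \<mu>" and g: "is_lm lex_less (cf g) \<nu>"
    and x: "lex_less (\<lambda>i. \<mu> i + \<nu> i) (\<lambda>i. \<beta> i + \<gamma> i) \<or> (\<lambda>i. \<mu> i + \<nu> i) = (\<lambda>i. \<beta> i + \<gamma> i) \<and> \<beta> \<noteq> \<mu>"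
  shows "av (cf f \<beta> * cf g \<gamma>) < av (cf f \<mu>) * av (cf g \<nu>)"
proof -
  have "lex_less \<mu> \<beta> \<or> lex_less \<nu> \<gamma>"
  proof (rule ccontr)
    assume n: "\<not> (lex_less \<mu> \<beta> \<or> lex_less \<nu> \<gamma>)"
    show False
    proof (cases "\<beta> = \<mu>")
      case True thus False using n x by simp
    next
      case False
      hence "lex_less \<beta> \<mu>" using n lex_less_total by blast
      hence 1: "lex_less (\<lambda>i. \<beta> i + \<gamma> i) (\<lambda>i. \<mu> i + \<gamma> i)"
        using lex_less_add[of \<gamma> \<beta> \<mu>] by (simp add: add.commute)
      have "\<gamma> = \<nu> \<or> lex_less \<gamma> \<nu>" using n lex_less_total by blast
      hence 2: "lex_less (\<lambda>i. \<beta> i + \<gamma> i) (\<lambda>i. \<mu> i + \<nu> i)"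
        using 1 lex_less_trans[OF 1, of "\<lambda>i. \<mu> i + \<nu> i"] lex_less_add[of \<mu> \<gamma> \<nu>] by (elim disjE) simp_all
      from x show False
      proof (elim disjE conjE)
        assume "lex_less (\<lambda>i. \<mu> i + \<nu> i) (\<lambda>i. \<beta> i + \<gamma> i)"
        from lex_less_trans[OF this 2] show False by simp
      next
        assume "(\<lambda>i. \<mu> i + \<nu> i) = (\<lambda>i. \<beta> i + \<gamma> i)"
        thus False using 2 by (simp only: lex_less_irrefl)
      qed
    qed
  qed
  thus ?thesis
  proof
    assume "lex_less \<mu> \<beta>"
    hence "av (cf f \<beta>) < av (cf f \<mu>)" using f by (simp add: is_lm_def)
    moreover have "av (cf g \<gamma>) \<le> av (cf g \<nu>)" "0 < av (cf g \<nu>)" using g by (auto simp: is_lm_def)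
    ultimately show ?thesis unfolding av_mult
      by (metis av_nonneg mult_left_mono mult_strict_right_mono order_le_less_trans)
  next
    assume "lex_less \<nu> \<gamma>"
    hence "av (cf g \<gamma>) < av (cf g \<nu>)" using g by (simp add: is_lm_def)
    moreover have "av (cf f \<beta>) \<le> av (cf f \<mu>)" "0 < av (cf f \<mu>)" using f by (auto simp: is_lm_def)
    ultimately show ?thesis unfolding av_mult
      by (metis av_nonneg mult_right_mono mult_strict_left_mono order_le_less_trans)
  qed
qed

text \<open>A refinement of the multiplicativity of the Gauss norm: in the coefficient at \<mu> +
  \<nu> the summand of the two leading coefficients strictly dominates all others.\<close>

lemma is_lm_mult:
  assumes f: "is_lm lex_less (cf f) \<mu>" and g: "is_lm lex_less (cf g) \<nu>"
  shows "is_lm lex_less (cf (f * g)) (\<lambda>i. \<mu> i + \<nu> i)"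
proof -
  let ?m = "\<lambda>i. \<mu> i + \<nu> i" and ?B = "\<lambda>x::nat\<Rightarrow>nat. {\<beta>::nat\<Rightarrow>nat. \<forall>i. \<beta> i \<le> x i}"
  have pos: "0 < av (cf f \<mu>) * av (cf g \<nu>)" using f g by (simp add: is_lm_def)
  have split: "x = (\<lambda>i. \<beta> i + (x i - \<beta> i))" if "\<beta> \<in> ?B x" for \<beta> x using that by auto
  have "fin_idx \<mu>" "fin_idx \<nu>" using f g cf_infinite unfolding is_lm_def by blast+
  hence "finite ({i. \<mu> i \<noteq> 0} \<union> {i. \<nu> i \<noteq> 0})" by simp
  hence "fin_idx ?m" by (rule rev_finite_subset) auto
  hence fin: "finite (?B ?m)" by (rule finite_below_iff[THEN iffD2])
  have eq: "cf (f * g) ?m = cf f \<mu> * cf g \<nu> + (\<Sum>\<beta>\<in>?B ?m - {\<mu>}. cf f \<beta> * cf g (\<lambda>i. ?m i - \<beta> i))"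
    unfolding cf_mult tmul_def using fin by (subst sum.remove[of _ \<mu>]) auto
  have less: "av (\<Sum>\<beta>\<in>?B ?m - {\<mu>}. cf f \<beta> * cf g (\<lambda>i. ?m i - \<beta> i)) < av (cf f \<mu> * cf g \<nu>)"
    unfolding av_mult
  proof (rule av_sum_less[OF pos])
    fix \<beta> assume \<beta>: "\<beta> \<in> ?B ?m - {\<mu>}"
    show "av (cf f \<beta> * cf g (\<lambda>i. ?m i - \<beta> i)) < av (cf f \<mu>) * av (cf g \<nu>)"
      by (rule lm_mult_less[OF f g]) (use \<beta> split[of \<beta> ?m] in auto)
  qed
  have m: "av (cf (f * g) ?m) = av (cf f \<mu>) * av (cf g \<nu>)"
    unfolding eq av_add_eq[OF less] by (rule av_mult)
  have "av (cf (f * g) x) \<le> av (cf f \<mu>) * av (cf g \<nu>)" for x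
    unfolding cf_mult tmul_def
    by (rule av_sum_le) (use pos f g in \<open>auto simp: av_mult is_lm_def intro!: mult_mono\<close>)
  moreover have "av (cf (f * g) x) < av (cf f \<mu>) * av (cf g \<nu>)" if x: "lex_less ?m x" for x
    unfolding cf_mult tmul_def
  proof (rule av_sum_less[OF pos])
    fix \<beta> assume \<beta>: "\<beta> \<in> ?B x"
    show "av (cf f \<beta> * cf g (\<lambda>i. x i - \<beta> i)) < av (cf f \<mu>) * av (cf g \<nu>)"
      by (rule lm_mult_less[OF f g]) (use x in \<open>simp only: split[OF \<beta>, symmetric] simp_thms\<close>)
  qed
  moreover have "cf (f * g) ?m \<noteq> 0" using m pos by (metis av_0 less_irrefl)
  ultimately show ?thesis unfolding is_lm_def m by blast
qed

text \<open>The leading indices of \<open>f\<close> and \<open>g\<close> add up to that of 1, so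
  both are 0; every other index comes later in the order.\<close>

lemma unit_dominant:
  assumes "f \<in> T D" "g \<in> T D" "f * g = 1" "\<alpha> \<noteq> (\<lambda>_. 0)"
  shows "av (cf f \<alpha>) < av (cf f (\<lambda>_. 0))"
proof -
  have "f \<noteq> 0" "g \<noteq> 0" using assms(3) by auto
  then obtain \<mu> \<nu> where lm: "is_lm lex_less (cf f) \<mu>" "is_lm lex_less (cf g) \<nu>" using T_is_lm assms by blast
  have "cf 1 (\<lambda>i. \<mu> i + \<nu> i) \<noteq> (0::'k)" using is_lm_mult[OF lm] by (simp add: is_lm_def assms(3))
  hence "(\<lambda>i. \<mu> i + \<nu> i) = (\<lambda>_. 0)" by (auto simp: cf_1 split: if_splits)
  hence "\<mu> = (\<lambda>_. 0)" by (simp add: fun_eq_iff)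
  thus ?thesis using lm(1) lex_less_0[OF assms(4)] by (simp add: is_lm_def)
qed

text \<open>This is where integrality of n matters: z and the constant may tie in size, and the
  order then prefers z.\<close>

lemma is_lm_linear:
  assumes "av n \<le> 1" shows "is_lm lex_less (cf (X d - Cc n)) (\<lambda>j. if j = d then 1 else 0)"
proof -
  let ?e = "\<lambda>j. if j = d then 1 else (0::nat)"
  have fin: "fin_idx ?e" by (rule finite_subset[of _ "{d}"]) auto
  have ne: "(\<lambda>_. 0) \<noteq> ?e" by (auto simp: fun_eq_iff)
  have c: "cf (X d - Cc n) x = (if x = ?e then 1 else if x = (\<lambda>_. 0) then - n else 0)" for x
    using fin ne by (auto simp: X_def cf_mon cf_Cc)
  have "\<not> lex_less ?e (\<lambda>_. 0)" by (simp add: lex_less_def)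
  thus ?thesis unfolding is_lm_def c using assms lex_less_irrefl by auto
qed

text \<open>The leading index of a nonzero multiple of z - n involves z, which a series over S does
  not contain.\<close>

lemma linear_divides_const:
  assumes n: "av n \<le> 1" and G: "G \<in> T d" and W: "W \<in> T (Suc d)" and e: "G = (X d - Cc n) * W"
  shows "G = 0"
proof (rule ccontr)
  assume "G \<noteq> 0"
  hence "W \<noteq> 0" using e by auto
  then obtain \<nu> where "is_lm lex_less (cf W) \<nu>" using T_is_lm W by blast
  from is_lm_mult[OF is_lm_linear[OF n, of d] this]
  have "cf G (\<lambda>i. (if i = d then 1 else 0) + \<nu> i) \<noteq> 0" by (simp add: is_lm_def e)
  from T_idx[OF G this] show False by (auto simp: multi_idx_def)
qed

lemma const_linear_unique:
  assumes n: "av n \<le> 1" and "G \<in> T d" "G' \<in> T d" "W \<in> T (Suc d)" "W' \<in> T (Suc d)"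
    and e: "G + (X d - Cc n) * W = G' + (X d - Cc n) * W'"
  shows "G = G'"
proof -
  have "G - G' = (X d - Cc n) * (W' - W)" using e by (simp add: algebra_simps)
  hence "G - G' = 0" using linear_divides_const[OF n] T_diff assms(2-5) by metis
  thus ?thesis by simp
qed

text \<open>Substitution of n for z in a monomial: z^l - n^l is z - n times a sum \<open>U\<close>
  whose norm is at most 1 because |n| \<le> 1.\<close>

lemma div_linear_mon:
  assumes n: "av n \<le> 1" and \<alpha>: "multi_idx (Suc d) \<alpha>" and c: "av c \<le> r"
  shows "\<exists>G\<in>T d. \<exists>W\<in>T (Suc d). bd r G \<and> bd r W \<and> mon c \<alpha> = G + (X d - Cc n) * W"
proof -
  define \<alpha>' where "\<alpha>' = \<alpha>(d := 0)"
  have mi: "multi_idx d \<alpha>'" using \<alpha> by (auto simp: multi_idx_def \<alpha>'_def)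
  define l where "l = \<alpha> d"
  have fin: "fin_idx (\<lambda>j. if j = d then l else 0)" by (rule finite_subset[of _ "{d}"]) auto
  have e: "mon c \<alpha> = mon c \<alpha>' * X d ^ l"
    unfolding X_power using multi_idx_fin[OF mi] fin
    by (simp add: mon_mult) (auto simp: \<alpha>'_def l_def intro!: arg_cong[of _ _ "mon c"])
  define U where "U = (\<Sum>i<l. Cc n ^ (l - Suc i) * X d ^ i)"
  have Xl: "X d ^ l = Cc n ^ l + (X d - Cc n) * U"
    using power_diff_sumr2[of "X d" l "Cc n"] unfolding U_def[symmetric] diff_eq_eq by (simp only: add.commute)
  have "mon c \<alpha> = mon c \<alpha>' * Cc n ^ l + (X d - Cc n) * (mon c \<alpha>' * U)"
    unfolding e Xl by (simp add: algebra_simps)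
  moreover have bp: "bd 1 (f ^ i)" if "bd 1 f" for f i
    using that by (induction i) (auto intro: bd_mult1)
  hence "bd 1 (Cc n ^ l)" "bd 1 U" using n
    by (auto simp: U_def intro!: bd_sum bd_mult1 bp bd_Cc)
  hence "bd r (mon c \<alpha>' * Cc n ^ l)" "bd r (mon c \<alpha>' * U)" using c by (auto intro: bd_mult1)
  moreover have "mon c \<alpha>' * Cc n ^ l \<in> T d" using T_mon[OF mi] by (intro T_mult T_power) auto
  moreover have "mon c \<alpha>' * U \<in> T (Suc d)"
    unfolding U_def using T_mon[OF multi_idx_mono[OF mi, of "Suc d"]]
    by (intro T_mult T_sum T_power T_X) auto
  ultimately show ?thesis by blast
qed

text \<open>Presents a series as a matrix, so that the iteration lemma for matrices covers division
  of series.\<close>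

definition entry00 :: "'k ps \<Rightarrow> 'k pmat" where "entry00 F = (\<lambda>l j. if l = 0 \<and> j = 0 then F else 0)"

text \<open>Weierstrass division by z - n with norm control. A polynomial truncation is divided
  monomial by monomial, which leaves an error of half the norm, and the iteration removes
  it.\<close>

lemma div_linear:
  assumes n: "av n \<le> 1" and F: "F \<in> T (Suc d)" "bd r F"
  shows "\<exists>G\<in>T d. \<exists>W\<in>T (Suc d). bd r G \<and> bd r W \<and> F = G + (X d - Cc n) * W"
proof -
  \<comment> \<open>Remainder and quotient are the coefficients of the two generators 1 and z - n;
    the first coefficient is restricted to S.\<close>
  let ?g = "\<lambda>k::nat. entry00 (if k = 0 then 1 else X d - Cc n)"
  have bd1: "bd 1 (X d - Cc n)" using n by (intro bd_diff bd_X bd_Cc)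
  have lc2: "lin_comb 2 h ?g = entry00 (h 0 + (X d - Cc n) * h 1)" for h :: "nat \<Rightarrow> 'k ps"
    by (auto simp: lin_comb_def entry00_def fun_eq_iff numeral_2_eq_2 algebra_simps)
  have sd: "entry00 F - entry00 G = entry00 (F - G)" for F G by (auto simp: entry00_def fun_eq_iff)
  have sb: "mbd r (entry00 F) \<longleftrightarrow> bd r F" for r F
    by (auto simp: mbd_def entry00_def dest: bd_nonneg)
  have si: "entry00 F = entry00 G \<Longrightarrow> F = G" for F G by (auto simp: entry00_def dest!: fun_cong[of _ _ 0])
  have "\<exists>h. (\<forall>k<2. h k \<in> T (if k = 0 then d else Suc d) \<and> bd r (h k)) \<and> entry00 F = lin_comb 2 h ?g"
  proof (rule lin_comb_iterate[where \<theta> = "1/2" and P = "entry00 ` T (Suc d)"])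
    show "mbd 1 (?g j)" for j using bd1 by (simp add: sb)
    show "entry00 F \<in> entry00 ` T (Suc d)" "mbd r (entry00 F)" using F by (auto simp: sb)
    fix v r assume "v \<in> entry00 ` T (Suc d)" and vr: "mbd r v"
    then obtain F where F: "F \<in> T (Suc d)" "v = entry00 F" "bd r F" by (auto simp: sb)
    have r0: "0 \<le> r" using bd_nonneg[OF F(3)] .
    have "\<exists>G\<in>T d. \<exists>W\<in>T (Suc d). bd r G \<and> bd r W \<and> bd (1/2 * r) (F - (G + (X d - Cc n) * W))"
    proof (cases "r = 0")
      case True
      thus ?thesis using F by (intro bexI[of _ 0]) auto
    next
      case False
      hence r: "1/2 * r > 0" using r0 by simp
      let ?S = "{\<alpha>. 1/2 * r \<le> av (cf F \<alpha>)}"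
      have "\<exists>G\<in>T d. \<exists>W\<in>T (Suc d). bd r G \<and> bd r W \<and> (\<Sum>\<alpha>\<in>S. mon (cf F \<alpha>) \<alpha>) = G + (X d - Cc n) * W"
        if "finite S" "S \<subseteq> ?S" for S
        using that
      proof (induction S)
        case empty
        thus ?case using r0 by (intro bexI[of _ 0]) auto
      next
        case (insert \<alpha> S)
        then obtain G W where GW: "G \<in> T d" "W \<in> T (Suc d)" "bd r G" "bd r W"
          "(\<Sum>\<alpha>\<in>S. mon (cf F \<alpha>) \<alpha>) = G + (X d - Cc n) * W" by auto
        have "multi_idx (Suc d) \<alpha>" using T_trunc(2)[OF F(1) r] insert.prems by auto
        then obtain G' W' where GW': "G' \<in> T d" "W' \<in> T (Suc d)" "bd r G'" "bd r W'"
          "mon (cf F \<alpha>) \<alpha> = G' + (X d - Cc n) * W'" using div_linear_mon[OF n _ bdD[OF F(3)]] by metis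
        show ?case using GW GW' insert.hyps
          by (intro bexI[of _ "G' + G"] bexI[of _ "W' + W"]) (auto intro: bd_add T_add simp: algebra_simps)
      qed
      from this[OF T_trunc(1)[OF F(1) r] order_refl] T_trunc(3)[OF F(1) r] show ?thesis by metis
    qed
    then obtain G W where GW: "G \<in> T d" "W \<in> T (Suc d)" "bd r G" "bd r W"
      "bd (1/2 * r) (F - (G + (X d - Cc n) * W))" by blast
    have "G + (X d - Cc n) * W \<in> T (Suc d)"
      using GW(1,2) T_mono[of d "Suc d"] by (auto intro!: T_add T_mult T_diff T_X)
    hence *: "F - (G + (X d - Cc n) * W) \<in> T (Suc d)" using F(1) by (intro T_diff)
    show "\<exists>h. (\<forall>k<2. h k \<in> T (if k = 0 then d else Suc d) \<and> bd r (h k)) \<and> v - lin_comb 2 h ?g \<in> entry00 ` T (Suc d) \<and>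
        mbd (1/2 * r) (v - lin_comb 2 h ?g)"
      using GW * by (intro exI[of _ "\<lambda>k. if k = 0 then G else W"]) (auto simp: lc2 F(2) sd sb simp del: One_nat_def)
  qed auto
  then obtain h where h: "\<forall>k<2. h k \<in> T (if k = 0 then d else Suc d) \<and> bd r (h k)"
    "entry00 F = lin_comb 2 h ?g" by blast
  show ?thesis using h(1)[rule_format, of 0] h(1)[rule_format, of 1] si[OF h(2)[unfolded lc2]] by auto
qed

text \<open>The remainder modulo z - n is unique and no larger than the divided series.
  Approximations by multiples of z - n thus make it smaller than every \<epsilon>.\<close>

lemma linear_ideal_closed:
  assumes n: "av n \<le> 1" and F: "F \<in> T (Suc d)"
    and lim: "\<And>\<epsilon>. \<epsilon> > 0 \<Longrightarrow> \<exists>W\<in>T (Suc d). bd \<epsilon> (F - (X d - Cc n) * W)"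
  shows "\<exists>W\<in>T (Suc d). F = (X d - Cc n) * W"
proof -
  obtain r where "bd r F" using T_bdd[OF F] by blast
  then obtain G W where GW: "G \<in> T d" "W \<in> T (Suc d)" "F = G + (X d - Cc n) * W"
    using div_linear[OF n F] by blast
  have "bd \<epsilon> G" if "\<epsilon> > 0" for \<epsilon>
  proof -
    obtain W' where W': "W' \<in> T (Suc d)" "bd \<epsilon> (F - (X d - Cc n) * W')" using lim \<open>\<epsilon> > 0\<close> by blast
    have "F - (X d - Cc n) * W' \<in> T (Suc d)" using F W' by (intro T_diff T_mult T_X) auto
    then obtain G' W'' where G': "G' \<in> T d" "W'' \<in> T (Suc d)" "bd \<epsilon> G'"
      "F - (X d - Cc n) * W' = G' + (X d - Cc n) * W''" using div_linear[OF n _ W'(2)] by blast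
    have "G + (X d - Cc n) * W = G' + (X d - Cc n) * (W' + W'')"
      using G'(4) GW(3) by (simp add: algebra_simps)
    hence "G = G'" using const_linear_unique[OF n GW(1) G'(1) GW(2)] T_add W'(1) G'(2) by blast
    thus ?thesis using G'(3) by simp
  qed
  hence "G = 0" by (rule bd_all_zero)
  thus ?thesis using GW by auto
qed

text \<open>Equality of the values at z = n. The congruence takes the place of an evaluation
  homomorphism; the value itself is the unique congruent element of S, if |n| \<le> 1.\<close>

definition cong_lin :: "nat \<Rightarrow> 'k \<Rightarrow> 'k ps \<Rightarrow> 'k ps \<Rightarrow> bool" where
  "cong_lin d n F G \<longleftrightarrow> (\<exists>W\<in>T (Suc d). F - G = (X d - Cc n) * W)"

lemma cong_lin_refl [simp]: "cong_lin d n F F" by (auto simp: cong_lin_def intro: bexI[of _ 0])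
lemma cong_lin_sym: "cong_lin d n F G \<Longrightarrow> cong_lin d n G F"
  unfolding cong_lin_def by (metis T_uminus minus_diff_eq mult_minus_right)
lemma cong_lin_add: "cong_lin d n F G \<Longrightarrow> cong_lin d n F' G' \<Longrightarrow> cong_lin d n (F + F') (G + G')"
  unfolding cong_lin_def by (metis T_add add_diff_add distrib_left)
lemma cong_lin_diff: assumes "cong_lin d n F G" "cong_lin d n F' G'" shows "cong_lin d n (F - F') (G - G')"
proof -
  obtain W W' where "W \<in> T (Suc d)" "W' \<in> T (Suc d)" "F - G = (X d - Cc n) * W" "F' - G' = (X d - Cc n) * W'"
    using assms by (auto simp: cong_lin_def)
  moreover have "F - F' - (G - G') = (F - G) - (F' - G')" by simp
  ultimately have "F - F' - (G - G') = (X d - Cc n) * (W - W')" "W - W' \<in> T (Suc d)"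
    by (simp_all only: right_diff_distrib T_diff)
  thus ?thesis unfolding cong_lin_def by blast
qed
lemma cong_lin_trans: "cong_lin d n F G \<Longrightarrow> cong_lin d n G H \<Longrightarrow> cong_lin d n F H"
  using cong_lin_add[of d n F G "G" H] cong_lin_diff[of d n "F + G" "G + H" G G] by simp
lemma cong_lin_mult:
  assumes "cong_lin d n F G" "cong_lin d n F' G'" "F \<in> T (Suc d)" "G' \<in> T (Suc d)"
  shows "cong_lin d n (F * F') (G * G')"
proof -
  obtain W W' where W: "W \<in> T (Suc d)" "W' \<in> T (Suc d)" "F - G = (X d - Cc n) * W" "F' - G' = (X d - Cc n) * W'"
    using assms by (auto simp: cong_lin_def)
  have "F * F' - G * G' = F * (F' - G') + (F - G) * G'" by (simp add: algebra_simps)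
  also have "\<dots> = (X d - Cc n) * (F * W' + W * G')" unfolding W by (simp add: algebra_simps)
  finally show ?thesis unfolding cong_lin_def using W assms by (auto intro!: bexI[of _ "F * W' + W * G'"] T_add T_mult)
qed
lemma cong_lin_sum: "(\<And>x. x \<in> A \<Longrightarrow> cong_lin d n (F x) (G x)) \<Longrightarrow> cong_lin d n (sum F A) (sum G A)"
  by (induction A rule: infinite_finite_induct) (auto intro: cong_lin_add)
lemma cong_lin_prod:
  "(\<And>x. x \<in> A \<Longrightarrow> cong_lin d n (F x) (G x)) \<Longrightarrow> (\<And>x. x \<in> A \<Longrightarrow> F x \<in> T (Suc d)) \<Longrightarrow>
   (\<And>x. x \<in> A \<Longrightarrow> G x \<in> T (Suc d)) \<Longrightarrow> cong_lin d n (prod F A) (prod G A)"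
  by (induction A rule: infinite_finite_induct) (auto intro!: cong_lin_mult T_prod)
lemma cong_lin_X: "cong_lin d n (X d) (Cc n)" by (auto simp: cong_lin_def intro: bexI[of _ 1])
lemma cong_lin_X_diff: "cong_lin d n (X d - Cc m) (Cc (n - m))"
  unfolding Cc_diff by (intro cong_lin_diff cong_lin_X cong_lin_refl)

lemma cong_lin_const_eq: "av n \<le> 1 \<Longrightarrow> cong_lin d n G G' \<Longrightarrow> G \<in> T d \<Longrightarrow> G' \<in> T d \<Longrightarrow> G = G'"
  by (metis cong_lin_def linear_divides_const T_diff right_minus_eq)
lemma ex_cong_lin: assumes "av n \<le> 1" "F \<in> T (Suc d)" shows "\<exists>G\<in>T d. cong_lin d n F G"
proof -
  obtain r where "bd r F" using T_bdd[OF assms(2)] by blast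
  from div_linear[OF assms this] show ?thesis by (auto simp: cong_lin_def) (metis add_diff_cancel_left')
qed

end

section \<open>Interpolation of the iterates\<close>

locale padic = nonarch av for av :: "'k::field \<Rightarrow> real" +
  fixes p :: nat
  assumes prime_p: "prime p" and av_p: "av (of_nat p) = 1 / real p"
begin

lemma p_gt1: "real p > 1" using prime_gt_1_nat[OF prime_p] by simp

text \<open>By Bezout n * u = 1 - p * w. The right side has absolute value 1 by the isosceles
  principle, and neither factor on the left exceeds 1.\<close>

lemma av_unit: assumes "\<not> int p dvd n" shows "av (of_int n) = 1"
proof -
  have "coprime (int p) n" using prime_p assms by (simp add: prime_imp_coprime)
  then obtain w u where wu: "int p * w + n * u = 1"
    by (metis bezout_int coprime_imp_gcd_eq_1 mult.commute)
  have e: "(of_int n * of_int u :: 'k) = 1 + (- (of_nat p * of_int w))"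
    using arg_cong[OF wu, of "of_int :: int \<Rightarrow> 'k"] by (simp add: algebra_simps)
  have "av (- (of_nat p * of_int w)) = av (of_int w) / real p" by (simp add: av_mult av_p)
  also have "\<dots> < 1" using av_of_int[of w] p_gt1 by simp
  finally have "av (of_int n) * av (of_int u) = 1"
    using av_add_eq[of "- (of_nat p * of_int w)" 1] by (simp only: e av_1 flip: av_mult)
  moreover have "av (of_int n) * av (of_int u) \<le> av (of_int n) * 1"
    using av_of_int[of u] by (intro mult_left_mono) auto
  ultimately show ?thesis using av_of_int[of n] by simp
qed

lemma av_dvd: assumes "int p ^ r dvd n" shows "av (of_int n) \<le> (1 / real p) ^ r"
proof -
  obtain m where m: "n = int p ^ r * m" using assms by auto
  have "av (of_int n) = (1 / real p) ^ r * av (of_int m)"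
    by (simp add: m av_mult av_power av_p)
  also have "\<dots> \<le> (1 / real p) ^ r * 1" using av_of_int[of m] by (intro mult_left_mono) auto
  finally show ?thesis by simp
qed

text \<open>Characteristic 0: factors p are split off until \<open>av_unit\<close> applies.\<close>

lemma of_int_nz: "n \<noteq> 0 \<Longrightarrow> (of_int n :: 'k) \<noteq> 0"
proof (induction "nat \<bar>n\<bar>" arbitrary: n rule: less_induct)
  case less
  show ?case
  proof (cases "int p dvd n")
    case True
    then obtain m where m: "n = int p * m" by auto
    have "m \<noteq> 0" using m less.prems by auto
    moreover have "nat \<bar>m\<bar> < nat \<bar>n\<bar>"
      using \<open>m \<noteq> 0\<close> prime_gt_1_nat[OF prime_p] by (auto simp: m abs_mult nat_mult_distrib)
    ultimately have "(of_int m :: 'k) \<noteq> 0" using less.hyps by blast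
    moreover have "(of_nat p :: 'k) \<noteq> 0" using av_p p_gt1 by (metis av_0 divide_eq_0_iff of_nat_0 less_numeral_extra(3) not_one_less_zero zero_neq_one)
    ultimately show ?thesis by (simp add: m)
  next
    case False
    thus ?thesis using av_unit by (metis av_0 zero_neq_one)
  qed
qed

lemma of_int_eq [simp]: "(of_int m :: 'k) = of_int n \<longleftrightarrow> m = n"
  using of_int_nz[of "m - n"] by auto

lemma fact_nz [simp]: "(of_nat (fact m) :: 'k) \<noteq> 0"
  using of_int_nz[of "int (fact m)"] by (metis fact_nonzero of_int_of_nat_eq of_nat_eq_0_iff)

text \<open>Legendre's recursion: factors prime to p are units, and the multiples of p up to m
  contribute p^(m div p) times the factorial of m div p.\<close>

lemma av_fact: "av (of_nat (fact m)) = (1 / real p) ^ (m div p) * av (of_nat (fact (m div p)))"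
proof (induction m)
  case (Suc m)
  have f: "av (of_nat (fact (Suc m))) = av (of_nat (Suc m)) * av (of_nat (fact m))" for m
    by (simp only: fact_Suc of_nat_mult av_mult of_nat_id)
  show ?case
  proof (cases "p dvd Suc m")
    case True
    hence d: "Suc m div p = Suc (m div p)" by (simp add: div_Suc mod_eq_0_iff_dvd)
    have "Suc m = p * Suc (m div p)" using True d by (metis dvd_mult_div_cancel)
    hence "av (of_nat (Suc m)) = 1 / real p * av (of_nat (Suc (m div p)))"
      by (metis av_mult av_p of_nat_mult)
    thus ?thesis unfolding d by (simp only: f power_Suc Suc.IH mult_ac)
  next
    case False
    hence d: "Suc m div p = m div p" by (simp add: div_Suc mod_eq_0_iff_dvd)
    have "av (of_int (int (Suc m))) = 1" using False av_unit[of "int (Suc m)"] int_dvd_int_iff by blast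
    thus ?thesis unfolding f d Suc by simp
  qed
qed simp

text \<open>The number with q^p = p q; this equation is exactly what makes the bound q^m on 1/|m!|
  reproduce itself under Legendre's recursion.\<close>

definition q :: real where "q = real p powr (1 / (real p - 1))"

lemma q_ge1: "1 \<le> q" using p_gt1 by (simp add: q_def ge_one_powr_ge_zero)

lemma q_power: "q ^ p = real p * q"
proof -
  have "q ^ p = real p powr (real p / (real p - 1))"
    using p_gt1 by (simp add: q_def powr_powr flip: powr_realpow)
  also have "real p / (real p - 1) = 1 + 1 / (real p - 1)" using p_gt1 by (simp add: field_simps)
  finally show ?thesis using p_gt1 by (simp add: powr_add q_def)
qed

lemma inverse_av_fact: "inverse (av (of_nat (fact m))) \<le> q ^ m"
proof (induction m rule: less_induct)
  case (less m)
  show ?case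
  proof (cases "m = 0")
    case False
    define k where "k = m div p"
    have "k < m" using False prime_gt_1_nat[OF prime_p] by (simp add: k_def)
    have "inverse (av (of_nat (fact m))) = real p ^ k * inverse (av (of_nat (fact k)))"
      unfolding av_fact[of m] k_def by (simp add: power_one_over inverse_eq_divide)
    also have "\<dots> \<le> real p ^ k * q ^ k" using less[OF \<open>k < m\<close>] by (intro mult_left_mono) auto
    also have "\<dots> = q ^ (p * k)" by (simp add: q_power power_mult power_mult_distrib)
    also have "\<dots> \<le> q ^ m" using q_ge1 by (intro power_increasing) (simp_all add: k_def)
    finally show ?thesis .
  qed simp
qed

text \<open>The binomial coefficient, written with a falling factorial in the field so that n may be
  negative.\<close>

definition bin :: "int \<Rightarrow> nat \<Rightarrow> 'k" where
  "bin n m = inverse (of_nat (fact m)) * (\<Prod>j<m. of_int n - of_nat j)"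

lemma bin_0 [simp]: "bin n 0 = 1" by (simp add: bin_def)
lemma bin_0_Suc [simp]: "bin 0 (Suc m) = 0"
  unfolding bin_def prod.lessThan_Suc_shift by simp
lemma bin_Suc: "bin (n + 1) (Suc m) = bin n (Suc m) + bin n m"
proof -
  define P where "P = (\<Prod>j<m. of_int n - of_nat j :: 'k)"
  have nz: "(of_nat (Suc m) :: 'k) \<noteq> 0"
    by (rule of_int_nz[of "int (Suc m)", unfolded of_int_of_nat_eq]) simp
  have f: "(of_nat (fact (Suc m)) :: 'k) = of_nat (Suc m) * of_nat (fact m)" by (simp only: fact_Suc of_nat_mult of_nat_id)
  have h1: "(\<Prod>j<Suc m. of_int (n + 1) - of_nat j :: 'k) = (of_int n + 1) * P"
    by (subst prod.lessThan_Suc_shift) (simp add: P_def)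
  have h2: "(\<Prod>j<Suc m. of_int n - of_nat j :: 'k) = P * (of_int n - of_nat m)" by (simp add: P_def)
  have g: "inverse (of_nat (fact m) :: 'k) = inverse (of_nat (Suc m) * of_nat (fact m)) * of_nat (Suc m)"
    using nz by (simp del: of_nat_Suc)
  have "(of_int n + 1) * P = P * (of_int n - of_nat m) + of_nat (Suc m) * P" by (simp add: algebra_simps)
  thus ?thesis unfolding bin_def f h1 h2 P_def[symmetric] g by (simp only: distrib_left mult.assoc)
qed

text \<open>Integrality by Pascal's rule, run upwards and downwards from n = 0; the downward
  direction has an inner induction on m.\<close>

lemma av_bin: "av (bin n m) \<le> 1"
proof -
  have "\<forall>m. av (bin n m) \<le> 1"
  proof (induction n rule: int_induct[where k = 0])
    case base
    show ?case
    proof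
      fix m show "av (bin 0 m) \<le> 1" by (cases m) auto
    qed
  next
    case (step1 n)
    show ?case
    proof
      fix m show "av (bin (n + 1) m) \<le> 1" using step1 by (cases m) (auto simp: bin_Suc intro: av_add_le)
    qed
  next
    case (step2 n)
    show ?case
    proof
      fix m show "av (bin (n - 1) m) \<le> 1"
      proof (induction m)
        case (Suc m)
        have "bin (n - 1) (Suc m) = bin n (Suc m) - bin (n - 1) m" using bin_Suc[of "n - 1" m] by simp
        thus ?case using Suc step2 by (simp add: av_diff_le)
      qed simp
    qed
  qed
  thus ?thesis ..
qed

end

section \<open>Automorphisms of a Tate algebra are isometries\<close>

locale tate_aut = nonarch av for av :: "'k::field \<Rightarrow> real" +
  fixes d :: nat and s :: "'k ps \<Rightarrow> 'k ps"
  assumes bij: "bij_betw s (T d) (T d)"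
    and s_add: "f \<in> T d \<Longrightarrow> g \<in> T d \<Longrightarrow> s (f + g) = s f + s g"
    and s_mult: "f \<in> T d \<Longrightarrow> g \<in> T d \<Longrightarrow> s (f * g) = s f * s g"
    and s_Cc: "s (Cc c) = Cc c"
begin

lemma s_T [simp]: "f \<in> T d \<Longrightarrow> s f \<in> T d" using bij by (auto simp: bij_betw_def)
lemma s_0 [simp]: "s 0 = 0" using s_Cc[of 0] by simp
lemma s_1 [simp]: "s 1 = 1" using s_Cc[of 1] by simp
lemma s_diff: "f \<in> T d \<Longrightarrow> g \<in> T d \<Longrightarrow> s (f - g) = s f - s g"
  using s_add[of "f - g" g] T_diff[of f d g] by simp
lemma s_sum: "(\<And>x. x \<in> A \<Longrightarrow> f x \<in> T d) \<Longrightarrow> s (sum f A) = (\<Sum>x\<in>A. s (f x))"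
  by (induction A rule: infinite_finite_induct) (auto simp: s_add T_sum)
lemma s_Cc_mult: "f \<in> T d \<Longrightarrow> s (Cc c * f) = Cc c * s f" by (simp add: s_mult s_Cc)

text \<open>f - \<kappa> is -\<kappa> times 1 - f/\<kappa>, and f/\<kappa> has norm below 1, so a
  geometric series inverts the second factor.\<close>

lemma unit_shift:
  assumes f: "f \<in> T D" "bd 1 f" and \<kappa>: "av \<kappa> > 1"
  shows "\<exists>g\<in>T D. (f - Cc \<kappa>) * g = 1"
proof -
  have \<kappa>0: "\<kappa> \<noteq> 0" using \<kappa> by auto
  define \<theta> where "\<theta> = inverse (av \<kappa>)"
  have \<theta>: "0 \<le> \<theta>" "\<theta> < 1" using \<kappa> by (auto simp: \<theta>_def inverse_less_1_iff)
  define u where "u = Cc (inverse \<kappa>) * f"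
  have u: "u \<in> T D" using f by (simp add: u_def T_mult)
  have "bd \<theta> u" unfolding u_def using bd_Cc_mult[OF f(2), of "inverse \<kappa>"] by (simp add: \<theta>_def av_inverse)
  hence bu: "bd (\<theta> ^ k * 1) (u ^ k)" for k
    by (induction k) (auto simp: mult.assoc dest: bd_mult)
  obtain g where g: "g \<in> T D" "\<And>k. bd (\<theta> ^ k * 1) (g - (\<Sum>i<k. u ^ i))"
    using T_series[OF \<theta>, of "\<lambda>k. u ^ k" D 1] T_power[OF u] bu by metis
  have "bd (\<theta> ^ k * 1) ((1 - u) * g - 1)" for k
  proof -
    have u1: "bd 1 (1 - u)" using bu[of 1] \<theta> by (intro bd_diff bd_one) (auto intro: bd_mono)
    have "(1 - u) * g - 1 = (g - (\<Sum>i<k. u ^ i)) * (1 - u) - u ^ k"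
      using one_diff_power_eq[of u k] by (simp add: algebra_simps)
    thus ?thesis using bd_diff[OF bd_mult1[OF g(2) u1] bu[of k]] by simp
  qed
  hence "(1 - u) * g = 1" using bd_geom_zero[OF \<theta>, of 1 "(1 - u) * g - 1"] by simp
  moreover have fe: "f - Cc \<kappa> = Cc (- \<kappa>) * (1 - u)"
  proof -
    have "Cc \<kappa> * u = (Cc (inverse \<kappa>) * Cc \<kappa>) * f" unfolding u_def by (simp only: mult_ac)
    hence "Cc \<kappa> * u = f" using Cc_inverse[OF \<kappa>0] by simp
    thus ?thesis by (simp add: Cc_uminus algebra_simps)
  qed
  moreover have "Cc (- \<kappa>) * Cc (inverse (- \<kappa>)) = 1" using \<kappa>0 by (simp flip: Cc_mult)
  moreover have "(f - Cc \<kappa>) * (g * Cc (inverse (- \<kappa>))) = (Cc (- \<kappa>) * Cc (inverse (- \<kappa>))) * ((1 - u) * g)"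
    unfolding fe by (simp only: mult_ac)
  ultimately have "(f - Cc \<kappa>) * (g * Cc (inverse (- \<kappa>))) = 1"
    by (simp only: mult_1_right)
  thus ?thesis using g(1) T_mult T_Cc by blast
qed

text \<open>Units detect the Gauss norm: if \<open>\<kappa>\<close> is a coefficient of \<open>s f\<close> with \<open>av \<kappa> > 1\<close>, then \<open>f - Cc \<kappa>\<close> is a
  unit, but the constant term of \<open>s f - Cc \<kappa>\<close> is not dominant.\<close>
lemma s_bd1: assumes f: "f \<in> T d" "bd 1 f" shows "bd 1 (s f)"
proof (rule ccontr)
  assume "\<not> bd 1 (s f)"
  then obtain \<alpha> where \<alpha>: "1 < av (cf (s f) \<alpha>)" by (auto simp: bd_def not_le)
  have key: "av (cf (s f) \<beta>) < av (cf (s f) (\<lambda>_. 0) - \<kappa>)" if \<kappa>: "1 < av \<kappa>" and \<beta>: "\<beta> \<noteq> (\<lambda>_. 0)" for \<kappa> \<beta>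
  proof -
    obtain g where g: "g \<in> T d" "(f - Cc \<kappa>) * g = 1" using unit_shift[OF f \<kappa>] by blast
    have "s ((f - Cc \<kappa>) * g) = (s f - Cc \<kappa>) * s g"
      using f(1) g(1) by (simp add: s_mult s_diff s_Cc T_diff)
    hence "(s f - Cc \<kappa>) * s g = 1" using g(2) by simp
    hence "av (cf (s f - Cc \<kappa>) \<beta>) < av (cf (s f - Cc \<kappa>) (\<lambda>_. 0))"
      using f g \<beta> by (intro unit_dominant[of _ d "s g"] T_diff) auto
    thus ?thesis using \<beta> by (simp add: cf_Cc)
  qed
  show False
  proof (cases "1 < av (cf (s f) (\<lambda>_. 0))")
    case True
    \<comment> \<open>With \<kappa> the constant term itself, the right side of \<open>key\<close>
      is 0, and any index other than 0 gives the contradiction.\<close>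
    have "(\<lambda>_::nat. 1::nat) \<noteq> (\<lambda>_. 0)" by (auto simp: fun_eq_iff)
    from key[OF True this] show False using av_nonneg by (simp add: not_less[symmetric])
  next
    case False
    hence "\<alpha> \<noteq> (\<lambda>_. 0)" using \<alpha> by auto
    from key[OF \<alpha> this] show False using av_diff[of "cf (s f) (\<lambda>_. 0)" "cf (s f) \<alpha>"] False \<alpha> by linarith
  qed
qed

text \<open>The Gauss norm is the absolute value of a coefficient, so division by that coefficient
  reduces to norm 1.\<close>

lemma s_bd: assumes f: "f \<in> T d" "bd r f" shows "bd r (s f)"
proof (cases "f = 0")
  case True thus ?thesis using f by simp
next
  case False
  then obtain \<alpha> where \<alpha>: "cf f \<alpha> \<noteq> 0" "bd (av (cf f \<alpha>)) f" using T_max[OF f(1)] by blast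
  define c where "c = cf f \<alpha>"
  define g where "g = Cc (inverse c) * f"
  have c: "c \<noteq> 0" "av c \<le> r" using \<alpha> bdD[OF f(2)] by (auto simp: c_def)
  have "Cc c * g = (Cc (inverse c) * Cc c) * f" unfolding g_def by (simp only: mult_ac)
  hence fg: "f = Cc c * g" using Cc_inverse[OF c(1)] by simp
  have gT: "g \<in> T d" using f by (simp add: g_def T_mult)
  have "bd 1 g" unfolding g_def using bd_Cc_mult[OF \<alpha>(2), of "inverse c"] c by (simp add: c_def av_inverse)
  hence "bd (av c * 1) (Cc c * s g)" using bd_Cc_mult s_bd1[OF gT] by blast
  hence "bd (av c) (s f)" by (simp add: fg s_Cc_mult[OF gT])
  thus ?thesis using c(2) bd_mono by blast
qed

lemma inv_aut: "tate_aut av d (inv_into (T d) s)"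
proof unfold_locales
  have img: "s ` T d = T d" and inj: "inj_on s (T d)" using bij by (auto simp: bij_betw_def)
  have iT: "inv_into (T d) s f \<in> T d" and si: "s (inv_into (T d) s f) = f" if "f \<in> T d" for f
    using that img by (simp_all add: inv_into_into f_inv_into_f)
  show "bij_betw (inv_into (T d) s) (T d) (T d)" using bij by (rule bij_betw_inv_into)
  have iis: "inv_into (T d) s (s f) = f" if "f \<in> T d" for f using that inj by simp
  fix f g assume fg: "f \<in> T d" "g \<in> T d"
  show "inv_into (T d) s (f + g) = inv_into (T d) s f + inv_into (T d) s g"
    using iis[of "inv_into (T d) s f + inv_into (T d) s g"] fg by (simp add: s_add iT si T_add)
  show "inv_into (T d) s (f * g) = inv_into (T d) s f * inv_into (T d) s g"
    using iis[of "inv_into (T d) s f * inv_into (T d) s g"] fg by (simp add: s_mult iT si T_mult)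
next
  fix c show "inv_into (T d) s (Cc c) = Cc c"
    using inv_into_f_f[of s "T d" "Cc c"] bij by (simp add: bij_betw_def s_Cc)
qed

text \<open>The previous bound for the inverse automorphism; together the two say that
  \<open>s\<close> preserves the Gauss norm.\<close>

lemma s_bd_rev: assumes "f \<in> T d" "bd r (s f)" shows "bd r f"
proof -
  have "inv_into (T d) s (s f) = f" using assms(1) bij by (simp add: bij_betw_def)
  thus ?thesis using tate_aut.s_bd[OF inv_aut s_T[OF assms(1)] assms(2)] by simp
qed

end

text \<open>In the application \<delta> is p^(-c), and \<open>\<delta> * q < 1\<close> is the
  hypothesis c > 1/(p-1): the decay of iterated differences beats the growth of 1/|m!|.\<close>

locale near_aut = padic av p + tate_aut av d s
  for av :: "'k::field \<Rightarrow> real" and p d :: nat and s :: "'k ps \<Rightarrow> 'k ps" +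
  fixes \<delta> :: real
  assumes near: "j < d \<Longrightarrow> bd \<delta> (s (X j) - X j)" and \<delta>: "0 < \<delta>" "\<delta> * q < 1"
begin

text \<open>Induction on the degree with the twisted Leibniz rule s(fg) - fg = (s(g) - g) s(f) +
  (s(f) - f) g, where \<open>s\<close> does not increase norms.\<close>

lemma near_mon: "multi_idx d \<alpha> \<Longrightarrow> bd \<delta> (s (mon 1 \<alpha>) - mon 1 \<alpha>)"
proof (induction "\<Sum>i<d. \<alpha> i" arbitrary: \<alpha>)
  case 0
  hence "\<alpha> i = 0" for i by (cases "i < d") (auto simp: multi_idx_def)
  hence "mon (1::'k) \<alpha> = 1" by (metis Cc_1 Cc_def ext)
  thus ?case using \<delta> by simp
next
  case (Suc N)
  have "\<exists>j<d. \<alpha> j \<noteq> 0"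
  proof (rule ccontr)
    assume "\<not> (\<exists>j<d. \<alpha> j \<noteq> 0)"
    hence "(\<Sum>i<d. \<alpha> i) = 0" by simp
    thus False using Suc.hyps(2) by simp
  qed
  then obtain j where j: "j < d" "\<alpha> j \<noteq> 0" by blast
  define \<beta> where "\<beta> = \<alpha>(j := \<alpha> j - 1)"
  have mi: "multi_idx d \<beta>" using Suc.prems j by (auto simp: multi_idx_def \<beta>_def)
  have \<alpha>: "\<alpha> = (\<lambda>i. (if i = j then 1 else 0) + \<beta> i)" using j by (auto simp: \<beta>_def)
  have "(\<Sum>i<d. \<alpha> i) = (\<Sum>i<d. if i = j then 1 else 0) + (\<Sum>i<d. \<beta> i)"
    by (subst \<alpha>) (rule sum.distrib)
  hence "N = (\<Sum>i<d. \<beta> i)" using Suc.hyps(2) j by simp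
  from Suc.hyps(1)[OF this mi] have IH: "bd \<delta> (s (mon 1 \<beta>) - mon 1 \<beta>)" .
  have fin: "fin_idx (\<lambda>i. if i = j then 1 else (0::nat))" by (rule finite_subset[of _ "{j}"]) auto
  have m: "mon 1 \<alpha> = X j * mon 1 \<beta>"
    by (subst \<alpha>) (simp add: X_def mon_mult[OF fin multi_idx_fin[OF mi]])
  have Xj: "X j \<in> T d" "mon 1 \<beta> \<in> T d" using j mi by (auto intro: T_X T_mon)
  have "s (mon 1 \<alpha>) - mon 1 \<alpha> = (s (mon 1 \<beta>) - mon 1 \<beta>) * s (X j) + (s (X j) - X j) * mon 1 \<beta>"
    unfolding m s_mult[OF Xj] by (simp add: algebra_simps)
  moreover have "bd \<delta> \<dots>" using IH near[OF j(1)] s_bd[OF Xj(1) bd_X]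
    by (intro bd_add bd_mult1) auto
  ultimately show ?case by simp
qed

text \<open>Truncation at \<delta> r: the tail is already that small and stays so under
  \<open>s\<close>, and the polynomial part reduces to monomials by linearity.\<close>

lemma near_bd: assumes f: "f \<in> T d" "bd r f" shows "bd (\<delta> * r) (s f - f)"
proof (cases "r = 0")
  case True
  hence "f = 0" using f(2) by (intro bd_all_zero) (auto intro: bd_mono)
  thus ?thesis using True by simp
next
  case False
  hence r: "r > 0" using bd_nonneg[OF f(2)] by simp
  hence \<epsilon>: "\<delta> * r > 0" using \<delta> by simp
  let ?F = "{\<alpha>. \<delta> * r \<le> av (cf f \<alpha>)}"
  define f0 where "f0 = (\<Sum>\<alpha>\<in>?F. mon (cf f \<alpha>) \<alpha>)"
  note tr = T_trunc[OF f(1) \<epsilon>]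
  have mT: "\<And>\<alpha>. \<alpha> \<in> ?F \<Longrightarrow> mon (cf f \<alpha>) \<alpha> \<in> T d" using tr(2) T_mon by blast
  have f0: "f0 \<in> T d" unfolding f0_def using mT by (rule T_sum)
  have f1: "bd (\<delta> * r) (f - f0)" using tr(3) by (simp add: f0_def)
  have "bd (\<delta> * r) (s (f - f0))" using s_bd[OF T_diff[OF f(1) f0] f1] .
  hence "bd (\<delta> * r) (s (f - f0) - (f - f0))" using f1 bd_diff by blast
  moreover have "bd (\<delta> * r) (s f0 - f0)"
  proof -
    have "s f0 = (\<Sum>\<alpha>\<in>?F. s (mon (cf f \<alpha>) \<alpha>))"
      unfolding f0_def by (rule s_sum) (rule mT)
    hence "s f0 - f0 = (\<Sum>\<alpha>\<in>?F. s (mon (cf f \<alpha>) \<alpha>) - mon (cf f \<alpha>) \<alpha>)"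
      by (simp only: f0_def sum_subtractf)
    also have "bd (\<delta> * r) \<dots>"
    proof (rule bd_sum)
      fix \<alpha> assume \<alpha>: "\<alpha> \<in> ?F"
      have "s (mon (cf f \<alpha>) \<alpha>) - mon (cf f \<alpha>) \<alpha> = Cc (cf f \<alpha>) * (s (mon 1 \<alpha>) - mon 1 \<alpha>)"
        unfolding mon_eq_Cc_mult[of "cf f \<alpha>"] s_Cc_mult[OF T_mon[OF tr(2)[OF \<alpha>]]] right_diff_distrib ..
      moreover have "bd (av (cf f \<alpha>) * \<delta>) \<dots>" using near_mon[OF tr(2)[OF \<alpha>]] by (rule bd_Cc_mult)
      moreover have "av (cf f \<alpha>) * \<delta> \<le> \<delta> * r" using bdD[OF f(2)] \<delta> by (simp add: mult.commute)
      ultimately show "bd (\<delta> * r) (s (mon (cf f \<alpha>) \<alpha>) - mon (cf f \<alpha>) \<alpha>)" using bd_mono by metis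
    qed (use \<epsilon> in simp)
    finally show ?thesis .
  qed
  moreover have "s f - f = (s (f - f0) - (f - f0)) + (s f0 - f0)" by (simp add: s_diff[OF f(1) f0])
  ultimately show ?thesis using bd_add by metis
qed

text \<open>The iterated difference (s - 1)^m f.\<close>

definition delta :: "nat \<Rightarrow> 'k ps \<Rightarrow> 'k ps" where "delta m f = ((\<lambda>f. s f - f) ^^ m) f"

lemma delta_0 [simp]: "delta 0 f = f" by (simp add: delta_def)
lemma delta_Suc: "delta (Suc m) f = s (delta m f) - delta m f" by (simp add: delta_def)
lemma delta_T: "f \<in> T d \<Longrightarrow> delta m f \<in> T d" by (induction m) (simp_all add: delta_Suc T_diff)
lemma delta_bd: "f \<in> T d \<Longrightarrow> bd r f \<Longrightarrow> bd (\<delta> ^ m * r) (delta m f)"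
  by (induction m) (auto simp: delta_Suc mult.assoc intro!: near_bd delta_T)

text \<open>Truncation of the binomial expansion of s^n = (1 + (s - 1))^n applied to f.\<close>

definition newton :: "nat \<Rightarrow> int \<Rightarrow> 'k ps \<Rightarrow> 'k ps" where
  "newton M n f = (\<Sum>m<M. Cc (bin n m) * delta m f)"

lemma newton_T: "f \<in> T d \<Longrightarrow> newton M n f \<in> T d"
  unfolding newton_def by (intro T_sum T_mult T_Cc delta_T)

text \<open>By Pascal's rule \<open>s\<close> acts on the expansion as the shift of n; truncation
  leaves the single boundary term.\<close>

lemma s_newton:
  assumes f: "f \<in> T d"
  shows "s (newton (Suc M) n f) = newton (Suc M) (n + 1) f + Cc (bin n M) * delta (Suc M) f"
proof (induction M)
  case 0
  show ?case by (simp add: newton_def delta_Suc)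
next
  case (Suc M)
  have "newton (Suc (Suc M)) n f = newton (Suc M) n f + Cc (bin n (Suc M)) * delta (Suc M) f" for n
    by (simp add: newton_def)
  note step = this
  have "s (newton (Suc (Suc M)) n f) = s (newton (Suc M) n f) + Cc (bin n (Suc M)) * s (delta (Suc M) f)"
    unfolding step using f by (simp add: s_add s_Cc_mult newton_T delta_T T_mult)
  also have "s (delta (Suc M) f) = delta (Suc M) f + delta (Suc (Suc M)) f" by (simp add: delta_Suc[of "Suc M"])
  finally show ?case unfolding Suc step[of "n + 1"] bin_Suc Cc_add by (simp add: algebra_simps)
qed

text \<open>The error terms for \<open>n\<close> and \<open>n + 1\<close> are related by the isometry \<open>s\<close>, so the bound
  propagates from \<open>n = 0\<close> in both directions.\<close>
lemma newton_error:
  assumes F: "\<And>n. F n \<in> T d" "\<And>n::int. s (F n) = F (n + 1)" and r: "bd r (F 0)"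
  shows "bd (\<delta> ^ M * r) (F n - newton M n (F 0))"
proof -
  have r0: "0 \<le> r" using bd_nonneg[OF r] .
  have nT: "F n - newton M n (F 0) \<in> T d" for n M using F(1) newton_T T_diff by blast
  show ?thesis
  \<comment> \<open>At M = 0 the sum is empty and has no boundary term; the claim is then that all
    \<open>F n\<close> share the bound of \<open>F 0\<close>.\<close>
  proof (cases M)
    case 0
    have "bd r (F n)"
    proof (induction n rule: int_induct[where k = 0])
      case (step1 n) thus ?case using s_bd[OF F(1)[of n]] F(2)[of n] by simp
    next
      case (step2 n) thus ?case using s_bd_rev[OF F(1)[of "n - 1"]] F(2)[of "n - 1"] by simp
    qed (rule r)
    thus ?thesis by (simp add: 0 newton_def)
  next
    case (Suc M')
    have rel: "s (F n - newton M n (F 0)) = (F (n + 1) - newton M (n + 1) (F 0)) - Cc (bin n M') * delta M (F 0)" for n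
      unfolding Suc s_diff[OF F(1) newton_T[OF F(1)]] s_newton[OF F(1)] F(2) by simp
    have "bd (av (bin n M') * (\<delta> ^ M * r)) (Cc (bin n M') * delta M (F 0))" for n
      using delta_bd[OF F(1) r] by (rule bd_Cc_mult)
    moreover have "av (bin n M') * (\<delta> ^ M * r) \<le> \<delta> ^ M * r" for n
      using av_bin[of n M'] r0 \<delta> by (intro mult_left_le_one_le) auto
    ultimately have b: "bd (\<delta> ^ M * r) (Cc (bin n M') * delta M (F 0))" for n using bd_mono by blast
    show ?thesis
    proof (induction n rule: int_induct[where k = 0])
      case base
      have "newton M 0 (F 0) = F 0" unfolding Suc newton_def by (subst sum.lessThan_Suc_shift) simp
      thus ?case using \<delta> r0 by simp
    next
      case (step1 n)
      have "bd (\<delta> ^ M * r) (s (F n - newton M n (F 0)))" using s_bd[OF nT step1(2)] .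
      from bd_add[OF this b[of n]] show ?case unfolding rel by simp
    next
      case (step2 n)
      have "bd (\<delta> ^ M * r) (s (F (n - 1) - newton M (n - 1) (F 0)))"
        using bd_diff[OF step2(2) b[of "n - 1"]] unfolding rel by simp
      thus ?case using s_bd_rev[OF nT] by blast
    qed
  qed
qed

text \<open>\<open>F\<close> is a two-sided orbit of \<open>s\<close>. Its Newton series converges
  in S<z> since the m-th term has norm at most (\<delta> q)^m r; the values at integers are
  identified by the error bound and closedness of the ideal of z - n.\<close>

lemma interpolation:
  assumes F: "\<And>n. F n \<in> T d" "\<And>n::int. s (F n) = F (n + 1)"
  shows "\<exists>G\<in>T (Suc d). \<forall>n. cong_lin d (of_int n) G (F n)"
proof -
  obtain r where r: "bd r (F 0)" using T_bdd[OF F(1)] by blast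
  have r0: "0 \<le> r" using bd_nonneg[OF r] .
  define \<theta> where "\<theta> = \<delta> * q"
  have \<theta>: "0 \<le> \<theta>" "\<theta> < 1" "\<delta> \<le> \<theta>" using \<delta> q_ge1 mult_left_mono[OF q_ge1, of \<delta>] by (auto simp: \<theta>_def)
  \<comment> \<open>The binomial polynomial z(z-1)...(z-m+1)/m!. Its numerator has norm at most 1,
    so only the factorial costs.\<close>
  define B where "B m = Cc (inverse (of_nat (fact m) :: 'k)) * (\<Prod>j<m. X d - Cc (of_nat j))" for m
  have XT: "X d - Cc c \<in> T (Suc d)" for c by (intro T_diff T_X T_Cc) simp
  have TT: "T d \<subseteq> T (Suc d)" by (rule T_mono) simp
  have BT: "B m \<in> T (Suc d)" for m unfolding B_def by (intro T_mult T_Cc T_prod XT)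
  have Bb: "bd (q ^ m) (B m)" for m
  proof -
    have "bd (av (inverse (of_nat (fact m)))) (B m)"
      unfolding B_def by (intro bd_mult1 bd_prod bd_diff bd_X bd_Cc av_of_nat order_refl)
    thus ?thesis using inverse_av_fact[of m] bd_mono by (simp add: av_inverse)
  qed
  define t where "t m = B m * delta m (F 0)" for m
  have tT: "t m \<in> T (Suc d)" for m unfolding t_def using BT delta_T[OF F(1)] TT by (intro T_mult) auto
  have tb: "bd (\<theta> ^ m * r) (t m)" for m
    unfolding t_def \<theta>_def using bd_mult[OF Bb[of m] delta_bd[OF F(1) r, of m]] by (simp add: power_mult_distrib mult_ac)
  obtain G where G: "G \<in> T (Suc d)" "\<And>k. bd (\<theta> ^ k * r) (G - (\<Sum>i<k. t i))"
    using T_series[OF \<theta>(1,2) tT tb] by blast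
  have "cong_lin d (of_int n) G (F n)" for n
    unfolding cong_lin_def
  proof (rule linear_ideal_closed)
    show "av (of_int n) \<le> 1" by (rule av_of_int)
    show "G - F n \<in> T (Suc d)" using G(1) F(1) TT by (intro T_diff) auto
    fix \<epsilon> :: real assume "\<epsilon> > 0"
    then obtain M where M: "\<theta> ^ M * r < \<epsilon>" using geom_small[OF \<theta>(1,2)] by blast
    have "cong_lin d (of_int n) (B m) (Cc (bin n m))" for m
      unfolding B_def bin_def Cc_mult Cc_prod
      by (intro cong_lin_mult cong_lin_prod cong_lin_refl cong_lin_X_diff XT T_Cc T_prod)
    hence "cong_lin d (of_int n) (\<Sum>m<M. t m) (newton M n (F 0))"
      \<comment> \<open>For finite sums, setting z = n turns binomial polynomials into binomial
        coefficients; the limit is taken afterwards.\<close>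
      unfolding t_def newton_def using BT delta_T[OF F(1)] TT by (intro cong_lin_sum cong_lin_mult cong_lin_refl) auto
    then obtain W where W: "W \<in> T (Suc d)" "(\<Sum>m<M. t m) - newton M n (F 0) = (X d - Cc (of_int n)) * W"
      by (auto simp: cong_lin_def)
    have "bd (\<theta> ^ M * r) (F n - newton M n (F 0))"
      using newton_error[OF F r, of M n] \<theta> \<delta> r0 by (auto elim!: bd_mono intro!: mult_right_mono power_mono)
    moreover have "G - F n - (X d - Cc (of_int n)) * W = (G - (\<Sum>m<M. t m)) - (F n - newton M n (F 0))"
      by (simp flip: W(2))
    ultimately have "bd (\<theta> ^ M * r) (G - F n - (X d - Cc (of_int n)) * W)"
      using bd_diff[OF G(2)] by (simp only:)
    thus "\<exists>W\<in>T (Suc d). bd \<epsilon> (G - F n - (X d - Cc (of_int n)) * W)"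
      using W(1) M bd_mono less_imp_le by blast
  qed
  thus ?thesis using G(1) by blast
qed

end

section \<open>Local constancy of fibres\<close>

lemma scal_lin_comb: "scal c (lin_comb m h g) = lin_comb m h (\<lambda>k. scal c (g k))"
  by (simp add: scal_def lin_comb_def fun_eq_iff sum_distrib_left mult_ac)
lemma scal_scal: "scal a (scal b u) = scal (a * b) u" by (simp add: scal_simps)
lemma scal_comm: "scal a (scal b u) = scal b (scal a u)" by (simp add: scal_def fun_eq_iff mult_ac)
lemma lin_comb_add_right: "lin_comb m h (\<lambda>j. g j + g' j) = lin_comb m h g + lin_comb m h g'"
  by (simp add: lin_comb_def fun_eq_iff algebra_simps sum.distrib)

context nonarch
begin

lemma lin_T: "X d - Cc \<nu> \<in> T (Suc d)" by (intro T_diff T_X T_Cc) simp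

lemma submod_sum_scal:
  assumes P: "submod D a b P" and Q: "submod D a b Q" and c: "c \<in> T D"
  shows "submod D a b {v + scal c w | v w. v \<in> P \<and> w \<in> Q}"
  unfolding submod_def
proof (intro conjI ballI)
  show "{v + scal c w | v w. v \<in> P \<and> w \<in> Q} \<subseteq> Mat D a b"
    using submodD(1)[OF P] submodD(1)[OF Q] submodD(3,4)[OF submod_Mat] c by blast
  have "0 = 0 + scal c 0" by (simp add: scal_simps)
  thus "0 \<in> {v + scal c w | v w. v \<in> P \<and> w \<in> Q}" using submodD(2)[OF P] submodD(2)[OF Q] by blast
  fix x assume "x \<in> {v + scal c w | v w. v \<in> P \<and> w \<in> Q}"
  then obtain v w where x: "x = v + scal c w" "v \<in> P" "w \<in> Q" by blast
  show "scal t x \<in> {v + scal c w | v w. v \<in> P \<and> w \<in> Q}" if t: "t \<in> T D" for t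
  proof -
    have "scal t x = scal t v + scal c (scal t w)"
      unfolding x scal_simps(1) scal_comm[of t c] ..
    thus ?thesis using submodD(4)[OF P t x(2)] submodD(4)[OF Q t x(3)] by blast
  qed
  fix y assume "y \<in> {v + scal c w | v w. v \<in> P \<and> w \<in> Q}"
  then obtain v' w' where y: "y = v' + scal c w'" "v' \<in> P" "w' \<in> Q" by blast
  have "x + y = (v + v') + scal c (w + w')" unfolding x y scal_simps by (simp add: algebra_simps)
  thus "x + y \<in> {v + scal c w | v w. v \<in> P \<and> w \<in> Q}"
    using submodD(3)[OF P x(2) y(2)] submodD(3)[OF Q x(3) y(3)] by blast
qed

text \<open>The fibre at \<open>\<nu>\<close> of the quotient of \<open>Zs\<close> by \<open>B\<close> vanishes.\<close>
definition fibre_zero :: "nat \<Rightarrow> 'k pmat set \<Rightarrow> 'k pmat set \<Rightarrow> 'k \<Rightarrow> bool" where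
  "fibre_zero d Zs B \<nu> \<longleftrightarrow> (\<forall>\<zeta>\<in>Zs. \<exists>v\<in>B. \<exists>w\<in>Zs. \<zeta> = v + scal (X d - Cc \<nu>) w)"

text \<open>A decomposition at \<mu> read at \<mu>' has the error (\<mu>' - \<mu>) w, which is
  smaller than \<zeta> by the factor C |\<mu>' - \<mu>|. Repetition puts \<zeta> into the closure of
  B + (z - \<mu>') Zs, and submodules are closed.\<close>

lemma fibre_zero_transfer:
  assumes Zs: "submod (Suc d) a b Zs" and B: "submod (Suc d) a b B" "B \<subseteq> Zs"
    and H: "\<And>\<zeta> r. \<zeta> \<in> Zs \<Longrightarrow> mbd r \<zeta> \<Longrightarrow> \<exists>v\<in>B. \<exists>w\<in>Zs. \<zeta> = v + scal (X d - Cc \<mu>) w \<and> mbd (C * r) w"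
    and C: "0 \<le> C" "C * av (\<mu>' - \<mu>) < 1"
  shows "fibre_zero d Zs B \<mu>'"
  unfolding fibre_zero_def
proof
  fix \<zeta> assume \<zeta>: "\<zeta> \<in> Zs"
  define P where "P = {v + scal (X d - Cc \<mu>') w | v w. v \<in> B \<and> w \<in> Zs}"
  have P: "submod (Suc d) a b P" unfolding P_def by (rule submod_sum_scal[OF B(1) Zs lin_T])
  have PZ: "P \<subseteq> Zs" unfolding P_def
    using submodD(3)[OF Zs] submodD(4)[OF Zs lin_T] B(2) by blast
  obtain r where r: "mbd r \<zeta>" using Mat_bdd[OF submodD(1)[OF Zs \<zeta>]] by blast
  define \<theta> where "\<theta> = C * av (\<mu>' - \<mu>)"
  have \<theta>: "0 \<le> \<theta>" "\<theta> < 1" using C by (auto simp: \<theta>_def)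
  have mat_vec: "\<exists>y\<in>P. mbd (\<theta> ^ k * r) (\<zeta> - y)" for k
  proof (induction k)
    case 0
    thus ?case using r submodD(2)[OF P] by (intro bexI[of _ 0]) auto
  next
    case (Suc k)
    then obtain y where y: "y \<in> P" "mbd (\<theta> ^ k * r) (\<zeta> - y)" by blast
    have "\<zeta> - y \<in> Zs" using submodD(6)[OF Zs \<zeta>] y(1) PZ by blast
    then obtain v w where vw: "v \<in> B" "w \<in> Zs" "\<zeta> - y = v + scal (X d - Cc \<mu>) w" "mbd (C * (\<theta> ^ k * r)) w"
      using H y(2) by blast
    have "v + scal (X d - Cc \<mu>') w \<in> P" using vw(1,2) by (auto simp: P_def)
    hence "y + (v + scal (X d - Cc \<mu>') w) \<in> P" using submodD(3)[OF P y(1)] by blast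
    moreover have "\<zeta> - (y + (v + scal (X d - Cc \<mu>') w)) = scal (Cc (\<mu>' - \<mu>)) w"
    proof -
      have "\<zeta> - (y + (v + scal (X d - Cc \<mu>') w)) = (\<zeta> - y) - v - scal (X d - Cc \<mu>') w" by simp
      also have "\<dots> = scal (X d - Cc \<mu>) w - scal (X d - Cc \<mu>') w" unfolding vw(3) by simp
      finally show ?thesis by (simp add: Cc_diff flip: scal_simps(4))
    qed
    moreover have "mbd (av (\<mu>' - \<mu>) * (C * (\<theta> ^ k * r))) (scal (Cc (\<mu>' - \<mu>)) w)"
      by (rule mbd_scal[OF bd_Cc[OF order_refl] vw(4)])
    hence "mbd (\<theta> ^ Suc k * r) (scal (Cc (\<mu>' - \<mu>)) w)" by (simp add: \<theta>_def mult_ac)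
    ultimately show ?case by metis
  qed
  have "\<zeta> \<in> P"
  proof (rule submod_closed[OF P submodD(1)[OF Zs \<zeta>]])
    fix \<epsilon> :: real assume "\<epsilon> > 0"
    then obtain k where k: "\<theta> ^ k * r < \<epsilon>" using geom_small[OF \<theta>] by blast
    obtain y where "y \<in> P" "mbd (\<theta> ^ k * r) (\<zeta> - y)" using mat_vec by blast
    thus "\<exists>w\<in>P. mbd \<epsilon> (\<zeta> - w)" using mbd_mono[of "\<theta> ^ k * r" "\<zeta> - y" \<epsilon>] k by auto
  qed
  thus "\<exists>v\<in>B. \<exists>w\<in>Zs. \<zeta> = v + scal (X d - Cc \<mu>') w" unfolding P_def by blast
qed

text \<open>Strict generators of \<open>B + (X d - Cc \<kappa>) Zs\<close> stand in for the open mapping theorem.\<close>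
lemma saturated_strict:
  assumes Zs: "submod (Suc d) a b Zs" and B: "submod (Suc d) a b B" "B \<subseteq> Zs"
    and sat: "\<And>w. w \<in> Zs \<Longrightarrow> scal (X d - Cc \<kappa>) w \<in> B \<Longrightarrow> w \<in> B"
  shows "\<exists>C>0. \<forall>w\<in>Zs. \<forall>v\<in>B. \<forall>r. mbd r (v + scal (X d - Cc \<kappa>) w) \<longrightarrow> (\<exists>v'\<in>B. mbd (C * r) (w - v'))"
proof -
  let ?l = "X d - Cc \<kappa>"
  define P where "P = {v + scal ?l w | v w. v \<in> B \<and> w \<in> Zs}"
  have P: "submod (Suc d) a b P" unfolding P_def by (rule submod_sum_scal[OF B(1) Zs lin_T])
  obtain m and g where g: "\<And>k. k < m \<Longrightarrow> g k \<in> P"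
    "\<And>v r. v \<in> P \<Longrightarrow> mbd r v \<Longrightarrow> \<exists>h. (\<forall>k<m. h k \<in> T (Suc d) \<and> bd r (h k)) \<and> v = lin_comb m h g"
    using strict_generators[OF P] by metis
  have "\<exists>v w C. k < m \<longrightarrow> v \<in> B \<and> w \<in> Zs \<and> g k = v + scal ?l w \<and> 0 < C \<and> mbd C w" for k
  proof (cases "k < m")
    case True
    then obtain v w where vw: "v \<in> B" "w \<in> Zs" "g k = v + scal ?l w" using g(1) unfolding P_def by blast
    obtain C where "0 < C" "mbd C w" using Mat_bdd[OF submodD(1)[OF Zs vw(2)]] by blast
    thus ?thesis using vw by blast
  qed blast
  then obtain v' w' C' where vw: "\<And>k. k < m \<Longrightarrow> v' k \<in> B \<and> w' k \<in> Zs \<and> g k = v' k + scal ?l (w' k) \<and> 0 < (C' k::real) \<and> mbd (C' k) (w' k)"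
    by metis
  define C where "C = Max (insert 1 (C' ` {..<m}))"
  have C1: "1 \<le> C" unfolding C_def by (intro Max_ge) auto
  have CC: "C' k \<le> C" if "k < m" for k unfolding C_def using that by (intro Max_ge) auto
  have "\<exists>x\<in>B. mbd (C * r) (w - x)" if w: "w \<in> Zs" "v \<in> B" and r: "mbd r (v + scal ?l w)" for w v r
  proof -
    have "v + scal ?l w \<in> P" using w unfolding P_def by blast
    then obtain h where h: "\<forall>k<m. h k \<in> T (Suc d) \<and> bd r (h k)" "v + scal ?l w = lin_comb m h g"
      using g(2) r by blast
    \<comment> \<open>\<open>y\<close> has the required bound by construction, and saturation will
      show that it agrees with \<open>w\<close> modulo \<open>B\<close>.\<close>
    define y where "y = lin_comb m h w'"
    have yZ: "y \<in> Zs" unfolding y_def using h(1) vw by (intro submod_lin_comb[OF Zs]) auto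
    have lv: "lin_comb m h v' \<in> B" using h(1) vw by (intro submod_lin_comb[OF B(1)]) auto
    have "lin_comb m h g = lin_comb m h (\<lambda>k. v' k + scal ?l (w' k))"
      unfolding lin_comb_def using vw by (intro ext sum.cong) auto
    hence "v + scal ?l w = lin_comb m h v' + scal ?l y"
      unfolding h(2) by (simp add: lin_comb_add_right scal_lin_comb y_def)
    hence "scal ?l (w - y) = lin_comb m h v' - v" unfolding scal_simps by (simp add: algebra_simps)
    hence "scal ?l (w - y) \<in> B" using submodD(6)[OF B(1) lv w(2)] by simp
    hence wy: "w - y \<in> B" using sat submodD(6)[OF Zs w(1) yZ] by blast
    have "mbd (r * C) y" unfolding y_def
      using h(1) vw CC C1 mbd_nonneg[OF r] by (intro mbd_lin_comb) (auto intro: mbd_mono)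
    hence "mbd (C * r) (w - (w - y))" by (simp add: mult.commute)
    thus ?thesis using wy by blast
  qed
  thus ?thesis using C1 by (intro exI[of _ C]) auto
qed

text \<open>\<open>B\<close> is enlarged to its saturation under z - \<kappa>. Away from \<kappa>
  the fibres do not notice; for the saturation the strict estimate holds at \<kappa>, and vanishing
  can be transferred between \<kappa> and every nearby \<nu> in both directions.\<close>

lemma fibre_zero_locally_constant:
  assumes Zs: "submod (Suc d) a b Zs" and B: "submod (Suc d) a b B" "B \<subseteq> Zs"
  shows "\<exists>\<epsilon>>0. \<exists>c. \<forall>\<nu>. \<nu> \<noteq> \<kappa> \<longrightarrow> av (\<nu> - \<kappa>) < \<epsilon> \<longrightarrow> fibre_zero d Zs B \<nu> = c"
proof -
  let ?l = "X d - Cc \<kappa>"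
  \<comment> \<open>The preimage in \<open>Zs\<close> of the (z - \<kappa>)-power torsion of the
    quotient of \<open>Zs\<close> by \<open>B\<close>.\<close>
  define B' where "B' = {w \<in> Zs. \<exists>m. scal (?l ^ m) w \<in> B}"
  have up: "scal (?l ^ (m + n)) w \<in> B" if w: "scal (?l ^ m) w \<in> B" for m n w
  proof -
    have "?l ^ n \<in> T (Suc d)" by (intro T_power lin_T)
    from submodD(4)[OF B(1) this w] show ?thesis by (simp add: scal_scal power_add mult.commute)
  qed
  have BB: "B \<subseteq> B'"
  proof
    fix w assume "w \<in> B"
    thus "w \<in> B'" using B(2) by (auto simp: B'_def scal_simps intro!: exI[of _ 0])
  qed
  have B'Z: "B' \<subseteq> Zs" by (auto simp: B'_def)
  have B': "submod (Suc d) a b B'"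
    unfolding submod_def
  proof (intro conjI ballI)
    show "B' \<subseteq> Mat (Suc d) a b" using B'Z submodD(1)[OF Zs] by blast
    show "0 \<in> B'" using BB submodD(2)[OF B(1)] by blast
    fix u assume u: "u \<in> B'"
    then obtain m where m: "scal (?l ^ m) u \<in> B" by (auto simp: B'_def)
    show "u + v \<in> B'" if v: "v \<in> B'" for v
    proof -
      obtain n where n: "scal (?l ^ n) v \<in> B" using v by (auto simp: B'_def)
      have "scal (?l ^ (m + n)) (u + v) \<in> B"
        unfolding scal_simps using submodD(3)[OF B(1) up[OF m, of n] up[OF n, of m]] by (simp add: add.commute)
      moreover have "u + v \<in> Zs" using u v B'Z submodD(3)[OF Zs] by blast
      ultimately show ?thesis by (auto simp: B'_def)
    qed
    show "scal c u \<in> B'" if c: "c \<in> T (Suc d)" for c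
    proof -
      have "scal (?l ^ m) (scal c u) \<in> B" unfolding scal_comm[of _ c] using submodD(4)[OF B(1) c m] .
      moreover have "scal c u \<in> Zs" using submodD(4)[OF Zs c] u B'Z by blast
      ultimately show ?thesis by (auto simp: B'_def)
    qed
  qed
  have eq: "fibre_zero d Zs B \<nu> = fibre_zero d Zs B' \<nu>" if \<nu>: "\<nu> \<noteq> \<kappa>" for \<nu>
  proof
    assume "fibre_zero d Zs B \<nu>"
    thus "fibre_zero d Zs B' \<nu>" using BB unfolding fibre_zero_def by blast
  next
    assume f: "fibre_zero d Zs B' \<nu>"
    let ?n = "X d - Cc \<nu>"
    \<comment> \<open>Modulo z - \<nu> the power (z - \<kappa>)^m is the nonzero constant (\<nu> -
      \<kappa>)^m, so it can be inverted there and torsion elements die in the fibre.\<close>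
    have dec: "\<exists>x\<in>B. \<exists>y\<in>Zs. v = x + scal ?n y" if v: "v \<in> B'" for v
    proof -
      obtain m where m: "scal (?l ^ m) v \<in> B" using v by (auto simp: B'_def)
      define c where "c = (\<nu> - \<kappa>) ^ m"
      have c0: "c \<noteq> 0" using \<nu> by (simp add: c_def)
      have "cong_lin d \<nu> (\<Prod>i<m. ?l) (\<Prod>i<m. Cc (\<nu> - \<kappa>))"
        by (intro cong_lin_prod cong_lin_X_diff lin_T T_Cc)
      then obtain W where W: "W \<in> T (Suc d)" "?l ^ m - Cc c = ?n * W"
        by (auto simp: cong_lin_def c_def Cc_power)
      let ?i = "Cc (inverse c)"
      have "Cc c = ?l ^ m - ?n * W" using W(2) by (simp add: algebra_simps)
      moreover have "?i * (?l ^ m) + ?n * (- (?i * W)) = ?i * (?l ^ m - ?n * W)" by (simp add: algebra_simps)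
      ultimately have "?i * (?l ^ m) + ?n * (- (?i * W)) = ?i * Cc c" by simp
      also have "\<dots> = 1" using Cc_inverse[OF c0] .
      finally have "scal (?i * (?l ^ m) + ?n * (- (?i * W))) v = v" by (simp add: scal_simps)
      hence "v = scal ?i (scal (?l ^ m) v) + scal ?n (scal (- (?i * W)) v)"
        by (simp only: scal_simps(3) scal_scal)
      moreover have "scal ?i (scal (?l ^ m) v) \<in> B" using submodD(4)[OF B(1) T_Cc m] .
      moreover have "scal (- (?i * W)) v \<in> Zs" using v B'Z W(1)
        by (intro submodD(4)[OF Zs] T_uminus T_mult T_Cc) auto
      ultimately show ?thesis by blast
    qed
    show "fibre_zero d Zs B \<nu>"
      unfolding fibre_zero_def
    proof
      fix \<zeta> assume "\<zeta> \<in> Zs"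
      then obtain v w where vw: "v \<in> B'" "w \<in> Zs" "\<zeta> = v + scal ?n w" using f unfolding fibre_zero_def by blast
      obtain x y where xy: "x \<in> B" "y \<in> Zs" "v = x + scal ?n y" using dec[OF vw(1)] by blast
      have "\<zeta> = x + scal ?n (y + w)" unfolding vw(3) xy(3) scal_simps by (simp add: add.assoc)
      thus "\<exists>v\<in>B. \<exists>w\<in>Zs. \<zeta> = v + scal ?n w" using xy(1) submodD(3)[OF Zs xy(2) vw(2)] by blast
    qed
  qed
  have sat: "w \<in> B'" if w: "w \<in> Zs" "scal ?l w \<in> B'" for w
  proof -
    obtain m where "scal (?l ^ m) (scal ?l w) \<in> B" using w(2) by (auto simp: B'_def)
    hence "scal (?l ^ Suc m) w \<in> B" by (simp add: scal_scal mult.commute)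
    thus ?thesis using w(1) by (auto simp: B'_def simp del: power_Suc)
  qed
  obtain C where C: "C > 0" "\<And>w v r. w \<in> Zs \<Longrightarrow> v \<in> B' \<Longrightarrow> mbd r (v + scal ?l w) \<Longrightarrow> \<exists>v'\<in>B'. mbd (C * r) (w - v')"
    using saturated_strict[OF Zs B' B'Z sat] by metis
  \<comment> \<open>The strict estimate bounds \<open>w\<close> only up to an element of
    \<open>B'\<close>; that element is absorbed into the first summand.\<close>
  have shift: "\<exists>v1\<in>B'. v + scal (X d - Cc \<nu>) w = v1 + scal (X d - Cc \<nu>) (w - v')" if "v \<in> B'" "v' \<in> B'" for v v' w \<nu>
  proof -
    have "v + scal (X d - Cc \<nu>) w = (v + scal (X d - Cc \<nu>) v') + scal (X d - Cc \<nu>) (w - v')"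
      by (simp add: scal_simps(2))
    thus ?thesis using submodD(3)[OF B' that(1) submodD(4)[OF B' lin_T that(2)]] by blast
  qed
  have "fibre_zero d Zs B' \<nu> = fibre_zero d Zs B' \<kappa>" if \<nu>: "av (\<nu> - \<kappa>) < inverse C" for \<nu>
  proof
    assume f: "fibre_zero d Zs B' \<kappa>"
    show "fibre_zero d Zs B' \<nu>"
    proof (rule fibre_zero_transfer[OF Zs B' B'Z])
      fix \<zeta> r assume \<zeta>: "\<zeta> \<in> Zs" "mbd r \<zeta>"
      obtain v w where vw: "v \<in> B'" "w \<in> Zs" "\<zeta> = v + scal ?l w" using f \<zeta>(1) unfolding fibre_zero_def by blast
      obtain v' where v': "v' \<in> B'" "mbd (C * r) (w - v')" using C(2)[OF vw(2,1)] \<zeta>(2) vw(3) by blast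
      show "\<exists>v\<in>B'. \<exists>w\<in>Zs. \<zeta> = v + scal ?l w \<and> mbd (C * r) w"
        using shift[OF vw(1) v'(1), of \<kappa> w] v'(2) submodD(6)[OF Zs vw(2)] v'(1) B'Z unfolding vw(3) by blast
    qed (use C(1) \<nu> in \<open>auto simp: field_simps\<close>)
  next
    assume f: "fibre_zero d Zs B' \<nu>"
    define \<theta> where "\<theta> = C * av (\<nu> - \<kappa>)"
    have \<theta>: "0 \<le> \<theta>" "\<theta> < 1" using C(1) \<nu> by (auto simp: \<theta>_def field_simps)
    show "fibre_zero d Zs B' \<kappa>"
    proof (rule fibre_zero_transfer[OF Zs B' B'Z, of \<nu> C])
      fix \<zeta> r assume \<zeta>: "\<zeta> \<in> Zs" "mbd r \<zeta>"
      show "\<exists>v\<in>B'. \<exists>w\<in>Zs. \<zeta> = v + scal (X d - Cc \<nu>) w \<and> mbd (C * r) w"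
      \<comment> \<open>For r = 0 the iteration below would approach its target C r without reaching
        it.\<close>
      proof (cases "r = 0")
        case True
        hence "\<zeta> = 0" using \<zeta>(2) mbd_zero_iff by simp
        thus ?thesis using True submodD(2)[OF B'] submodD(2)[OF Zs]
          by (intro bexI[of _ 0]) (auto simp: scal_simps)
      next
        case False
        hence r: "r > 0" using mbd_nonneg[OF \<zeta>(2)] by simp
        obtain v0 w0 where vw0: "v0 \<in> B'" "w0 \<in> Zs" "\<zeta> = v0 + scal (X d - Cc \<nu>) w0"
          using f \<zeta>(1) unfolding fibre_zero_def by blast
        obtain s where s: "mbd s w0" using Mat_bdd[OF submodD(1)[OF Zs vw0(2)]] by blast
        \<comment> \<open>Vanishing at \<nu> gives some w with no control of its norm. Each pass
          through the estimate at \<kappa> improves a bound t to max (C r) (\<theta> t), so finitely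
          many passes reach C r.\<close>
        have it: "\<exists>v\<in>B'. \<exists>w\<in>Zs. \<zeta> = v + scal (X d - Cc \<nu>) w \<and> mbd (max (C * r) (\<theta> ^ k * s)) w" for k
        proof (induction k)
          case 0
          thus ?case using vw0 s mbd_mono[of s w0 "max (C * r) s"] by auto
        next
          case (Suc k)
          define t where "t = max (C * r) (\<theta> ^ k * s)"
          obtain v w where vw: "v \<in> B'" "w \<in> Zs" "\<zeta> = v + scal (X d - Cc \<nu>) w" "mbd t w"
            using Suc unfolding t_def by blast
          have e0: "?l = (X d - Cc \<nu>) + Cc (\<nu> - \<kappa>)" by (simp add: Cc_diff)
          have e: "v + scal ?l w = \<zeta> + scal (Cc (\<nu> - \<kappa>)) w"
            unfolding vw(3) e0 scal_simps(3) by (simp only: add.assoc)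
          have "mbd (av (\<nu> - \<kappa>) * t) (scal (Cc (\<nu> - \<kappa>)) w)"
            by (rule mbd_scal[OF bd_Cc[OF order_refl] vw(4)])
          hence "mbd (max r (av (\<nu> - \<kappa>) * t)) (v + scal ?l w)" unfolding e
            using \<zeta>(2) by (intro mbd_add) (auto elim: mbd_mono)
          from C(2)[OF vw(2,1) this]
          obtain v' where v': "v' \<in> B'" "mbd (C * max r (av (\<nu> - \<kappa>) * t)) (w - v')" by blast
          have "C * max r (av (\<nu> - \<kappa>) * t) = max (C * r) (\<theta> * t)"
            using C(1) by (simp add: max_mult_distrib_left \<theta>_def mult.assoc)
          also have "\<dots> \<le> max (C * r) (\<theta> ^ Suc k * s)"
          proof -
            have "\<theta> * (C * r) \<le> C * r" using \<theta> C(1) r by (intro mult_left_le_one_le) auto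
            thus ?thesis using \<theta> by (auto simp: t_def max_mult_distrib_left mult.assoc)
          qed
          finally have "mbd (max (C * r) (\<theta> ^ Suc k * s)) (w - v')" using v'(2) mbd_mono by blast
          thus ?case
            using shift[OF vw(1) v'(1), of \<nu> w] submodD(6)[OF Zs vw(2)] v'(1) B'Z unfolding vw(3) by blast
        qed
        have "C * r > 0" using C(1) r by simp
        then obtain k where "\<theta> ^ k * s < C * r" using geom_small[OF \<theta>] by blast
        hence "max (C * r) (\<theta> ^ k * s) = C * r" by simp
        thus ?thesis using it[of k] by simp
      qed
    next
      show "C * av (\<kappa> - \<nu>) < 1" using \<theta>(2) by (simp add: \<theta>_def av_diff_commute)
    qed (use C(1) in simp)
  qed
  hence "\<forall>\<nu>. \<nu> \<noteq> \<kappa> \<longrightarrow> av (\<nu> - \<kappa>) < inverse C \<longrightarrow> fibre_zero d Zs B \<nu> = fibre_zero d Zs B' \<kappa>"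
    using eq by blast
  moreover have "inverse C > 0" using C(1) by simp
  ultimately show ?thesis by blast
qed

end

section \<open>Torsion at integers and compactness of the p-adic integers\<close>

context padic
begin

text \<open>\<open>U\<close> collects everything that a finite product of factors z - n sends into
  \<open>P\<close>. It is finitely generated, so a single finite set \<open>JJ\<close> serves for
  all of it, and for n outside \<open>JJ\<close> the product is invertible modulo z - n.\<close>

lemma finite_zero_divisors:
  assumes P: "submod (Suc d) a b P"
  shows "finite {n::int. \<exists>w\<in>Mat (Suc d) a b. w \<notin> P \<and> scal (X d - Cc (of_int n)) w \<in> P}"
proof -
  let ?l = "\<lambda>n::int. X d - Cc (of_int n :: 'k)"
  let ?p = "\<lambda>J. \<Prod>n\<in>J. ?l n"
  define U where "U = {w \<in> Mat (Suc d) a b. \<exists>J. finite J \<and> scal (?p J) w \<in> P}"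
  have pT: "?p J \<in> T (Suc d)" for J by (intro T_prod lin_T)
  have up: "scal (?p J') w \<in> P" if "scal (?p J) w \<in> P" "J \<subseteq> J'" "finite J'" for J J' w
  proof -
    have "scal (?p J') w = scal (?p (J' - J)) (scal (?p J) w)"
      unfolding scal_scal using prod.subset_diff[OF that(2,3), of ?l] by simp
    thus ?thesis using submodD(4)[OF P pT that(1)] by simp
  qed
  have UI: "w \<in> U" if "w \<in> Mat (Suc d) a b" "finite J" "scal (?p J) w \<in> P" for w J
    using that unfolding U_def by (intro CollectI conjI exI[of _ J])
  have U: "submod (Suc d) a b U"
    unfolding submod_def
  proof (intro conjI ballI)
    show "U \<subseteq> Mat (Suc d) a b" by (auto simp: U_def)
    show "0 \<in> U" using submodD(2)[OF P] submodD(2)[OF submod_Mat]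
      by (auto simp: U_def scal_simps intro!: exI[of _ "{}"])
    fix u assume u: "u \<in> U"
    then obtain J where J: "finite J" "scal (?p J) u \<in> P" by (auto simp: U_def)
    show "u + v \<in> U" if v: "v \<in> U" for v
    proof -
      obtain J' where J': "finite J'" "scal (?p J') v \<in> P" using v by (auto simp: U_def)
      have "scal (?p (J \<union> J')) (u + v) \<in> P"
        unfolding scal_simps by (rule submodD(3)[OF P up[OF J(2)] up[OF J'(2)]]) (use J(1) J'(1) in auto)
      moreover have "u + v \<in> Mat (Suc d) a b" using u v submodD(3)[OF submod_Mat] by (auto simp: U_def)
      ultimately show ?thesis using J(1) J'(1) UI[of "u + v" "J \<union> J'"] by simp
    qed
    show "scal c u \<in> U" if c: "c \<in> T (Suc d)" for c
    proof -
      have "scal (?p J) (scal c u) \<in> P" unfolding scal_comm[of _ c] using submodD(4)[OF P c J(2)] .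
      moreover have "scal c u \<in> Mat (Suc d) a b" using submodD(4)[OF submod_Mat c] u by (auto simp: U_def)
      ultimately show ?thesis using J(1) by (intro UI)
    qed
  qed
  obtain m and g where g: "\<And>k. k < m \<Longrightarrow> g k \<in> U"
    "\<And>v r. v \<in> U \<Longrightarrow> mbd r v \<Longrightarrow> \<exists>h. (\<forall>k<m. h k \<in> T (Suc d) \<and> bd r (h k)) \<and> v = lin_comb m h g"
    using strict_generators[OF U] by metis
  have "\<exists>J. k < m \<longrightarrow> finite J \<and> scal (?p J) (g k) \<in> P" for k using g(1)[of k] by (auto simp: U_def)
  then obtain J where J: "\<And>k. k < m \<Longrightarrow> finite (J k) \<and> scal (?p (J k)) (g k) \<in> P" by metis
  define JJ where "JJ = (\<Union>k<m. J k)"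
  have fJ: "finite JJ" using J by (auto simp: JJ_def)
  have JP: "scal (?p JJ) w \<in> P" if w: "w \<in> U" for w
  proof -
    obtain r where "mbd r w" using Mat_bdd[OF submodD(1)[OF U w]] by blast
    then obtain h where h: "\<forall>k<m. h k \<in> T (Suc d) \<and> bd r (h k)" "w = lin_comb m h g" using g(2) w by blast
    have "scal (?p JJ) (g k) \<in> P" if "k < m" for k
    proof (rule up)
      show "scal (?p (J k)) (g k) \<in> P" using J[OF that] ..
      show "J k \<subseteq> JJ" using that by (auto simp: JJ_def)
    qed (rule fJ)
    thus ?thesis unfolding h(2) scal_lin_comb using h(1) by (intro submod_lin_comb[OF P]) auto
  qed
  have "n \<in> JJ" if w: "w \<in> Mat (Suc d) a b" "w \<notin> P" "scal (?l n) w \<in> P" for n w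
  proof (rule ccontr)
    assume n: "n \<notin> JJ"
    have "w \<in> U" using w by (intro UI[of w "{n}"]) simp_all
    hence 1: "scal (?p JJ) w \<in> P" by (rule JP)
    \<comment> \<open>The value at z = n of the product over \<open>JJ\<close>. Both that product
      and z - n send \<open>w\<close> into \<open>P\<close>, hence so does this nonzero
      constant.\<close>
    define c where "c = (\<Prod>m\<in>JJ. of_int n - of_int m :: 'k)"
    have c0: "c \<noteq> 0" using n fJ by (auto simp: c_def)
    have "cong_lin d (of_int n) (?p JJ) (\<Prod>m\<in>JJ. Cc (of_int n - of_int m))"
      by (intro cong_lin_prod cong_lin_X_diff lin_T T_Cc)
    then obtain W where W: "W \<in> T (Suc d)" "?p JJ - Cc c = ?l n * W" by (auto simp: cong_lin_def c_def Cc_prod)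
    have "Cc c = ?p JJ - W * ?l n" using W(2) by (simp add: algebra_simps)
    hence "scal (Cc c) w = scal (?p JJ) w - scal W (scal (?l n) w)"
      unfolding scal_scal by (simp only: scal_simps(4)[of "?p JJ" "W * ?l n"])
    hence "scal (Cc c) w \<in> P" using submodD(6)[OF P 1 submodD(4)[OF P W(1) w(3)]] by simp
    hence "scal (Cc (inverse c)) (scal (Cc c) w) \<in> P" using submodD(4)[OF P T_Cc] by blast
    thus False using w(2) by (simp add: scal_scal Cc_inverse[OF c0] scal_simps)
  qed
  thus ?thesis using fJ by (auto elim!: rev_finite_subset)
qed

definition resid :: "int \<Rightarrow> nat \<Rightarrow> int set" where "resid a r = {a + int p ^ r * m | m. True}"

lemma resid_iff: "n \<in> resid a r \<longleftrightarrow> int p ^ r dvd n - a"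
  by (auto simp: resid_def dvd_def algebra_simps)

lemma resid_finer: "b \<in> resid a r \<Longrightarrow> r \<le> R \<Longrightarrow> resid b R \<subseteq> resid a r"
proof
  fix n assume b: "b \<in> resid a r" "r \<le> R" and n: "n \<in> resid b R"
  have "int p ^ r dvd n - b" using n b(2) le_imp_power_dvd dvd_trans unfolding resid_iff by blast
  hence "int p ^ r dvd (n - b) + (b - a)" using b(1) dvd_add unfolding resid_iff by blast
  thus "n \<in> resid a r" by (simp add: resid_iff)
qed

text \<open>Compactness of the \<open>p\<close>-adic integers: if no modulus works, nested bad residue classes
  converge to a point of the field at which \<open>S\<close> is not locally constant.\<close>
lemma locally_constant_imp_progressions:
  assumes loc: "\<And>\<kappa>. \<exists>\<epsilon>>0. \<exists>c. \<forall>n::int. of_int n \<noteq> \<kappa> \<longrightarrow> av (of_int n - \<kappa>) < \<epsilon> \<longrightarrow> (n \<in> S) = c"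
  shows "\<exists>r. \<exists>B. finite B \<and> finite ((S - (\<Union>a\<in>B. resid a r)) \<union> ((\<Union>a\<in>B. resid a r) - S))"
proof -
  have p0: "0 < p" using prime_gt_0_nat[OF prime_p] .
  define bad where "bad a r \<longleftrightarrow> infinite (S \<inter> resid a r) \<and> infinite (resid a r - S)" for a r
  have bad_mono: "bad b r" if "bad b R" "r \<le> R" for b r R
  proof -
    have "resid b R \<subseteq> resid b r" using resid_finer[of b b r R] that(2) by (simp add: resid_iff)
    hence "S \<inter> resid b R \<subseteq> S \<inter> resid b r" "resid b R - S \<subseteq> resid b r - S" by auto
    thus ?thesis using that(1) finite_subset unfolding bad_def by blast
  qed
  \<comment> \<open>Being bad for one modulus need not pass to a subclass. Containing bad classes of
    every finer modulus does, by the pigeonhole argument of \<open>child\<close>, and permits a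
    nested sequence.\<close>
  define rbad where "rbad a r \<longleftrightarrow> (\<forall>R\<ge>r. \<exists>b\<in>resid a r. bad b R)" for a r
  have child: "\<exists>a'. rbad a' (Suc r) \<and> a' \<in> resid a r" if rb: "rbad a r" for a r
  proof (rule ccontr)
    assume no: "\<not> (\<exists>a'. rbad a' (Suc r) \<and> a' \<in> resid a r)"
    have cin: "a + int p ^ r * int j \<in> resid a r" for j by (simp add: resid_iff)
    have "\<forall>j. \<exists>R\<ge>Suc r. \<forall>b\<in>resid (a + int p ^ r * int j) (Suc r). \<not> bad b R"
      using no cin unfolding rbad_def by blast
    then obtain Rf where Rf: "\<And>j. Suc r \<le> Rf j" "\<And>j b. b \<in> resid (a + int p ^ r * int j) (Suc r) \<Longrightarrow> \<not> bad b (Rf j)"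
      by metis
    \<comment> \<open>If all p subclasses were free of bad classes at some level,
      \<open>bad_mono\<close> would make the largest of these levels work for the whole
      class.\<close>
    define R where "R = Max (Rf ` {..<p})"
    have R: "Rf j \<le> R" if "j < p" for j unfolding R_def using that by (intro Max_ge) auto
    have "r \<le> R" using R[OF p0] Rf(1)[of 0] by simp
    then obtain b where b: "b \<in> resid a r" "bad b R" using rb unfolding rbad_def by blast
    obtain m where m: "b = a + int p ^ r * m" using b(1) by (auto simp: resid_def)
    \<comment> \<open>The next p-adic digit of \<open>b\<close>, which names the subclass containing
      it.\<close>
    define j where "j = nat (m mod int p)"
    have j: "j < p" "int j = m mod int p" using p0 by (auto simp: j_def nat_less_iff)
    have "b - (a + int p ^ r * int j) = int p ^ r * (m - m mod int p)" unfolding m j(2) by (simp add: algebra_simps)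
    also have "\<dots> = int p ^ Suc r * (m div int p)" by (simp add: minus_mod_eq_mult_div)
    finally have "b \<in> resid (a + int p ^ r * int j) (Suc r)" unfolding resid_iff by (metis dvd_triv_left)
    hence "\<not> bad b (Rf j)" by (rule Rf(2))
    thus False using bad_mono[OF b(2) R[OF j(1)]] by blast
  qed
  have "\<not> rbad 0 0"
  proof
    assume "rbad 0 0"
    hence "\<exists>f. \<forall>n. rbad (f n) n \<and> f (Suc n) \<in> resid (f n) n"
      using dependent_nat_choice[of "\<lambda>n a. rbad a n" "\<lambda>n a a'. a' \<in> resid a n"] child by blast
    then obtain f where f: "\<And>n. rbad (f n) n" "\<And>n. f (Suc n) \<in> resid (f n) n" by blast
    define \<theta> where "\<theta> = 1 / real p"
    have \<theta>: "0 \<le> \<theta>" "\<theta> < 1" using p_gt1 by (auto simp: \<theta>_def)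
    have "av (of_int (f (Suc k) - f k)) \<le> \<theta> ^ k" for k
      unfolding \<theta>_def using f(2)[of k] by (intro av_dvd) (simp add: resid_iff)
    hence b: "bd (\<theta> ^ k * 1) (Cc (of_int (f (Suc k) - f k)))" for k by (simp add: bd_Cc)
    \<comment> \<open>The p-adic limit of the centres is built as a telescoping series of constants
      in \<open>T 0\<close> and read off as a constant term.\<close>
    obtain s where s: "\<And>k. bd (\<theta> ^ k * 1) (s - (\<Sum>i<k. Cc (of_int (f (Suc i) - f i))))"
      using T_series[OF \<theta> T_Cc[where D = 0] b] by metis
    define \<kappa> where "\<kappa> = of_int (f 0) + cf s (\<lambda>_. 0)"
    have tel: "(\<Sum>i<k. of_int (f (Suc i) - f i)) = (of_int (f k) - of_int (f 0) :: 'k)" for k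
      by (induction k) auto
    have lim: "av (of_int (f k) - \<kappa>) \<le> \<theta> ^ k" for k
    proof -
      have "cf (\<Sum>i<k. Cc (of_int (f (Suc i) - f i))) (\<lambda>_. 0) = (of_int (f k) - of_int (f 0) :: 'k)"
        unfolding tel[symmetric] by (simp only: cf_sum cf_Cc if_True refl)
      hence "cf (s - (\<Sum>i<k. Cc (of_int (f (Suc i) - f i)))) (\<lambda>_. 0) = \<kappa> - of_int (f k)"
        by (simp only: cf_diff) (simp add: \<kappa>_def)
      thus ?thesis using bdD[OF s[of k], of "\<lambda>_. 0"] by (subst av_diff_commute) simp
    qed
    obtain \<epsilon> c where \<epsilon>: "\<epsilon> > 0" "\<And>n::int. of_int n \<noteq> \<kappa> \<Longrightarrow> av (of_int n - \<kappa>) < \<epsilon> \<Longrightarrow> (n \<in> S) = c"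
      using loc[of \<kappa>] by blast
    obtain k where k: "\<theta> ^ k * 1 < \<epsilon>" using geom_small[OF \<theta> \<epsilon>(1)] by blast
    obtain b where b: "b \<in> resid (f k) k" "bad b k" using f(1)[of k] unfolding rbad_def by blast
    have near: "av (of_int n - \<kappa>) < \<epsilon>" if "n \<in> resid b k" for n
    proof -
      have "n \<in> resid (f k) k" using resid_finer[OF b(1) order_refl] that by blast
      hence "av (of_int (n - f k)) \<le> \<theta> ^ k" unfolding \<theta>_def by (intro av_dvd) (simp add: resid_iff)
      hence "av (of_int (n - f k) + (of_int (f k) - \<kappa>)) \<le> \<theta> ^ k" using lim by (rule av_add_le)
      thus ?thesis using k by simp
    qed
    \<comment> \<open>The limit may itself be an integer, at which nothing is known; injectivity
      makes this a single point, and badness asks for infinitely many on each side.\<close>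
    have fin: "finite {n::int. of_int n = \<kappa>}"
    proof (cases "\<exists>n::int. of_int n = \<kappa>")
      case True
      then obtain n0 :: int where n0: "of_int n0 = \<kappa>" by blast
      have "{n::int. of_int n = \<kappa>} \<subseteq> {n0}" unfolding n0[symmetric] by auto
      thus ?thesis using finite_subset by blast
    qed simp
    have "resid b k - S \<subseteq> {n. of_int n = \<kappa>}" if c using \<epsilon>(2) near that by blast
    moreover have "S \<inter> resid b k \<subseteq> {n. of_int n = \<kappa>}" if "\<not> c" using \<epsilon>(2) near that by blast
    ultimately show False using b(2) fin finite_subset unfolding bad_def by blast
  qed
  then obtain R where "\<forall>b\<in>resid 0 0. \<not> bad b R" unfolding rbad_def by blast
  hence R: "\<not> bad b R" for b by (simp add: resid_iff)
  \<comment> \<open>Modulo p^R no class is bad, so \<open>S\<close> is finite or cofinite in each;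
    the cofinite classes are the progressions.\<close>
  define B where "B = {a \<in> {0..<int p ^ R}. finite (resid a R - S)}"
  define E where "E = (\<Union>a\<in>B. resid a R - S) \<union> (\<Union>a\<in>{0..<int p ^ R} - B. S \<inter> resid a R)"
  have fB: "finite B" unfolding B_def by (rule finite_subset[of _ "{0..<int p ^ R}"]) auto
  have "finite E" 
    unfolding E_def using fB R by (intro finite_UnI finite_UN_I) (auto simp: B_def bad_def)
  moreover have "S - (\<Union>a\<in>B. resid a R) \<subseteq> E"
  proof
    fix n assume n: "n \<in> S - (\<Union>a\<in>B. resid a R)"
    let ?a = "n mod int p ^ R"
    have "n \<in> resid ?a R" by (simp add: resid_iff minus_mod_eq_mult_div)
    moreover have "?a \<in> {0..<int p ^ R}" using p0 by simp
    ultimately show "n \<in> E" using n unfolding E_def by blast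
  qed
  moreover have "(\<Union>a\<in>B. resid a R) - S \<subseteq> E" by (auto simp: E_def)
  ultimately show ?thesis using fB finite_subset[of _ E] by (intro exI[of _ R] exI[of _ B]) auto
qed

end

section \<open>Homology of the interpolated complex\<close>

definition mat_mul :: "nat \<Rightarrow> 'k::field pmat \<Rightarrow> 'k pmat \<Rightarrow> 'k pmat" where
  "mat_mul n A B = (\<lambda>l j. \<Sum>t<n. A l t * B t j)"

lemma mat_mul_assoc: "mat_mul b (mat_mul a A B) C = mat_mul a A (mat_mul b B C)"
proof (intro ext)
  fix l j
  have "mat_mul b (mat_mul a A B) C l j = (\<Sum>t<b. \<Sum>s<a. A l s * B s t * C t j)"
    by (simp add: mat_mul_def sum_distrib_right)
  also have "\<dots> = (\<Sum>s<a. \<Sum>t<b. A l s * B s t * C t j)" by (rule sum.swap)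
  also have "\<dots> = mat_mul a A (mat_mul b B C) l j" by (simp add: mat_mul_def sum_distrib_left mult.assoc)
  finally show "mat_mul b (mat_mul a A B) C l j = mat_mul a A (mat_mul b B C) l j" .
qed
lemma mat_mul_add_right: "mat_mul n A (B + C) = mat_mul n A B + mat_mul n A C"
  by (intro ext) (simp add: mat_mul_def algebra_simps sum.distrib)
lemma mat_mul_diff_right: "mat_mul n A (B - C) = mat_mul n A B - mat_mul n A C"
  by (intro ext) (simp add: mat_mul_def algebra_simps sum_subtractf)
lemma mat_mul_add_left: "mat_mul n (A + B) C = mat_mul n A C + mat_mul n B C"
  by (intro ext) (simp add: mat_mul_def algebra_simps sum.distrib)
lemma mat_mul_diff_left: "mat_mul n (A - B) C = mat_mul n A C - mat_mul n B C"
  by (intro ext) (simp add: mat_mul_def algebra_simps sum_subtractf)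
lemma mat_mul_zero_right [simp]: "mat_mul n A 0 = 0" by (intro ext) (simp add: mat_mul_def)
lemma mat_mul_zero_left [simp]: "mat_mul n 0 A = 0" by (intro ext) (simp add: mat_mul_def)
lemma mat_mul_scal_right: "mat_mul n A (scal c B) = scal c (mat_mul n A B)"
  by (intro ext) (simp add: mat_mul_def scal_def sum_distrib_left mult_ac)

context nonarch
begin

definition Vec :: "nat \<Rightarrow> nat \<Rightarrow> (nat \<Rightarrow> 'k ps) set" where
  "Vec D f = {v. (\<forall>j<f. v j \<in> T D) \<and> (\<forall>j\<ge>f. v j = 0)}"

text \<open>The submodule generated by \<open>Q\<close>, built one term at a time so that facts
  about the span follow by rule induction.\<close>

inductive_set row_span :: "nat \<Rightarrow> (nat \<Rightarrow> 'k ps) set \<Rightarrow> (nat \<Rightarrow> 'k ps) set" for D Q where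
  row_span_0: "(\<lambda>_. 0) \<in> row_span D Q"
| row_span_step: "v \<in> row_span D Q \<Longrightarrow> c \<in> T D \<Longrightarrow> r \<in> Q \<Longrightarrow> (\<lambda>t. v t + c * r t) \<in> row_span D Q"

lemma Vec_T: "v \<in> Vec D f \<Longrightarrow> v j \<in> T D" by (cases "j < f") (auto simp: Vec_def)
lemma row_span_Vec: "v \<in> row_span D Q \<Longrightarrow> Q \<subseteq> Vec D f \<Longrightarrow> v \<in> Vec D f"
proof (induction rule: row_span.induct)
  case (row_span_step v c r)
  thus ?case by (auto simp: Vec_def intro!: T_add T_mult)
qed (simp add: Vec_def)

lemma row_span_add:
  assumes v: "v \<in> row_span D Q" and w: "w \<in> row_span D Q" shows "(\<lambda>t. v t + w t) \<in> row_span D Q"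
  using w
proof (induction rule: row_span.induct)
  case (row_span_step w c r)
  have "(\<lambda>t. (v t + w t) + c * r t) \<in> row_span D Q" using row_span_step by (intro row_span.row_span_step) auto
  thus ?case by (simp add: add.assoc)
qed (use v in simp)

lemma row_span_mult: "v \<in> row_span D Q \<Longrightarrow> a \<in> T D \<Longrightarrow> (\<lambda>t. a * v t) \<in> row_span D Q"
proof (induction v rule: row_span.induct)
  case (row_span_step v c r)
  have "(\<lambda>t. a * v t + (a * c) * r t) \<in> row_span D Q" using row_span_step by (intro row_span.row_span_step T_mult) auto
  thus ?case by (simp add: algebra_simps)
qed (simp add: row_span_0)

lemma row_span_sum: "(\<And>s. s < (n::nat) \<Longrightarrow> a s \<in> T D \<and> v s \<in> row_span D Q) \<Longrightarrow> (\<lambda>t. \<Sum>s<n. a s * v s t) \<in> row_span D Q"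
  by (induction n) (auto intro!: row_span_0 row_span_add row_span_mult)

lemma row_span_mono: "D \<le> D' \<Longrightarrow> row_span D Q \<subseteq> row_span D' Q"
proof
  fix v assume "D \<le> D'" "v \<in> row_span D Q"
  from this(2,1) show "v \<in> row_span D' Q"
    by (induction rule: row_span.induct) (use T_mono in \<open>blast intro: row_span.intros\<close>)+
qed

text \<open>The lifts of zero in N^k for N = S^f / row_span Q: each row represents one
  coordinate.\<close>

definition row_sub :: "nat \<Rightarrow> nat \<Rightarrow> nat \<Rightarrow> (nat \<Rightarrow> 'k ps) set \<Rightarrow> 'k pmat set" where
  "row_sub D k f Q = {u \<in> Mat D k f. \<forall>l<k. u l \<in> row_span D Q}"

lemma Mat_mono: "D \<le> D' \<Longrightarrow> Mat D a b \<subseteq> Mat D' a b"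
  using T_mono[of D D'] by (fastforce simp: Mat_def)
lemma row_sub_mono: "D \<le> D' \<Longrightarrow> row_sub D k f Q \<subseteq> row_sub D' k f Q"
  using Mat_mono row_span_mono by (fastforce simp: row_sub_def)

lemma mat_mul_Mat: "A \<in> Mat D a n \<Longrightarrow> B \<in> Mat D n b \<Longrightarrow> mat_mul n A B \<in> Mat D a b"
proof (rule MatI)
  assume A: "A \<in> Mat D a n" and B: "B \<in> Mat D n b"
  fix l j
  show "mat_mul n A B l j \<in> T D" unfolding mat_mul_def using Mat_T[OF A] Mat_T[OF B] by (intro T_sum T_mult)
  assume "\<not> (l < a \<and> j < b)"
  hence "A l t * B t j = 0" if "t < n" for t
    using Mat_out[OF A, of l t] Mat_out[OF B, of t j] by auto
  thus "mat_mul n A B l j = 0" by (simp add: mat_mul_def)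
qed

lemma row_sub_submod: "submod D k f (row_sub D k f Q)"
  unfolding submod_def
proof (intro conjI ballI)
  show "row_sub D k f Q \<subseteq> Mat D k f" by (auto simp: row_sub_def)
  show "0 \<in> row_sub D k f Q" using submodD(2)[OF submod_Mat] row_span_0 by (auto simp: row_sub_def zero_fun_def)
  fix u assume u: "u \<in> row_sub D k f Q"
  show "u + v \<in> row_sub D k f Q" if "v \<in> row_sub D k f Q" for v
    using u that submodD(3)[OF submod_Mat, of u D k f v] row_span_add[of "u _" D Q "v _"]
    by (auto simp: row_sub_def plus_fun_def)
  show "scal c u \<in> row_sub D k f Q" if "c \<in> T D" for c
    using u that submodD(4)[OF submod_Mat that, of u k f] row_span_mult[OF _ that, of "u _" Q]
    by (auto simp: row_sub_def scal_def)
qed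

lemma mat_mul_row_sub:
  assumes A: "A \<in> Mat D a k" and u: "u \<in> row_sub D k f Q" shows "mat_mul k A u \<in> row_sub D a f Q"
proof -
  have "mat_mul k A u l \<in> row_span D Q" for l
    unfolding mat_mul_def using Mat_T[OF A] u by (intro row_span_sum) (auto simp: row_sub_def)
  thus ?thesis using mat_mul_Mat[OF A, of u f] u by (simp add: row_sub_def)
qed

lemma submod_boundaries:
  assumes E: "E \<in> Mat D a b"
  shows "submod D a f {u \<in> Mat D a f. \<exists>w\<in>Mat D b f. u - mat_mul b E w \<in> row_sub D a f Q}" (is "submod D a f ?B")
  unfolding submod_def
proof (intro conjI ballI)
  note M = submodD[OF submod_Mat] and R = submodD[OF row_sub_submod]
  have BI: "u \<in> ?B" if "u \<in> Mat D a f" "w \<in> Mat D b f" "u - mat_mul b E w \<in> row_sub D a f Q" for u w using that by blast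
  show "?B \<subseteq> Mat D a f" by blast
  show "0 \<in> ?B" using M(2) R(2) by (intro BI[of 0 0]) simp_all
  fix u assume u: "u \<in> ?B"
  then obtain w where w: "w \<in> Mat D b f" "u - mat_mul b E w \<in> row_sub D a f Q" by blast
  show "u + u' \<in> ?B" if u': "u' \<in> ?B" for u'
  proof -
    obtain w' where w': "w' \<in> Mat D b f" "u' - mat_mul b E w' \<in> row_sub D a f Q" using u' by blast
    have "u + u' - mat_mul b E (w + w') = (u - mat_mul b E w) + (u' - mat_mul b E w')" by (simp add: mat_mul_add_right)
    hence "u + u' - mat_mul b E (w + w') \<in> row_sub D a f Q" using R(3)[OF w(2) w'(2)] by (simp only:)
    thus ?thesis using u u' M(3) w(1) w'(1) by (intro BI[of _ "w + w'"]) auto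
  qed
  show "scal c u \<in> ?B" if c: "c \<in> T D" for c
  proof -
    have "scal c u - mat_mul b E (scal c w) = scal c (u - mat_mul b E w)" by (simp add: mat_mul_scal_right scal_simps)
    hence "scal c u - mat_mul b E (scal c w) \<in> row_sub D a f Q" using R(4)[OF c w(2)] by (simp only:)
    thus ?thesis using u M(4)[OF c] w(1) by (intro BI[of _ "scal c w"]) auto
  qed
qed

lemma submod_cycles:
  assumes E: "E \<in> Mat D b a"
  shows "submod D a f {u \<in> Mat D a f. mat_mul a E u \<in> row_sub D b f Q}"
  unfolding submod_def
  using submodD[OF submod_Mat[of D a f]] submodD[OF row_sub_submod[of D b f Q]]
  by (auto simp: mat_mul_add_right mat_mul_scal_right)

lemma cong_lin_imp_scal:
  assumes M: "M \<in> Mat (Suc d) a b" and N: "N \<in> Mat (Suc d) a b" and c: "\<And>l j. cong_lin d \<nu> (M l j) (N l j)"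
  shows "\<exists>W\<in>Mat (Suc d) a b. M - N = scal (X d - Cc \<nu>) W"
proof -
  obtain W where W: "\<And>l j. W l j \<in> T (Suc d)" "\<And>l j. M l j - N l j = (X d - Cc \<nu>) * W l j"
    using c unfolding cong_lin_def by metis
  define V where "V = (\<lambda>l j. if l < a \<and> j < b then W l j else 0)"
  have "V \<in> Mat (Suc d) a b" using W(1) by (simp add: V_def Mat_def)
  moreover have "M - N = scal (X d - Cc \<nu>) V"
  proof (intro ext)
    fix l j
    show "(M - N) l j = scal (X d - Cc \<nu>) V l j"
      using W(2)[of l j] Mat_out[OF M, of l j] Mat_out[OF N, of l j]
      by (cases "l < a \<and> j < b") (simp_all add: scal_def V_def)
  qed
  ultimately show ?thesis by blast
qed

lemma scal_imp_cong_lin: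
  assumes "M - N = scal (X d - Cc \<nu>) W" "W \<in> Mat (Suc d) a b"
  shows "cong_lin d \<nu> (M l j) (N l j)"
  unfolding cong_lin_def using fun_cong[OF fun_cong[OF assms(1)], of l j] Mat_T[OF assms(2)]
  by (auto simp: scal_def intro!: bexI[of _ "W l j"])

lemma cong_lin_mat_mul:
  assumes "\<And>l j. cong_lin d \<nu> (A l j) (A' l j)" "\<And>l j. cong_lin d \<nu> (B l j) (B' l j)"
    "A \<in> Mat (Suc d) a n" "B' \<in> Mat (Suc d) n b"
  shows "cong_lin d \<nu> (mat_mul n A B l j) (mat_mul n A' B' l j)"
  unfolding mat_mul_def using assms Mat_T by (intro cong_lin_sum cong_lin_mult) blast+

lemma Mat_cong_lin_eq:
  assumes "av \<nu> \<le> 1" "M \<in> Mat d a b" "N \<in> Mat d a b" "\<And>l j. cong_lin d \<nu> (M l j) (N l j)"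
  shows "M = N"
  using cong_lin_const_eq[OF assms(1) assms(4)] Mat_T[OF assms(2)] Mat_T[OF assms(3)] by (intro ext) blast

lemma Mat_ex_cong_lin:
  assumes "av \<nu> \<le> 1" "M \<in> Mat (Suc d) a b"
  shows "\<exists>N\<in>Mat d a b. \<forall>l j. cong_lin d \<nu> (M l j) (N l j)"
proof -
  obtain N where N: "\<And>l j. N l j \<in> T d" "\<And>l j. cong_lin d \<nu> (M l j) (N l j)"
    using ex_cong_lin[OF assms(1) Mat_T[OF assms(2)]] by metis
  define V where "V = (\<lambda>l j. if l < a \<and> j < b then N l j else 0)"
  have "V \<in> Mat d a b" using N(1) by (simp add: V_def Mat_def)
  moreover have "cong_lin d \<nu> (M l j) (V l j)" for l j
    using N(2)[of l j] Mat_out[OF assms(2), of l j] by (cases "l < a \<and> j < b") (auto simp: V_def)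
  ultimately show ?thesis by blast
qed

text \<open>The relations \<open>Q\<close> do not involve z, so evaluation at n affects only the
  coefficients.\<close>

lemma row_span_ex_cong_lin:
  assumes \<nu>: "av \<nu> \<le> 1" and Q: "Q \<subseteq> Vec d f" and v: "v \<in> row_span (Suc d) Q"
  shows "\<exists>w\<in>row_span d Q. \<forall>t. cong_lin d \<nu> (v t) (w t)"
  using v
proof (induction rule: row_span.induct)
  case row_span_0
  show ?case by (intro bexI[of _ "\<lambda>_. 0"]) (auto intro: row_span.row_span_0)
next
  case (row_span_step v c r)
  then obtain w where w: "w \<in> row_span d Q" "\<forall>t. cong_lin d \<nu> (v t) (w t)" by blast
  obtain c' where c': "c' \<in> T d" "cong_lin d \<nu> c c'" using ex_cong_lin[OF \<nu> row_span_step(2)] by blast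
  have "r t \<in> T (Suc d)" for t using Vec_T[OF subsetD[OF Q row_span_step(3)], of t] T_mono[of d "Suc d"] by auto
  hence "cong_lin d \<nu> (v t + c * r t) (w t + c' * r t)" for t
    using w(2) c'(2) row_span_step(2) by (intro cong_lin_add cong_lin_mult cong_lin_refl) auto
  thus ?case using row_span.row_span_step[OF w(1) c'(1) row_span_step(3)] by (intro bexI[of _ "\<lambda>t. w t + c' * r t"]) auto
qed

lemma row_sub_ex_cong_lin:
  assumes \<nu>: "av \<nu> \<le> 1" and Q: "Q \<subseteq> Vec d f" and u: "u \<in> row_sub (Suc d) k f Q"
  shows "\<exists>w\<in>row_sub d k f Q. \<forall>l j. cong_lin d \<nu> (u l j) (w l j)"
proof -
  have "\<exists>w. l < k \<longrightarrow> w \<in> row_span d Q \<and> (\<forall>t. cong_lin d \<nu> (u l t) (w t))" for l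
    using row_span_ex_cong_lin[OF \<nu> Q, of "u l"] u by (auto simp: row_sub_def)
  then obtain w where w: "\<And>l. l < k \<Longrightarrow> w l \<in> row_span d Q \<and> (\<forall>t. cong_lin d \<nu> (u l t) (w l t))" by metis
  define V where "V = (\<lambda>l. if l < k then w l else (\<lambda>_. 0))"
  have wV: "w l \<in> Vec d f" if "l < k" for l using row_span_Vec[OF _ Q] w[OF that] by blast
  have "V \<in> Mat d k f" using wV by (auto simp: Mat_def V_def Vec_def)
  hence "V \<in> row_sub d k f Q" using w by (simp add: row_sub_def V_def)
  moreover have "cong_lin d \<nu> (u l j) (V l j)" for l j
  proof (cases "l < k")
    case False
    have "u \<in> Mat (Suc d) k f" using u by (simp add: row_sub_def)
    hence "u l j = 0" using Mat_out False by blast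
    thus ?thesis using False by (simp add: V_def)
  qed (use w in \<open>simp add: V_def\<close>)
  ultimately show ?thesis by blast
qed

text \<open>Homology at the middle of \<open>N^k2 \<rightarrow> N^k1 \<rightarrow> N^k0\<close> with \<open>N = S^f / row_span Q\<close>.\<close>
definition hom_nz :: "nat \<Rightarrow> nat \<Rightarrow> (nat \<Rightarrow> 'k ps) set \<Rightarrow> nat \<Rightarrow> nat \<Rightarrow> nat \<Rightarrow> 'k pmat \<Rightarrow> 'k pmat \<Rightarrow> bool" where
  "hom_nz d f Q k0 k1 k2 A0 A1 \<longleftrightarrow> (\<exists>u\<in>Mat d k1 f. mat_mul k1 A0 u \<in> row_sub d k0 f Q \<and>
     \<not> (\<exists>w\<in>Mat d k2 f. u - mat_mul k2 A1 w \<in> row_sub d k1 f Q))"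

end

section \<open>Fibres of the homology over S<z>\<close>

context padic
begin

text \<open>A nonzero \<open>F\<close> would be divisible by z(z-1)...(z-m) for every m, and its
  leading exponent in z would be unbounded. This is what makes the interpolated maps compose to
  zero.\<close>

lemma in_all_linear_ideals:
  assumes F: "F \<in> T (Suc d)" and c: "\<And>n::int. cong_lin d (of_int n) F 0"
  shows "F = 0"
proof (rule ccontr)
  let ?l = "\<lambda>n::nat. X d - Cc (of_nat n :: 'k)" and ?e = "\<lambda>j. if j = d then 1 else (0::nat)"
  assume "F \<noteq> 0"
  then obtain \<mu> where \<mu>: "is_lm lex_less (cf F) \<mu>" using T_is_lm[OF F] by blast
  have div: "\<exists>W\<in>T (Suc d). F = (\<Prod>j<m. ?l j) * W" for m
  proof (induction m)
    case 0
    thus ?case using F by auto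
  next
    case (Suc m)
    then obtain W where W: "W \<in> T (Suc d)" "F = (\<Prod>j<m. ?l j) * W" by blast
    obtain V where V: "V \<in> T (Suc d)" "F = ?l m * V" using c[of "int m"] by (auto simp: cong_lin_def)
    \<comment> \<open>The value at z = m of the factors already split off; it is nonzero, so z - m
      must divide the cofactor \<open>W\<close>.\<close>
    define a where "a = (\<Prod>j<m. of_nat m - of_nat j :: 'k)"
    have nz: "(of_nat m - of_nat j :: 'k) \<noteq> 0" if "j < m" for j
      using of_int_eq[of "int m" "int j"] that by (simp del: of_int_eq)
    have a0: "a \<noteq> 0" using nz by (auto simp: a_def)
    have "cong_lin d (of_nat m) (\<Prod>j<m. ?l j) (\<Prod>j<m. Cc (of_nat m - of_nat j))"
      by (intro cong_lin_prod cong_lin_X_diff lin_T T_Cc)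
    then obtain Y where Y: "Y \<in> T (Suc d)" "(\<Prod>j<m. ?l j) - Cc a = ?l m * Y" by (auto simp: cong_lin_def a_def Cc_prod)
    have P: "(\<Prod>j<m. ?l j) = Cc a + ?l m * Y" using Y(2) by (simp add: algebra_simps)
    have "Cc a * W = F - ?l m * Y * W" using W(2) unfolding P by (simp add: algebra_simps)
    also have "\<dots> = ?l m * (V - Y * W)" using V(2) by (simp add: algebra_simps)
    finally have "Cc (inverse a) * (Cc a * W) = ?l m * (Cc (inverse a) * (V - Y * W))" by (simp only: mult_ac)
    hence "W = ?l m * (Cc (inverse a) * (V - Y * W))" using Cc_inverse[OF a0] by (simp flip: mult.assoc)
    hence "F = (\<Prod>j<Suc m. ?l j) * (Cc (inverse a) * (V - Y * W))" using W(2) by (simp add: mult.assoc)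
    thus ?case using W(1) Y(1) V(1) by (blast intro: T_mult T_diff T_Cc)
  qed
  have lmP: "is_lm lex_less (cf (\<Prod>j<m. ?l j)) (\<lambda>j. m * ?e j)" for m
  proof (induction m)
    case 0
    show ?case by (auto simp: is_lm_def cf_1)
  next
    case (Suc m)
    have "(\<lambda>i. m * ?e i + ?e i) = (\<lambda>i. Suc m * ?e i)" by auto
    thus ?case using is_lm_mult[OF Suc is_lm_linear[OF av_of_nat[of m], of d]] by simp
  qed
  obtain W where W: "W \<in> T (Suc d)" "F = (\<Prod>j<Suc (\<mu> d). ?l j) * W" using div by blast
  have "W \<noteq> 0" using W(2) \<open>F \<noteq> 0\<close> by auto
  then obtain \<nu> where "is_lm lex_less (cf W) \<nu>" using T_is_lm[OF W(1)] by blast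
  from is_lm_mult[OF lmP[of "Suc (\<mu> d)"] this]
  have "is_lm lex_less (cf F) (\<lambda>i. Suc (\<mu> d) * ?e i + \<nu> i)" by (simp only: W(2))
  from fun_cong[OF is_lm_unique[OF \<mu> this], of d] show False by simp
qed

text \<open>Two torsion conditions suffice. None modulo \<open>B0\<close> lets a cycle at n be
  corrected to a cycle over S<z>; none modulo \<open>Zs\<close> makes w a cycle when (z - n) w is
  one. \<open>finite_zero_divisors\<close> bounds the failures of both. An exceptional n shows as
  equality of the two truth values, because nonvanishing is set against vanishing.\<close>

theorem homology_fibres:
  assumes E0: "E0 \<in> Mat (Suc d) k0 k1" and E1: "E1 \<in> Mat (Suc d) k1 k2"
    and A0: "\<And>n::int. A0 n \<in> Mat d k0 k1" and A1: "\<And>n::int. A1 n \<in> Mat d k1 k2"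
    and c0: "\<And>n l j. cong_lin d (of_int n) (E0 l j) (A0 n l j)" and c1: "\<And>n l j. cong_lin d (of_int n) (E1 l j) (A1 n l j)"
    and cplx: "\<And>n. mat_mul k1 (A0 n) (A1 n) = 0" and Q: "Q \<subseteq> Vec d f"
  shows "\<exists>Zs B. submod (Suc d) k1 f Zs \<and> submod (Suc d) k1 f B \<and> B \<subseteq> Zs \<and>
    finite {n. hom_nz d f Q k0 k1 k2 (A0 n) (A1 n) = fibre_zero d Zs B (of_int n)}"
proof -
  let ?l = "\<lambda>n::int. X d - Cc (of_int n :: 'k)"
  define Zs where "Zs = {u \<in> Mat (Suc d) k1 f. mat_mul k1 E0 u \<in> row_sub (Suc d) k0 f Q}"
  define B where "B = {u \<in> Mat (Suc d) k1 f. \<exists>w\<in>Mat (Suc d) k2 f. u - mat_mul k2 E1 w \<in> row_sub (Suc d) k1 f Q}"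
  define B0 where "B0 = {u \<in> Mat (Suc d) k0 f. \<exists>w\<in>Mat (Suc d) k1 f. u - mat_mul k1 E0 w \<in> row_sub (Suc d) k0 f Q}"
  have Zs: "submod (Suc d) k1 f Zs" unfolding Zs_def by (rule submod_cycles[OF E0])
  have B: "submod (Suc d) k1 f B" unfolding B_def by (rule submod_boundaries[OF E1])
  have B0: "submod (Suc d) k0 f B0" unfolding B0_def by (rule submod_boundaries[OF E0])
  have up: "Mat d x y \<subseteq> Mat (Suc d) x y" for x y by (rule Mat_mono) simp
  have upR: "row_sub d x f Q \<subseteq> row_sub (Suc d) x f Q" for x by (rule row_sub_mono) simp
  note M = submodD[OF submod_Mat] and R = submodD[OF row_sub_submod]
  have a1: "av (of_int n) \<le> 1" for n :: int by (rule av_of_int)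
  have EE: "mat_mul k1 E0 E1 = 0"
  proof (intro ext)
    fix l j
    have "cong_lin d (of_int n) (mat_mul k1 E0 E1 l j) (mat_mul k1 (A0 n) (A1 n) l j)" for n
      using c0 c1 E0 A1 up by (intro cong_lin_mat_mul) blast+
    hence "cong_lin d (of_int n) (mat_mul k1 E0 E1 l j) 0" for n by (simp add: cplx)
    thus "mat_mul k1 E0 E1 l j = 0 l j"
      using in_all_linear_ideals[OF Mat_T[OF mat_mul_Mat[OF E0 E1]], of l j] by simp
  qed
  have BZ: "B \<subseteq> Zs"
  proof
    fix u assume "u \<in> B"
    then obtain w where w: "u \<in> Mat (Suc d) k1 f" "w \<in> Mat (Suc d) k2 f" "u - mat_mul k2 E1 w \<in> row_sub (Suc d) k1 f Q"
      unfolding B_def by blast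
    have "mat_mul k1 E0 (u - mat_mul k2 E1 w) \<in> row_sub (Suc d) k0 f Q" using mat_mul_row_sub[OF E0 w(3)] .
    moreover have "mat_mul k1 E0 (mat_mul k2 E1 w) = 0" by (simp add: EE flip: mat_mul_assoc)
    ultimately show "u \<in> Zs" using w(1) by (simp add: Zs_def mat_mul_diff_right)
  qed
  define bad where "bad = {n::int. \<exists>w\<in>Mat (Suc d) k0 f. w \<notin> B0 \<and> scal (?l n) w \<in> B0} \<union>
     {n::int. \<exists>w\<in>Mat (Suc d) k1 f. w \<notin> Zs \<and> scal (?l n) w \<in> Zs}"
  have fin: "finite bad" unfolding bad_def by (intro finite_UnI finite_zero_divisors[OF B0] finite_zero_divisors[OF Zs])
  have main: "hom_nz d f Q k0 k1 k2 (A0 n) (A1 n) \<longleftrightarrow> \<not> fibre_zero d Zs B (of_int n)" if n: "n \<notin> bad" for n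
  proof -
    have g0: "w \<in> B0" if "w \<in> Mat (Suc d) k0 f" "scal (?l n) w \<in> B0" for w using n that unfolding bad_def by blast
    have g1: "w \<in> Zs" if "w \<in> Mat (Suc d) k1 f" "scal (?l n) w \<in> Zs" for w using n that unfolding bad_def by blast
    have A0M: "A0 n \<in> Mat (Suc d) k0 k1" and A1M: "A1 n \<in> Mat (Suc d) k1 k2" using A0 A1 up by blast+
    have 1: "\<exists>w\<in>Mat d k2 f. u - mat_mul k2 (A1 n) w \<in> row_sub d k1 f Q"
      if fz: "fibre_zero d Zs B (of_int n)" and u: "u \<in> Mat d k1 f" "mat_mul k1 (A0 n) u \<in> row_sub d k0 f Q" for u
    proof -
      have uM: "u \<in> Mat (Suc d) k1 f" using u(1) up by blast
      have qR: "mat_mul k1 (A0 n) u \<in> row_sub (Suc d) k0 f Q" using u(2) upR by blast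
      have "cong_lin d (of_int n) (mat_mul k1 E0 u l j) (mat_mul k1 (A0 n) u l j)" for l j
        using c0 by (intro cong_lin_mat_mul[OF _ _ E0 uM]) simp_all
      then obtain w where w: "w \<in> Mat (Suc d) k0 f" "mat_mul k1 E0 u - mat_mul k1 (A0 n) u = scal (?l n) w"
        using cong_lin_imp_scal[OF mat_mul_Mat[OF E0 uM] mat_mul_Mat[OF A0M uM]] by blast
      have "scal (?l n) w - mat_mul k1 E0 u = - mat_mul k1 (A0 n) u" unfolding w(2)[symmetric] by simp
      hence "scal (?l n) w \<in> B0" unfolding B0_def
        using R(5)[OF qR] uM M(4)[OF lin_T w(1)] by (intro CollectI conjI bexI[of _ u]) simp_all
      hence "w \<in> B0" using g0 w(1) by blast
      then obtain v where v: "v \<in> Mat (Suc d) k1 f" "w - mat_mul k1 E0 v \<in> row_sub (Suc d) k0 f Q" unfolding B0_def by blast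
      \<comment> \<open>Subtracting (z - n) v makes \<open>u\<close> a cycle over S<z> and leaves
        its value at n unchanged.\<close>
      have "mat_mul k1 E0 (u - scal (?l n) v) = mat_mul k1 (A0 n) u + scal (?l n) (w - mat_mul k1 E0 v)"
      proof -
        have "mat_mul k1 E0 u = mat_mul k1 (A0 n) u + scal (?l n) w" unfolding w(2)[symmetric] by simp
        thus ?thesis unfolding mat_mul_diff_right mat_mul_scal_right scal_simps(2) by simp
      qed
      hence "mat_mul k1 E0 (u - scal (?l n) v) \<in> row_sub (Suc d) k0 f Q"
        using R(3)[OF qR R(4)[OF lin_T v(2)]] by simp
      hence "u - scal (?l n) v \<in> Zs" unfolding Zs_def using M(6)[OF uM M(4)[OF lin_T v(1)]] by blast
      then obtain b w' where bw: "b \<in> B" "w' \<in> Zs" "u - scal (?l n) v = b + scal (?l n) w'"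
        using fz unfolding fibre_zero_def by blast
      have ub: "u - b = scal (?l n) (v + w')"
      proof -
        have "u - b = (u - scal (?l n) v) - b + scal (?l n) v" by simp
        thus ?thesis unfolding bw(3) scal_simps(1) by (simp add: add.commute)
      qed
      have vw: "v + w' \<in> Mat (Suc d) k1 f" using M(3)[OF v(1)] submodD(1)[OF Zs bw(2)] by blast
      obtain y where y: "y \<in> Mat (Suc d) k2 f" "b - mat_mul k2 E1 y \<in> row_sub (Suc d) k1 f Q"
        using bw(1) unfolding B_def by blast
      obtain y0 where y0: "y0 \<in> Mat d k2 f" "\<forall>l j. cong_lin d (of_int n) (y l j) (y0 l j)" using Mat_ex_cong_lin[OF a1 y(1)] by blast
      obtain q0 where q0: "q0 \<in> row_sub d k1 f Q" "\<forall>l j. cong_lin d (of_int n) ((b - mat_mul k2 E1 y) l j) (q0 l j)"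
        using row_sub_ex_cong_lin[OF a1 Q y(2)] by blast
      have y0M: "y0 \<in> Mat (Suc d) k2 f" using y0(1) up by blast
      have q0M: "q0 \<in> Mat d k1 f" using q0(1) by (simp add: row_sub_def)
      \<comment> \<open>Both sides have entries in S and equal values at n, which forces
        equality.\<close>
      have "u = q0 + mat_mul k2 (A1 n) y0"
      proof (rule Mat_cong_lin_eq[OF a1 u(1)])
        show "q0 + mat_mul k2 (A1 n) y0 \<in> Mat d k1 f" using M(3)[OF q0M mat_mul_Mat[OF A1 y0(1)]] .
        fix l j
        have e1: "cong_lin d (of_int n) (u l j) (b l j)" by (rule scal_imp_cong_lin[OF ub vw])
        have e2: "cong_lin d (of_int n) (mat_mul k2 E1 y l j) (mat_mul k2 (A1 n) y0 l j)"
          using c1 y0(2) by (intro cong_lin_mat_mul[OF _ _ E1 y0M]) blast+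
        have "cong_lin d (of_int n) ((b - mat_mul k2 E1 y) l j + mat_mul k2 E1 y l j) (q0 l j + mat_mul k2 (A1 n) y0 l j)"
          using q0(2) e2 by (intro cong_lin_add) blast+
        hence "cong_lin d (of_int n) (b l j) ((q0 + mat_mul k2 (A1 n) y0) l j)" by simp
        thus "cong_lin d (of_int n) (u l j) ((q0 + mat_mul k2 (A1 n) y0) l j)" using e1 cong_lin_trans by blast
      qed
      hence "u - mat_mul k2 (A1 n) y0 = q0" by simp
      thus ?thesis using q0(1) y0(1) by metis
    qed
    have 2: "fibre_zero d Zs B (of_int n)" if nh: "\<not> hom_nz d f Q k0 k1 k2 (A0 n) (A1 n)"
      unfolding fibre_zero_def
    proof
      fix \<zeta> assume \<zeta>: "\<zeta> \<in> Zs"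
      hence \<zeta>M: "\<zeta> \<in> Mat (Suc d) k1 f" and \<zeta>R: "mat_mul k1 E0 \<zeta> \<in> row_sub (Suc d) k0 f Q" by (auto simp: Zs_def)
      obtain u where u: "u \<in> Mat d k1 f" "\<forall>l j. cong_lin d (of_int n) (\<zeta> l j) (u l j)" using Mat_ex_cong_lin[OF a1 \<zeta>M] by blast
      have uM: "u \<in> Mat (Suc d) k1 f" using u(1) up by blast
      obtain w where w: "w \<in> Mat (Suc d) k1 f" "\<zeta> - u = scal (?l n) w" using cong_lin_imp_scal[OF \<zeta>M uM] u(2) by blast
      obtain q0 where q0: "q0 \<in> row_sub d k0 f Q" "\<forall>l j. cong_lin d (of_int n) (mat_mul k1 E0 \<zeta> l j) (q0 l j)"
        using row_sub_ex_cong_lin[OF a1 Q \<zeta>R] by blast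
      have "mat_mul k1 (A0 n) u = q0"
      proof (rule Mat_cong_lin_eq[OF a1 mat_mul_Mat[OF A0 u(1)]])
        show "q0 \<in> Mat d k0 f" using q0(1) by (simp add: row_sub_def)
        fix l j
        have "cong_lin d (of_int n) (mat_mul k1 E0 \<zeta> l j) (mat_mul k1 (A0 n) u l j)"
          using c0 u(2) by (intro cong_lin_mat_mul[OF _ _ E0 uM]) blast+
        thus "cong_lin d (of_int n) (mat_mul k1 (A0 n) u l j) (q0 l j)" using q0(2) cong_lin_trans cong_lin_sym by blast
      qed
      then obtain y where y: "y \<in> Mat d k2 f" "u - mat_mul k2 (A1 n) y \<in> row_sub d k1 f Q"
        using nh u(1) q0(1) unfolding hom_nz_def by blast
      have yM: "y \<in> Mat (Suc d) k2 f" using y(1) up by blast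
      have "cong_lin d (of_int n) (mat_mul k2 E1 y l j) (mat_mul k2 (A1 n) y l j)" for l j
        using c1 by (intro cong_lin_mat_mul[OF _ _ E1 yM]) simp_all
      then obtain w' where w': "w' \<in> Mat (Suc d) k1 f" "mat_mul k2 E1 y - mat_mul k2 (A1 n) y = scal (?l n) w'"
        using cong_lin_imp_scal[OF mat_mul_Mat[OF E1 yM] mat_mul_Mat[OF A1M yM]] by blast
      define q where "q = u - mat_mul k2 (A1 n) y"
      have qR: "q \<in> row_sub (Suc d) k1 f Q" using y(2) upR unfolding q_def by blast
      \<comment> \<open>A boundary over S<z> with the same value at n as \<open>u\<close>, and hence
        as \<zeta>.\<close>
      define b where "b = mat_mul k2 E1 y + q"
      have "q \<in> Mat (Suc d) k1 f" using qR by (simp add: row_sub_def)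
      hence bM: "b \<in> Mat (Suc d) k1 f" unfolding b_def using M(3)[OF mat_mul_Mat[OF E1 yM]] by blast
      have "b - mat_mul k2 E1 y = q" by (simp add: b_def)
      hence bB: "b \<in> B" unfolding B_def using bM yM qR by (intro CollectI conjI bexI[of _ y]) simp_all
      have e: "\<zeta> - b = scal (?l n) (w - w')"
      proof -
        have "\<zeta> - b = (\<zeta> - u) - (mat_mul k2 E1 y - mat_mul k2 (A1 n) y)" by (simp add: b_def q_def)
        thus ?thesis unfolding w(2) w'(2) scal_simps(2) .
      qed
      have "\<zeta> - b \<in> Zs" using submodD(6)[OF Zs \<zeta>] bB BZ by blast
      hence "w - w' \<in> Zs" using g1[OF M(6)[OF w(1) w'(1)]] unfolding e by blast
      moreover have "\<zeta> = b + scal (?l n) (w - w')" unfolding e[symmetric] by simp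
      ultimately show "\<exists>v\<in>B. \<exists>w\<in>Zs. \<zeta> = v + scal (?l n) w" using bB by blast
    qed
    show ?thesis using 1 2 unfolding hom_nz_def by blast
  qed
  have "{n. hom_nz d f Q k0 k1 k2 (A0 n) (A1 n) = fibre_zero d Zs B (of_int n)} \<subseteq> bad"
    using main by blast
  thus ?thesis using Zs B BZ fin finite_subset by blast
qed

theorem homology_progressions:
  assumes "E0 \<in> Mat (Suc d) k0 k1" "E1 \<in> Mat (Suc d) k1 k2"
    "\<And>n::int. A0 n \<in> Mat d k0 k1" "\<And>n::int. A1 n \<in> Mat d k1 k2"
    "\<And>n l j. cong_lin d (of_int n) (E0 l j) (A0 n l j)" "\<And>n l j. cong_lin d (of_int n) (E1 l j) (A1 n l j)"
    "\<And>n. mat_mul k1 (A0 n) (A1 n) = 0" "Q \<subseteq> Vec d f"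
  defines "S \<equiv> {n::int. hom_nz d f Q k0 k1 k2 (A0 n) (A1 n)}"
  shows "\<exists>r. \<exists>B. finite B \<and> finite ((S - (\<Union>a\<in>B. resid a r)) \<union> ((\<Union>a\<in>B. resid a r) - S))"
proof -
  obtain Zs B where ZB: "submod (Suc d) k1 f Zs" "submod (Suc d) k1 f B" "B \<subseteq> Zs"
    and fin: "finite {n. hom_nz d f Q k0 k1 k2 (A0 n) (A1 n) = fibre_zero d Zs B (of_int n)}"
    using homology_fibres[OF assms(1-8)] by blast
  define S' where "S' = {n::int. \<not> fibre_zero d Zs B (of_int n)}"
  have "\<exists>\<epsilon>>0. \<exists>c. \<forall>n::int. of_int n \<noteq> \<kappa> \<longrightarrow> av (of_int n - \<kappa>) < \<epsilon> \<longrightarrow> (n \<in> S') = c" for \<kappa>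
  proof -
    obtain \<epsilon> c where "\<epsilon> > 0" "\<forall>\<nu>. \<nu> \<noteq> \<kappa> \<longrightarrow> av (\<nu> - \<kappa>) < \<epsilon> \<longrightarrow> fibre_zero d Zs B \<nu> = c"
      using fibre_zero_locally_constant[OF ZB] by blast
    thus ?thesis by (intro exI[of _ \<epsilon>] conjI exI[of _ "\<not> c"]) (auto simp: S'_def)
  qed
  from locally_constant_imp_progressions[of S', OF this]
  obtain r B' where B': "finite B'" "finite ((S' - (\<Union>a\<in>B'. resid a r)) \<union> ((\<Union>a\<in>B'. resid a r) - S'))" by blast
  have "(S - (\<Union>a\<in>B'. resid a r)) \<union> ((\<Union>a\<in>B'. resid a r) - S) \<subseteq>
      ((S' - (\<Union>a\<in>B'. resid a r)) \<union> ((\<Union>a\<in>B'. resid a r) - S')) \<union>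
      {n. hom_nz d f Q k0 k1 k2 (A0 n) (A1 n) = fibre_zero d Zs B (of_int n)}"
    unfolding S_def S'_def by blast
  hence "finite ((S - (\<Union>a\<in>B'. resid a r)) \<union> ((\<Union>a\<in>B'. resid a r) - S))"
    using B'(2) fin finite_subset finite_UnI by blast
  thus ?thesis using B'(1) by blast
qed

end

section \<open>Independence of the resolution\<close>

definition mat_vec :: "nat \<Rightarrow> 'k::field pmat \<Rightarrow> (nat \<Rightarrow> 'k ps) \<Rightarrow> (nat \<Rightarrow> 'k ps)" where
  "mat_vec n A v = (\<lambda>l. \<Sum>t<n. A l t * v t)"
definition column :: "'k::field pmat \<Rightarrow> nat \<Rightarrow> (nat \<Rightarrow> 'k ps)" where "column Z t = (\<lambda>l. Z l t)"
definition id_mat :: "nat \<Rightarrow> 'k::field pmat" where "id_mat e = (\<lambda>l j. if l = j \<and> l < e then 1 else 0)"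

lemma column_mat_mul: "column (mat_mul n A Z) t = mat_vec n A (column Z t)" by (simp add: column_def mat_mul_def mat_vec_def)

context nonarch
begin

lemma column_Vec: "Z \<in> Mat D a b \<Longrightarrow> column Z t \<in> Vec D a"
  using Mat_T[of Z D a b] Mat_out[of Z D a b] by (auto simp: Vec_def column_def)

lemma id_mat_Mat: "id_mat e \<in> Mat D e e" by (auto simp: Mat_def id_mat_def)

lemma mat_mul_id_mat_left: assumes "Z \<in> Mat D e b" shows "mat_mul e (id_mat e) Z = Z"
proof (intro ext)
  fix l j
  have "mat_mul e (id_mat e) Z l j = (\<Sum>t<e. if t = l then Z l j else 0)"
    unfolding mat_mul_def id_mat_def by (intro sum.cong) auto
  thus "mat_mul e (id_mat e) Z l j = Z l j" using Mat_out[OF assms, of l j] by auto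
qed

lemma mat_mul_id_mat_right: assumes "Z \<in> Mat D a b" shows "mat_mul b Z (id_mat b) = Z"
proof (intro ext)
  fix l j
  have "mat_mul b Z (id_mat b) l j = (\<Sum>t<b. if t = j then Z l j else 0)"
    unfolding mat_mul_def id_mat_def by (intro sum.cong) auto
  thus "mat_mul b Z (id_mat b) l j = Z l j" using Mat_out[OF assms, of l j] by auto
qed

text \<open>Projectivity of a free module in matrix form: a preimage is chosen for the image of each
  basis vector.\<close>

lemma lift_columns:
  assumes Z: "Z \<in> Mat D b m" and A: "A \<in> Mat D b n" and c: "\<And>t. t < m \<Longrightarrow> column Z t \<in> mat_vec n A ` Vec D n"
  shows "\<exists>Y\<in>Mat D n m. Z = mat_mul n A Y"
proof -
  have "\<exists>y. t < m \<longrightarrow> y \<in> Vec D n \<and> column Z t = mat_vec n A y" for t using c[of t] by blast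
  then obtain y where y: "\<And>t. t < m \<Longrightarrow> y t \<in> Vec D n \<and> column Z t = mat_vec n A (y t)" by metis
  define Y where "Y = (\<lambda>l t. if t < m then y t l else 0)"
  have "Y \<in> Mat D n m" using y by (auto simp: Mat_def Y_def Vec_def)
  moreover have "Z = mat_mul n A Y"
  proof (intro ext)
    fix l t
    show "Z l t = mat_mul n A Y l t"
    proof (cases "t < m")
      case True
      have "Z l t = column Z t l" by (simp add: column_def)
      also have "\<dots> = mat_mul n A Y l t" using y[OF True] True by (simp add: mat_vec_def mat_mul_def Y_def)
      finally show ?thesis .
    next
      case False
      thus ?thesis using Mat_out[OF Z, of l t] by (simp add: mat_mul_def Y_def)
    qed
  qed
  ultimately show ?thesis by blast
qed

definition is_res :: "nat \<Rightarrow> nat \<Rightarrow> (nat \<Rightarrow> 'k ps) set \<Rightarrow> (nat \<Rightarrow> nat) \<Rightarrow> (nat \<Rightarrow> 'k pmat) \<Rightarrow> bool" where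
  "is_res d e R k A \<longleftrightarrow> k 0 = e \<and> (\<forall>j. A j \<in> Mat d (k j) (k (Suc j))) \<and>
     row_span d R = mat_vec (k 1) (A 0) ` Vec d (k 1) \<and>
     (\<forall>j. {v \<in> Vec d (k (Suc j)). mat_vec (k (Suc j)) (A j) v = 0} =
        mat_vec (k (Suc (Suc j))) (A (Suc j)) ` Vec d (k (Suc (Suc j))))"

context
  fixes d e R k A
  assumes fr: "is_res d e R k A"
begin

lemma is_res_0: "k 0 = e" using fr by (simp add: is_res_def)
lemma is_res_Mat: "A j \<in> Mat d (k j) (k (Suc j))" using fr by (simp add: is_res_def)
lemma is_res_exact: "{v \<in> Vec d (k (Suc j)). mat_vec (k (Suc j)) (A j) v = 0} =
        mat_vec (k (Suc (Suc j))) (A (Suc j)) ` Vec d (k (Suc (Suc j)))" using fr by (simp add: is_res_def)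

text \<open>Every column of \<open>A (Suc j)\<close> is the image of a basis vector and so lies in
  the kernel of \<open>A j\<close>.\<close>

lemma is_res_complex: "mat_mul (k (Suc j)) (A j) (A (Suc j)) = 0"
proof (intro ext)
  fix l t
  let ?n = "k (Suc (Suc j))"
  have "column (mat_mul (k (Suc j)) (A j) (A (Suc j))) t = 0"
  proof -
    have "mat_vec ?n (A (Suc j)) (column (id_mat ?n) t) = column (A (Suc j)) t"
      unfolding column_mat_mul[symmetric] mat_mul_id_mat_right[OF is_res_Mat] ..
    moreover have "column (id_mat ?n) t \<in> Vec d ?n" using column_Vec[OF id_mat_Mat] .
    ultimately have "column (A (Suc j)) t \<in> mat_vec ?n (A (Suc j)) ` Vec d ?n" by (metis imageI)
    thus ?thesis unfolding is_res_exact[symmetric] column_mat_mul by blast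
  qed
  from fun_cong[OF this, of l] show "mat_mul (k (Suc j)) (A j) (A (Suc j)) l t = 0 l t" by (simp add: column_def)
qed

lemma is_res_lift:
  assumes Z: "Z \<in> Mat d (k (Suc j)) m" and z: "mat_mul (k (Suc j)) (A j) Z = 0"
  shows "\<exists>Y\<in>Mat d (k (Suc (Suc j))) m. Z = mat_mul (k (Suc (Suc j))) (A (Suc j)) Y"
proof (rule lift_columns[OF Z is_res_Mat])
  fix t
  have "mat_vec (k (Suc j)) (A j) (column Z t) = 0"
    unfolding column_mat_mul[symmetric] z by (simp add: column_def zero_fun_def)
  thus "column Z t \<in> mat_vec (k (Suc (Suc j))) (A (Suc j)) ` Vec d (k (Suc (Suc j)))"
    unfolding is_res_exact[symmetric] using column_Vec[OF Z] by blast
qed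

end

text \<open>The comparison theorem over the identity of the presented module; the two resolutions
  share their relations, which starts the construction, and exactness continues it.\<close>

lemma chain_map_exists:
  assumes fr: "is_res d e R k A" and fr': "is_res d e R k' A'"
  shows "\<exists>\<phi>. \<phi> 0 = id_mat e \<and> (\<forall>j. \<phi> j \<in> Mat d (k j) (k' j) \<and>
    mat_mul (k (Suc j)) (A j) (\<phi> (Suc j)) = mat_mul (k' j) (\<phi> j) (A' j))"
proof -
  \<comment> \<open>Dependent choice needs the next step to be possible, so the invariant includes a
    lift of the composite through \<open>A j\<close>.\<close>
  define P where "P j \<phi> \<longleftrightarrow> \<phi> \<in> Mat d (k j) (k' j) \<and> (j = 0 \<longrightarrow> \<phi> = id_mat e) \<and>
    (\<exists>Y\<in>Mat d (k (Suc j)) (k' (Suc j)). mat_mul (k' j) \<phi> (A' j) = mat_mul (k (Suc j)) (A j) Y)" for j \<phi>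
  define Q where "Q j \<phi> \<phi>' \<longleftrightarrow> mat_mul (k (Suc j)) (A j) \<phi>' = mat_mul (k' j) \<phi> (A' j)" for j \<phi> \<phi>'
  note M = is_res_Mat[OF fr] and M' = is_res_Mat[OF fr']
  have k0: "k 0 = e" "k' 0 = e" using is_res_0 fr fr' by auto
  have "\<exists>\<phi>. \<forall>j. P j (\<phi> j) \<and> Q j (\<phi> j) (\<phi> (Suc j))"
  proof (rule dependent_nat_choice)
    have A'0: "A' 0 \<in> Mat d e (k' 1)" and A0: "A 0 \<in> Mat d e (k 1)" using M'[of 0] M[of 0] k0 by auto
    have "\<exists>Y\<in>Mat d (k 1) (k' 1). A' 0 = mat_mul (k 1) (A 0) Y"
    proof (rule lift_columns[OF A'0 A0])
      fix t
      have "mat_vec (k' 1) (A' 0) (column (id_mat (k' 1)) t) = column (A' 0) t"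
        unfolding column_mat_mul[symmetric] mat_mul_id_mat_right[OF A'0] ..
      hence "column (A' 0) t \<in> mat_vec (k' 1) (A' 0) ` Vec d (k' 1)" using column_Vec[OF id_mat_Mat] by (metis imageI)
      also have "\<dots> = mat_vec (k 1) (A 0) ` Vec d (k 1)" using fr fr' by (simp add: is_res_def)
      finally show "column (A' 0) t \<in> mat_vec (k 1) (A 0) ` Vec d (k 1)" .
    qed
    hence "P 0 (id_mat e)" unfolding P_def using k0 mat_mul_id_mat_left[OF A'0] id_mat_Mat by simp
    thus "\<exists>\<phi>. P 0 \<phi>" by blast
  next
    fix \<phi> j assume "P j \<phi>"
    then obtain Y where \<phi>: "\<phi> \<in> Mat d (k j) (k' j)" and Y: "Y \<in> Mat d (k (Suc j)) (k' (Suc j))"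
      "mat_mul (k' j) \<phi> (A' j) = mat_mul (k (Suc j)) (A j) Y" unfolding P_def by blast
    have "mat_mul (k (Suc j)) (A j) (mat_mul (k' (Suc j)) Y (A' (Suc j))) = mat_mul (k' (Suc j)) (mat_mul (k' j) \<phi> (A' j)) (A' (Suc j))"
      unfolding Y(2) mat_mul_assoc ..
    also have "\<dots> = 0" unfolding mat_mul_assoc is_res_complex[OF fr'] by simp
    finally have "\<exists>Y'\<in>Mat d (k (Suc (Suc j))) (k' (Suc (Suc j))).
        mat_mul (k' (Suc j)) Y (A' (Suc j)) = mat_mul (k (Suc (Suc j))) (A (Suc j)) Y'"
      by (rule is_res_lift[OF fr mat_mul_Mat[OF Y(1) M']])
    hence "P (Suc j) Y" unfolding P_def using Y(1) by blast
    moreover have "Q j \<phi> Y" unfolding Q_def using Y(2) by simp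
    ultimately show "\<exists>\<phi>'. P (Suc j) \<phi>' \<and> Q j \<phi> \<phi>'" by blast
  qed
  then obtain \<phi> where \<phi>: "\<And>j. P j (\<phi> j) \<and> Q j (\<phi> j) (\<phi> (Suc j))" by blast
  have "\<phi> 0 = id_mat e" using \<phi>[of 0] unfolding P_def by blast
  moreover have "\<phi> j \<in> Mat d (k j) (k' j) \<and> mat_mul (k (Suc j)) (A j) (\<phi> (Suc j)) = mat_mul (k' j) (\<phi> j) (A' j)" for j
    using \<phi>[of j] unfolding P_def Q_def by blast
  ultimately show ?thesis by blast
qed

text \<open>A chain map that is 0 in degree 0 is homotopic to 0. The invariant \<open>P\<close> says
  that the part of \<chi> not yet accounted for is a cycle, which exactness then lifts.\<close>

lemma null_homotopy_exists:
  assumes fr: "is_res d e R k A" and \<chi>: "\<And>j. \<chi> j \<in> Mat d (k j) (k j)" "\<chi> 0 = 0"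
    "\<And>j. mat_mul (k (Suc j)) (A j) (\<chi> (Suc j)) = mat_mul (k j) (\<chi> j) (A j)"
  shows "\<exists>h. \<forall>j. h j \<in> Mat d (k (Suc j)) (k j) \<and>
    \<chi> (Suc j) = mat_mul (k j) (h j) (A j) + mat_mul (k (Suc (Suc j))) (A (Suc j)) (h (Suc j))"
proof -
  define P where "P j h \<longleftrightarrow> h \<in> Mat d (k (Suc j)) (k j) \<and>
    mat_mul (k (Suc j)) (A j) (mat_mul (k j) h (A j)) = mat_mul (k j) (\<chi> j) (A j)" for j h
  define Q where "Q j h h' \<longleftrightarrow> \<chi> (Suc j) - mat_mul (k j) h (A j) = mat_mul (k (Suc (Suc j))) (A (Suc j)) h'" for j h h'
  note M = is_res_Mat[OF fr]
  have "\<exists>h. \<forall>j. P j (h j) \<and> Q j (h j) (h (Suc j))"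
  proof (rule dependent_nat_choice)
    have "P 0 0" unfolding P_def using \<chi>(2) submodD(2)[OF submod_Mat] by simp
    thus "\<exists>h. P 0 h" by blast
  next
    fix h j assume "P j h"
    hence h: "h \<in> Mat d (k (Suc j)) (k j)" "mat_mul (k (Suc j)) (A j) (mat_mul (k j) h (A j)) = mat_mul (k j) (\<chi> j) (A j)"
      unfolding P_def by blast+
    let ?Z = "\<chi> (Suc j) - mat_mul (k j) h (A j)"
    have Z: "?Z \<in> Mat d (k (Suc j)) (k (Suc j))"
      using submodD(6)[OF submod_Mat \<chi>(1) mat_mul_Mat[OF h(1) M]] .
    have "mat_mul (k (Suc j)) (A j) ?Z = 0" unfolding mat_mul_diff_right \<chi>(3) h(2) by simp
    from is_res_lift[OF fr Z this]
    obtain Y where Y: "Y \<in> Mat d (k (Suc (Suc j))) (k (Suc j))" "?Z = mat_mul (k (Suc (Suc j))) (A (Suc j)) Y" by blast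
    have "mat_mul (k (Suc (Suc j))) (A (Suc j)) (mat_mul (k (Suc j)) Y (A (Suc j))) = mat_mul (k (Suc j)) ?Z (A (Suc j))"
      unfolding Y(2) mat_mul_assoc ..
    also have "\<dots> = mat_mul (k (Suc j)) (\<chi> (Suc j)) (A (Suc j))"
      unfolding mat_mul_diff_left mat_mul_assoc is_res_complex[OF fr] by simp
    finally have "P (Suc j) Y" unfolding P_def using Y(1) by blast
    moreover have "Q j h Y" unfolding Q_def using Y(2) .
    ultimately show "\<exists>h'. P (Suc j) h' \<and> Q j h h'" by blast
  qed
  then obtain h where h: "\<And>j. P j (h j) \<and> Q j (h j) (h (Suc j))" by blast
  have "h j \<in> Mat d (k (Suc j)) (k j)" for j using h[of j] unfolding P_def by blast
  moreover have "\<chi> (Suc j) = mat_mul (k j) (h j) (A j) + mat_mul (k (Suc (Suc j))) (A (Suc j)) (h (Suc j))" for j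
  proof -
    have "\<chi> (Suc j) = mat_mul (k j) (h j) (A j) + (\<chi> (Suc j) - mat_mul (k j) (h j) (A j))" by simp
    thus ?thesis using h[of j] unfolding Q_def by simp
  qed
  ultimately show ?thesis by blast
qed

text \<open>With chain maps \<phi> and \<psi> between the resolutions, \<psi>\<phi> - 1 is
  null-homotopic; all maps are matrices over S and preserve the relations of N, so the homotopy
  survives the tensor product.\<close>

theorem hom_nz_independent:
  assumes fr: "is_res d e R k A" and fr': "is_res d e R k' A'"
    and nz: "hom_nz d f Q (k' i) (k' (Suc i)) (k' (Suc (Suc i))) (A' i) (A' (Suc i))"
  shows "hom_nz d f Q (k i) (k (Suc i)) (k (Suc (Suc i))) (A i) (A (Suc i))"
proof (rule ccontr)
  assume z: "\<not> ?thesis"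
  note M = is_res_Mat[OF fr] and M' = is_res_Mat[OF fr']
  note S = submodD[OF submod_Mat] and RSd = submodD[OF row_sub_submod]
  obtain \<phi> where \<phi>: "\<phi> 0 = id_mat e" "\<And>j. \<phi> j \<in> Mat d (k j) (k' j)"
    "\<And>j. mat_mul (k (Suc j)) (A j) (\<phi> (Suc j)) = mat_mul (k' j) (\<phi> j) (A' j)" using chain_map_exists[OF fr fr'] by blast
  obtain \<psi> where \<psi>: "\<psi> 0 = id_mat e" "\<And>j. \<psi> j \<in> Mat d (k' j) (k j)"
    "\<And>j. mat_mul (k' (Suc j)) (A' j) (\<psi> (Suc j)) = mat_mul (k j) (\<psi> j) (A j)" using chain_map_exists[OF fr' fr] by blast
  define \<chi> where "\<chi> j = mat_mul (k j) (\<psi> j) (\<phi> j) - id_mat (k' j)" for j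
  have \<chi>M: "\<chi> j \<in> Mat d (k' j) (k' j)" for j
    unfolding \<chi>_def using S(6)[OF mat_mul_Mat[OF \<psi>(2) \<phi>(2)] id_mat_Mat] .
  have "\<chi> 0 = 0"
    unfolding \<chi>_def \<phi>(1) \<psi>(1) is_res_0[OF fr] is_res_0[OF fr'] mat_mul_id_mat_left[OF id_mat_Mat] by simp
  moreover have "mat_mul (k' (Suc j)) (A' j) (\<chi> (Suc j)) = mat_mul (k' j) (\<chi> j) (A' j)" for j
  proof -
    have "mat_mul (k' (Suc j)) (A' j) (mat_mul (k (Suc j)) (\<psi> (Suc j)) (\<phi> (Suc j))) = mat_mul (k' j) (mat_mul (k j) (\<psi> j) (\<phi> j)) (A' j)"
      unfolding mat_mul_assoc[symmetric] \<psi>(3) unfolding mat_mul_assoc \<phi>(3) ..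
    thus ?thesis unfolding \<chi>_def mat_mul_diff_right mat_mul_diff_left mat_mul_id_mat_left[OF M'] mat_mul_id_mat_right[OF M'] by simp
  qed
  ultimately obtain h where h: "\<And>j. h j \<in> Mat d (k' (Suc j)) (k' j)"
    "\<And>j. \<chi> (Suc j) = mat_mul (k' j) (h j) (A' j) + mat_mul (k' (Suc (Suc j))) (A' (Suc j)) (h (Suc j))"
    using null_homotopy_exists[OF fr' \<chi>M] by blast
  obtain u where u: "u \<in> Mat d (k' (Suc i)) f" "mat_mul (k' (Suc i)) (A' i) u \<in> row_sub d (k' i) f Q"
    and nb: "\<And>w. w \<in> Mat d (k' (Suc (Suc i))) f \<Longrightarrow> u - mat_mul (k' (Suc (Suc i))) (A' (Suc i)) w \<notin> row_sub d (k' (Suc i)) f Q"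
    using nz unfolding hom_nz_def by blast
  let ?c = "mat_mul (k' (Suc i)) (A' i) u"
  define u1 where "u1 = mat_mul (k' (Suc i)) (\<phi> (Suc i)) u"
  have "mat_mul (k (Suc i)) (A i) u1 = mat_mul (k' i) (\<phi> i) ?c"
    unfolding u1_def mat_mul_assoc[symmetric] \<phi>(3) ..
  hence "mat_mul (k (Suc i)) (A i) u1 \<in> row_sub d (k i) f Q" using mat_mul_row_sub[OF \<phi>(2) u(2)] by simp
  moreover have "u1 \<in> Mat d (k (Suc i)) f" unfolding u1_def using mat_mul_Mat[OF \<phi>(2) u(1)] .
  ultimately obtain w where w: "w \<in> Mat d (k (Suc (Suc i))) f"
    "u1 - mat_mul (k (Suc (Suc i))) (A (Suc i)) w \<in> row_sub d (k (Suc i)) f Q" using z unfolding hom_nz_def by blast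
  \<comment> \<open>If \<phi> u is the boundary of \<open>w\<close> modulo relations, then applying
    \<psi> and subtracting the homotopy term exhibits \<open>u\<close> as the boundary of this
    \<open>v\<close>.\<close>
  define v where "v = mat_mul (k (Suc (Suc i))) (\<psi> (Suc (Suc i))) w - mat_mul (k' (Suc i)) (h (Suc i)) u"
  have vM: "v \<in> Mat d (k' (Suc (Suc i))) f"
    unfolding v_def using S(6)[OF mat_mul_Mat[OF \<psi>(2) w(1)] mat_mul_Mat[OF h(1) u(1)]] .
  have 1: "mat_mul (k (Suc i)) (\<psi> (Suc i)) (u1 - mat_mul (k (Suc (Suc i))) (A (Suc i)) w) =
      mat_mul (k (Suc i)) (\<psi> (Suc i)) u1 - mat_mul (k' (Suc (Suc i))) (A' (Suc i)) (mat_mul (k (Suc (Suc i))) (\<psi> (Suc (Suc i))) w)"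
    unfolding mat_mul_diff_right mat_mul_assoc[symmetric] \<psi>(3) ..
  have 2: "mat_mul (k (Suc i)) (\<psi> (Suc i)) u1 = u + mat_mul (k' (Suc i)) (\<chi> (Suc i)) u"
    unfolding \<chi>_def mat_mul_diff_left mat_mul_id_mat_left[OF u(1)] u1_def mat_mul_assoc by simp
  have 3: "mat_mul (k' (Suc i)) (\<chi> (Suc i)) u =
      mat_mul (k' i) (h i) ?c + mat_mul (k' (Suc (Suc i))) (A' (Suc i)) (mat_mul (k' (Suc i)) (h (Suc i)) u)"
    unfolding h(2) mat_mul_add_left mat_mul_assoc ..
  have "u - mat_mul (k' (Suc (Suc i))) (A' (Suc i)) v =
      mat_mul (k (Suc i)) (\<psi> (Suc i)) (u1 - mat_mul (k (Suc (Suc i))) (A (Suc i)) w) - mat_mul (k' i) (h i) ?c"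
    unfolding 1 unfolding 2 3 v_def mat_mul_diff_right by simp
  also have "\<dots> \<in> row_sub d (k' (Suc i)) f Q"
    using RSd(6)[OF mat_mul_row_sub[OF \<psi>(2) w(2)] mat_mul_row_sub[OF h(1) u(2)]] .
  finally show False using nb[OF vM] by blast
qed

end

section \<open>Twisting a resolution by an automorphism\<close>

definition map_mat :: "('k::field ps \<Rightarrow> 'k ps) \<Rightarrow> 'k pmat \<Rightarrow> 'k pmat" where "map_mat s A = (\<lambda>l j. s (A l j))"
definition map_row :: "('k::field ps \<Rightarrow> 'k ps) \<Rightarrow> (nat \<Rightarrow> 'k ps) \<Rightarrow> (nat \<Rightarrow> 'k ps)" where "map_row s v = (\<lambda>j. s (v j))"

context tate_aut
begin

lemma map_mat_Mat: "A \<in> Mat d a b \<Longrightarrow> map_mat s A \<in> Mat d a b" by (simp add: Mat_def map_mat_def)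
lemma map_row_Vec: "v \<in> Vec d n \<Longrightarrow> map_row s v \<in> Vec d n" by (simp add: Vec_def map_row_def)
lemma map_row_image: "map_row s ` Vec d n = Vec d n"
proof
  show "map_row s ` Vec d n \<subseteq> Vec d n" using map_row_Vec by blast
  show "Vec d n \<subseteq> map_row s ` Vec d n"
  proof
    fix v assume v: "v \<in> Vec d n"
    interpret i: tate_aut av d "inv_into (T d) s" by (rule inv_aut)
    have "s (inv_into (T d) s f) = f" if "f \<in> T d" for f
      using bij that by (simp add: bij_betw_def f_inv_into_f)
    hence "v = map_row s (map_row (inv_into (T d) s) v)" using Vec_T[OF v] by (simp add: map_row_def)
    thus "v \<in> map_row s ` Vec d n" using i.map_row_Vec[OF v] by blast
  qed
qed
lemma s_inj: "f \<in> T d \<Longrightarrow> g \<in> T d \<Longrightarrow> s f = s g \<Longrightarrow> f = g"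
  using bij by (auto simp: bij_betw_def dest: inj_onD)
lemma map_row_zero: "v \<in> Vec d n \<Longrightarrow> map_row s v = 0 \<longleftrightarrow> v = 0"
  using s_inj[OF Vec_T[of v d n] T_0] by (auto simp: map_row_def fun_eq_iff)
lemma mat_vec_map_row:
  assumes "A \<in> Mat d a n" "v \<in> Vec d n" shows "mat_vec n (map_mat s A) (map_row s v) = map_row s (mat_vec n A v)"
  using Mat_T[OF assms(1)] Vec_T[OF assms(2)]
  by (simp add: mat_vec_def map_mat_def map_row_def s_sum s_mult T_mult)

lemma row_span_map_row: assumes R: "R \<subseteq> Vec d e" shows "row_span d (map_row s ` R) = map_row s ` row_span d R"
proof
  show "map_row s ` row_span d R \<subseteq> row_span d (map_row s ` R)"
  proof
    fix w assume "w \<in> map_row s ` row_span d R"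
    then obtain v where v: "v \<in> row_span d R" "w = map_row s v" by blast
    from v(1) have "map_row s v \<in> row_span d (map_row s ` R)"
    proof (induction rule: row_span.induct)
      case row_span_0
      thus ?case by (simp add: map_row_def row_span.row_span_0)
    next
      case (row_span_step v c r)
      have "map_row s (\<lambda>t. v t + c * r t) = (\<lambda>t. map_row s v t + s c * map_row s r t)"
        using Vec_T[OF row_span_Vec[OF row_span_step(1) R]] row_span_step(2) Vec_T[OF subsetD[OF R row_span_step(3)]]
        by (simp add: map_row_def s_add s_mult T_mult)
      thus ?case using row_span_step by (auto intro!: row_span.row_span_step)
    qed
    thus "w \<in> row_span d (map_row s ` R)" using v(2) by simp
  qed
  show "row_span d (map_row s ` R) \<subseteq> map_row s ` row_span d R"
  proof
    fix w assume "w \<in> row_span d (map_row s ` R)"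
    thus "w \<in> map_row s ` row_span d R"
    proof (induction rule: row_span.induct)
      case row_span_0
      have "(\<lambda>_. 0) = map_row s (\<lambda>_. 0)" by (simp add: map_row_def)
      thus ?case using row_span.row_span_0 by blast
    next
      case (row_span_step v c r)
      obtain v' where v': "v' \<in> row_span d R" "v = map_row s v'" using row_span_step(4) by blast
      obtain r' where r': "r' \<in> R" "r = map_row s r'" using row_span_step(3) by blast
      obtain c' where c': "c' \<in> T d" "c = s c'" using row_span_step(2) bij by (auto simp: bij_betw_def)
      have "map_row s (\<lambda>t. v' t + c' * r' t) = (\<lambda>t. v t + c * r t)"
        using Vec_T[OF row_span_Vec[OF v'(1) R]] c'(1) Vec_T[OF subsetD[OF R r'(1)]]
        unfolding v'(2) c'(2) r'(2) by (simp add: map_row_def s_add s_mult T_mult)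
      thus ?case using imageI[OF row_span.row_span_step[OF v'(1) c'(1) r'(1)], of "map_row s"] by simp
    qed
  qed
qed

text \<open>\<open>s\<close> acts on every free module as a semilinear bijection, so spans, images
  and kernels are carried along and exactness with them.\<close>

lemma is_res_map_mat:
  assumes fr: "is_res d e R k A" and R: "R \<subseteq> Vec d e"
  shows "is_res d e (map_row s ` R) k (\<lambda>j. map_mat s (A j))"
proof -
  note M = is_res_Mat[OF fr]
  have img: "mat_vec (k (Suc j)) (map_mat s (A j)) ` Vec d (k (Suc j)) = map_row s ` (mat_vec (k (Suc j)) (A j) ` Vec d (k (Suc j)))" for j
  proof -
    have "mat_vec (k (Suc j)) (map_mat s (A j)) ` Vec d (k (Suc j)) = mat_vec (k (Suc j)) (map_mat s (A j)) ` map_row s ` Vec d (k (Suc j))"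
      unfolding map_row_image ..
    also have "\<dots> = map_row s ` (mat_vec (k (Suc j)) (A j) ` Vec d (k (Suc j)))"
      unfolding image_image using mat_vec_map_row[OF M] by (intro image_cong) auto
    finally show ?thesis .
  qed
  have aV: "mat_vec n B v \<in> Vec d a" if "B \<in> Mat d a n" "v \<in> Vec d n" for a n B v
    using Mat_T[OF that(1)] Vec_T[OF that(2)] Mat_out[OF that(1)]
    by (auto simp: Vec_def mat_vec_def intro!: T_sum T_mult)
  have ker: "{v \<in> Vec d (k (Suc j)). mat_vec (k (Suc j)) (map_mat s (A j)) v = 0} =
      map_row s ` {v \<in> Vec d (k (Suc j)). mat_vec (k (Suc j)) (A j) v = 0}" for j
  proof -
    have "{v \<in> Vec d (k (Suc j)). mat_vec (k (Suc j)) (map_mat s (A j)) v = 0} =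
        {v \<in> map_row s ` Vec d (k (Suc j)). mat_vec (k (Suc j)) (map_mat s (A j)) v = 0}" unfolding map_row_image ..
    also have "\<dots> = map_row s ` {v \<in> Vec d (k (Suc j)). mat_vec (k (Suc j)) (map_mat s (A j)) (map_row s v) = 0}" by blast
    also have "\<dots> = map_row s ` {v \<in> Vec d (k (Suc j)). mat_vec (k (Suc j)) (A j) v = 0}"
    proof -
      have "mat_vec (k (Suc j)) (map_mat s (A j)) (map_row s v) = 0 \<longleftrightarrow> mat_vec (k (Suc j)) (A j) v = 0"
        if "v \<in> Vec d (k (Suc j))" for v
        unfolding mat_vec_map_row[OF M that] using map_row_zero[OF aV[OF M that]] .
      thus ?thesis by (intro arg_cong[of _ _ "image (map_row s)"]) blast
    qed
    finally show ?thesis .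
  qed
  show ?thesis
    unfolding is_res_def row_span_map_row[OF R]
  proof (intro conjI allI)
    show "k 0 = e" by (rule is_res_0[OF fr])
    show "map_mat s (A j) \<in> Mat d (k j) (k (Suc j))" for j using map_mat_Mat[OF M] .
    show "map_row s ` row_span d R = mat_vec (k 1) (map_mat s (A 0)) ` Vec d (k 1)"
      using img[of 0] fr by (simp add: is_res_def)
    show "{v \<in> Vec d (k (Suc j)). mat_vec (k (Suc j)) (map_mat s (A j)) v = 0} =
        mat_vec (k (Suc (Suc j))) (map_mat s (A (Suc j))) ` Vec d (k (Suc (Suc j)))" for j
      unfolding ker img is_res_exact[OF fr] ..
  qed
qed

end

section \<open>Translation to coefficient functions\<close>

definition vec_coeffs :: "(nat \<Rightarrow> 'k::field ps) \<Rightarrow> 'k tvec" where "vec_coeffs v = (\<lambda>j. cf (v j))"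
definition mat_coeffs :: "'k::field pmat \<Rightarrow> 'k tmat" where "mat_coeffs A = (\<lambda>l j. cf (A l j))"

lemma cf_zero: "cf 0 = 0" by (intro ext) simp
lemma cf_add_fun: "cf (f + g) = cf f + cf g" by (intro ext) simp
lemma cf_diff_fun: "cf (f - g) = cf f - cf g" by (intro ext) simp
lemma cf_sum_fun: "cf (sum f A) = (\<Sum>x\<in>A. cf (f x))"
  by (induction A rule: infinite_finite_induct)
     (simp_all only: sum.empty sum.insert sum.infinite cf_zero cf_add_fun not_False_eq_True)
lemma inj_vec_coeffs: "inj vec_coeffs" by (rule injI) (auto simp: vec_coeffs_def fun_eq_iff cf_inject[symmetric])
lemma vec_coeffs_zero_iff: "vec_coeffs v = 0 \<longleftrightarrow> v = 0"
  using inj_eq[OF inj_vec_coeffs, of v 0] by (simp add: vec_coeffs_def cf_zero zero_fun_def)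
lemma vec_coeffs_0: "vec_coeffs 0 = 0" using vec_coeffs_zero_iff[of 0] by simp
lemma mat_coeffs_diff: "mat_coeffs u - mat_coeffs v = mat_coeffs (u - v)" by (intro ext) (simp add: mat_coeffs_def)
lemma vec_coeffs_mat_vec: "mat_app (mat_coeffs A) n (vec_coeffs v) = vec_coeffs (mat_vec n A v)"
  by (intro ext) (simp add: mat_app_def mat_coeffs_def vec_coeffs_def mat_vec_def cf_sum_fun cf_mult)
lemma mat_coeffs_mat_mul: "tens_app (mat_coeffs A) n (mat_coeffs u) = mat_coeffs (mat_mul n A u)"
proof -
  have "(\<Sum>j<n. smul_vec (mat_coeffs A l j) (mat_coeffs u j)) t = (\<Sum>j<n. tmul (cf (A l j)) (cf (u j t)))" for l t
    by (induction n) (simp_all add: smul_vec_def mat_coeffs_def)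
  thus ?thesis by (intro ext) (simp add: tens_app_def mat_coeffs_def mat_mul_def cf_sum_fun cf_mult)
qed

lemma cf_X: "cf (X j) = tvar j"
proof
  fix \<alpha>
  have "fin_idx (\<lambda>i. if i = j then 1 else (0::nat))" by (rule finite_subset[of _ "{j}"]) auto
  thus "cf (X j) \<alpha> = tvar j \<alpha>" by (simp add: X_def cf_mon tvar_def)
qed
lemma cf_Cc_tconst: "cf (Cc c) = tconst c" by (intro ext) (simp add: cf_Cc tconst_def)

context nonarch
begin

lemma cf_tate: "f \<in> T d \<Longrightarrow> cf f \<in> tate av d" by (simp add: T_def)
lemma Abs_tate: assumes "f \<in> tate av d" shows "cf (Abs_ps f) = f" "Abs_ps f \<in> T d"
proof -
  show "cf (Abs_ps f) = f" using assms multi_idx_fin by (subst Abs_ps_inverse) (auto simp: tate_def)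
  thus "Abs_ps f \<in> T d" using assms by (simp add: T_def)
qed
lemma vecs_eq: "vecs av d k = vec_coeffs ` Vec d k"
proof
  show "vec_coeffs ` Vec d k \<subseteq> vecs av d k" by (auto simp: vecs_def Vec_def vec_coeffs_def cf_tate cf_zero)
  show "vecs av d k \<subseteq> vec_coeffs ` Vec d k"
  proof
    fix v assume v: "v \<in> vecs av d k"
    define w where "w = (\<lambda>j. if j < k then Abs_ps (v j) else 0)"
    have "w \<in> Vec d k" using v Abs_tate(2) by (auto simp: w_def Vec_def vecs_def)
    moreover have "v = vec_coeffs w" using v Abs_tate(1) by (auto simp: w_def vec_coeffs_def vecs_def cf_zero fun_eq_iff)
    ultimately show "v \<in> vec_coeffs ` Vec d k" by blast
  qed
qed

lemma mat_coeffs_mats: "A \<in> Mat d b a \<Longrightarrow> mat_coeffs A \<in> mats av d b a"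
  by (auto simp: mats_def Mat_def mat_coeffs_def cf_tate cf_zero)
lemma mats_mat_coeffs: assumes "A \<in> mats av d b a" shows "\<exists>A'\<in>Mat d b a. A = mat_coeffs A'"
proof -
  define w where "w = (\<lambda>l j. if l < b \<and> j < a then Abs_ps (A l j) else 0)"
  have "w \<in> Mat d b a" using assms Abs_tate(2) by (auto simp: w_def Mat_def mats_def)
  moreover have "A l j = mat_coeffs w l j" for l j
    using assms Abs_tate(1)[of "A l j" d] by (cases "l < b \<and> j < a") (auto simp: w_def mat_coeffs_def mats_def cf_zero)
  hence "A = mat_coeffs w" by (intro ext) simp
  ultimately show ?thesis by blast
qed
lemma nvecs_eq: "nvecs av d k f = mat_coeffs ` Mat d k f"
proof
  show "mat_coeffs ` Mat d k f \<subseteq> nvecs av d k f"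
    by (auto simp: nvecs_def vecs_def Mat_def mat_coeffs_def cf_tate cf_zero zero_fun_def)
  show "nvecs av d k f \<subseteq> mat_coeffs ` Mat d k f"
  proof
    fix u assume u: "u \<in> nvecs av d k f"
    have "u l j = 0" if "\<not> (l < k \<and> j < f)" for l j
      using u that by (cases "l < k") (auto simp: nvecs_def vecs_def)
    hence "u \<in> mats av d k f" using u by (auto simp: nvecs_def vecs_def mats_def)
    thus "u \<in> mat_coeffs ` Mat d k f" using mats_mat_coeffs by blast
  qed
qed

lemma span_eq: "span av d (vec_coeffs ` R) = vec_coeffs ` row_span d R"
proof
  show "vec_coeffs ` row_span d R \<subseteq> span av d (vec_coeffs ` R)"
  proof clarify
    fix v assume "v \<in> row_span d R"
    thus "vec_coeffs v \<in> span av d (vec_coeffs ` R)"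
    proof (induction rule: row_span.induct)
      case row_span_0
      have z: "(\<lambda>_. 0) = (0 :: nat \<Rightarrow> 'k ps)" by (simp add: zero_fun_def)
      show ?case unfolding span_def z vec_coeffs_0 by (intro CollectI exI[of _ 0] exI[of _ "\<lambda>_. 0"] conjI)
          (simp_all only: lessThan_0 sum.empty not_less_zero simp_thms)
    next
      case (row_span_step v c r)
      from row_span_step(4) obtain n :: nat and c' r' where n: "\<forall>j<n. c' j \<in> tate av d \<and> r' j \<in> vec_coeffs ` R"
        "vec_coeffs v = (\<Sum>j<n. smul_vec (c' j) (r' j))"
        unfolding span_def mem_Collect_eq by (elim exE conjE) (erule that, assumption)
      have "vec_coeffs (\<lambda>t. v t + c * r t) = vec_coeffs v + smul_vec (cf c) (vec_coeffs r)"
        by (intro ext) (simp add: vec_coeffs_def smul_vec_def cf_mult)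
      also have "\<dots> = (\<Sum>j<Suc n. smul_vec ((c'(n := cf c)) j) ((r'(n := vec_coeffs r)) j))"
        unfolding n(2) by simp
      finally have e: "vec_coeffs (\<lambda>t. v t + c * r t) = \<dots>" .
      have m: "\<forall>j<Suc n. (c'(n := cf c)) j \<in> tate av d \<and> (r'(n := vec_coeffs r)) j \<in> vec_coeffs ` R"
        using n(1) row_span_step(2,3) cf_tate by (auto simp: less_Suc_eq)
      show ?case unfolding span_def mem_Collect_eq
        by (rule exI[of _ "Suc n"], rule exI[of _ "c'(n := cf c)"], rule exI[of _ "r'(n := vec_coeffs r)"]) (rule conjI[OF m e])
    qed
  qed
  show "span av d (vec_coeffs ` R) \<subseteq> vec_coeffs ` row_span d R"
  proof
    fix v assume "v \<in> span av d (vec_coeffs ` R)"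
    then obtain n :: nat and c r where n: "\<forall>j<n. c j \<in> tate av d \<and> r j \<in> vec_coeffs ` R"
      "v = (\<Sum>j<n. smul_vec (c j) (r j))"
      unfolding span_def mem_Collect_eq by (elim exE conjE) (erule that, assumption)
    have "(\<Sum>j<n. smul_vec (c j) (r j)) \<in> vec_coeffs ` row_span d R" using n(1)
    proof (induction n)
      case 0
      have z: "(\<lambda>_. 0) = (0 :: nat \<Rightarrow> 'k ps)" by (simp add: zero_fun_def)
      have "vec_coeffs 0 \<in> vec_coeffs ` row_span d R" using row_span_0 unfolding z by (rule imageI)
      thus ?case by (simp only: vec_coeffs_0 lessThan_0 sum.empty)
    next
      case (Suc n)
      then obtain w where w: "w \<in> row_span d R" "(\<Sum>j<n. smul_vec (c j) (r j)) = vec_coeffs w" by auto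
      obtain r' where r': "r' \<in> R" "r n = vec_coeffs r'" using Suc.prems by blast
      have c: "c n \<in> tate av d" using Suc.prems by blast
      have "(\<Sum>j<Suc n. smul_vec (c j) (r j)) = vec_coeffs (\<lambda>t. w t + Abs_ps (c n) * r' t)"
        unfolding sum.lessThan_Suc w(2) r'(2)
        by (intro ext) (simp add: vec_coeffs_def smul_vec_def cf_mult Abs_tate(1)[OF c])
      moreover have "(\<lambda>t. w t + Abs_ps (c n) * r' t) \<in> row_span d R"
        using row_span_step[OF w(1) Abs_tate(2)[OF c] r'(1)] .
      ultimately show ?case by simp
    qed
    thus "v \<in> vec_coeffs ` row_span d R" using n(2) by simp
  qed
qed

lemma in_sub_iff: "in_sub av d (vec_coeffs ` Q) k (mat_coeffs u) \<longleftrightarrow> (\<forall>l<k. u l \<in> row_span d Q)"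
proof -
  have "mat_coeffs u l = vec_coeffs (u l)" for l by (simp add: mat_coeffs_def vec_coeffs_def)
  thus ?thesis by (simp add: in_sub_def span_eq inj_image_mem_iff[OF inj_vec_coeffs])
qed

lemma free_res_iff:
  "free_res av d e (vec_coeffs ` R) k A \<longleftrightarrow> (\<exists>A'. A = (\<lambda>j. mat_coeffs (A' j)) \<and> is_res d e R k A')"
proof -
  have img: "mat_app (mat_coeffs B) n ` vecs av d n = vec_coeffs ` (mat_vec n B ` Vec d n)" for B n
    unfolding vecs_eq image_image vec_coeffs_mat_vec ..
  have ker: "{v \<in> vecs av d n. mat_app (mat_coeffs B) n v = 0} = vec_coeffs ` {v \<in> Vec d n. mat_vec n B v = 0}" for B n
    unfolding vecs_eq by (auto simp: vec_coeffs_mat_vec vec_coeffs_zero_iff)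
  have iff: "free_res av d e (vec_coeffs ` R) k (\<lambda>j. mat_coeffs (A' j)) \<longleftrightarrow> is_res d e R k A'"
    if "\<And>j. A' j \<in> Mat d (k j) (k (Suc j))" for A'
    unfolding free_res_def is_res_def span_eq img ker inj_image_eq_iff[OF inj_vec_coeffs] by (simp add: that mat_coeffs_mats)
  show ?thesis
  proof
    assume fr: "free_res av d e (vec_coeffs ` R) k A"
    hence "A j \<in> mats av d (k j) (k (Suc j))" for j by (simp add: free_res_def)
    hence "\<exists>A'\<in>Mat d (k j) (k (Suc j)). A j = mat_coeffs A'" for j by (rule mats_mat_coeffs)
    then obtain A' where A': "\<And>j. A' j \<in> Mat d (k j) (k (Suc j))" "\<And>j. A j = mat_coeffs (A' j)" by metis
    hence "A = (\<lambda>j. mat_coeffs (A' j))" by auto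
    thus "\<exists>A'. A = (\<lambda>j. mat_coeffs (A' j)) \<and> is_res d e R k A'" using fr iff[OF A'(1)] by blast
  next
    assume "\<exists>A'. A = (\<lambda>j. mat_coeffs (A' j)) \<and> is_res d e R k A'"
    thus "free_res av d e (vec_coeffs ` R) k A" using iff is_res_Mat by blast
  qed
qed

text \<open>Writing the degree as a successor turns the index i - 1 of the definition into an
  ordinary one.\<close>

lemma tor_nonzero_iff:
  "tor_nonzero av d e (vec_coeffs ` R) f (vec_coeffs ` Q) (Suc i) \<longleftrightarrow>
    (\<exists>k A. is_res d e R k A \<and> hom_nz d f Q (k i) (k (Suc i)) (k (Suc (Suc i))) (A i) (A (Suc i)))"
proof -
  have hom: "(\<exists>u\<in>nvecs av d (k (Suc i)) f.
        in_sub av d (vec_coeffs ` Q) (k i) (tens_app (mat_coeffs (A i)) (k (Suc i)) u) \<and>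
        \<not> (\<exists>w\<in>nvecs av d (k (Suc (Suc i))) f.
             in_sub av d (vec_coeffs ` Q) (k (Suc i)) (u - tens_app (mat_coeffs (A (Suc i))) (k (Suc (Suc i))) w)))
     \<longleftrightarrow> hom_nz d f Q (k i) (k (Suc i)) (k (Suc (Suc i))) (A i) (A (Suc i))"
    if fr: "is_res d e R k A" for k A
  proof -
    note M = is_res_Mat[OF fr]
    have 1: "(\<forall>l<k i. mat_mul (k (Suc i)) (A i) u l \<in> row_span d Q) \<longleftrightarrow> mat_mul (k (Suc i)) (A i) u \<in> row_sub d (k i) f Q"
      if "u \<in> Mat d (k (Suc i)) f" for u
      using mat_mul_Mat[OF M that] by (simp add: row_sub_def)
    have 2: "(\<forall>l<k (Suc i). (u - mat_mul (k (Suc (Suc i))) (A (Suc i)) w) l \<in> row_span d Q) \<longleftrightarrow>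
        u - mat_mul (k (Suc (Suc i))) (A (Suc i)) w \<in> row_sub d (k (Suc i)) f Q"
      if "u \<in> Mat d (k (Suc i)) f" "w \<in> Mat d (k (Suc (Suc i))) f" for u w
      using submodD(6)[OF submod_Mat that(1) mat_mul_Mat[OF M that(2)]] by (simp add: row_sub_def)
    show ?thesis
      unfolding nvecs_eq hom_nz_def bex_simps mat_coeffs_mat_mul mat_coeffs_diff in_sub_iff
      using 1 2 by (simp only: cong: bex_cong ball_cong conj_cong)
  qed
  have ex: "(\<exists>k A. (\<exists>A'. A = g A' \<and> P k A') \<and> F k A) \<longleftrightarrow> (\<exists>k A'. P k A' \<and> F k (g A'))"
    for g :: "(nat \<Rightarrow> 'k pmat) \<Rightarrow> nat \<Rightarrow> 'k tmat" and P and F :: "(nat \<Rightarrow> nat) \<Rightarrow> (nat \<Rightarrow> 'k tmat) \<Rightarrow> bool"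
    by blast
  show ?thesis
    unfolding tor_nonzero_def free_res_iff diff_Suc_1 ex using hom by (simp only: cong: conj_cong)
qed

end

section \<open>Integer iterates of the automorphism\<close>

lemma tate_aut_id: "nonarch av \<Longrightarrow> tate_aut av d (\<lambda>f. f)"
  by (auto simp: tate_aut_def tate_aut_axioms_def bij_betw_def)

lemma tate_aut_comp:
  assumes "tate_aut av d s" "tate_aut av d t" shows "tate_aut av d (\<lambda>f. s (t f))"
proof -
  interpret s: tate_aut av d s by fact
  interpret t: tate_aut av d t by fact
  show ?thesis
  proof
    show "bij_betw (\<lambda>f. s (t f)) (s.T d) (s.T d)" using bij_betw_trans[OF t.bij s.bij] by (simp add: comp_def)
  qed (simp_all add: s.s_add s.s_mult t.s_add t.s_mult t.s_Cc s.s_Cc)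
qed

lemma tate_aut_funpow: "tate_aut av d s \<Longrightarrow> tate_aut av d (s ^^ n)"
proof (induction n)
  case 0
  hence "nonarch av" by (simp add: tate_aut_def)
  thus ?case using tate_aut_id[of av d] by (simp add: id_def)
next
  case (Suc n)
  thus ?case using tate_aut_comp[of av d s "s ^^ n"] by (simp add: comp_def)
qed

context tate_aut
begin

definition iterate :: "int \<Rightarrow> 'k ps \<Rightarrow> 'k ps" where
  "iterate n = (if 0 \<le> n then s ^^ nat n else inv_into (T d) s ^^ nat (- n))"

lemma iterate_aut: "tate_aut av d (iterate n)"
  unfolding iterate_def using tate_aut_funpow[OF tate_aut_axioms] tate_aut_funpow[OF inv_aut] by simp

lemma iterate_T: "f \<in> T d \<Longrightarrow> iterate n f \<in> T d" by (rule tate_aut.s_T[OF iterate_aut])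

lemma s_inv: "f \<in> T d \<Longrightarrow> s (inv_into (T d) s f) = f"
  using bij by (simp add: bij_betw_def f_inv_into_f)

lemma s_iterate: assumes f: "f \<in> T d" shows "s (iterate n f) = iterate (n + 1) f"
proof (cases "0 \<le> n")
  case True
  thus ?thesis by (simp add: iterate_def nat_add_distrib)
next
  case False
  \<comment> \<open>One inverse cancels against \<open>s\<close>; for n = -1 the result belongs to
    the other branch of \<open>iterate\<close>, with exponent 0.\<close>
  define m where "m = nat (- n - 1)"
  have m: "nat (- n) = Suc m" "nat (- (n + 1)) = m" using False by (auto simp: m_def)
  have gT: "(inv_into (T d) s ^^ m) f \<in> T d" by (rule tate_aut.s_T[OF tate_aut_funpow[OF inv_aut] f])
  have "iterate (n + 1) f = (inv_into (T d) s ^^ m) f"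
    using False m(2) by (cases "n = - 1") (auto simp: iterate_def m_def)
  moreover have "s (iterate n f) = (inv_into (T d) s ^^ m) f"
    using False m(1) s_inv[OF gT] by (simp add: iterate_def)
  ultimately show ?thesis by simp
qed

lemma iterate_iterate: assumes f: "f \<in> T d" shows "iterate n (iterate m f) = iterate (n + m) f"
proof (induction n rule: int_induct[where k = 0])
  case base
  show ?case by (simp add: iterate_def)
next
  case (step1 n)
  have "iterate (n + 1) (iterate m f) = s (iterate n (iterate m f))" using s_iterate[OF iterate_T[OF f]] by simp
  also have "\<dots> = iterate (n + m + 1) f" unfolding step1(2) by (rule s_iterate[OF f])
  finally show ?case by (simp add: algebra_simps)
next
  case (step2 n)
  have "s (iterate (n - 1) (iterate m f)) = s (iterate (n - 1 + m) f)"
    using step2(2) by (simp add: s_iterate iterate_T f)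
  thus ?case using s_inj iterate_T f by blast
qed

end

context near_aut
begin

lemma interpolation_mat:
  assumes A: "A \<in> Mat d a b"
  shows "\<exists>E\<in>Mat (Suc d) a b. \<forall>n l j. cong_lin d (of_int n) (E l j) (map_mat (iterate n) A l j)"
proof -
  have "\<exists>G\<in>T (Suc d). \<forall>n. cong_lin d (of_int n) G (iterate n (A l j))" for l j
    using iterate_T s_iterate Mat_T[OF A] by (intro interpolation) auto
  then obtain G where G: "\<And>l j. G l j \<in> T (Suc d)" "\<And>l j n. cong_lin d (of_int n) (G l j) (iterate n (A l j))" by metis
  define E where "E = (\<lambda>l j. if l < a \<and> j < b then G l j else 0)"
  have "E \<in> Mat (Suc d) a b" using G(1) by (simp add: E_def Mat_def)
  moreover have "cong_lin d (of_int n) (E l j) (map_mat (iterate n) A l j)" for n l j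
  proof (cases "l < a \<and> j < b")
    case False
    hence "map_mat (iterate n) A l j = 0"
      using Mat_out[OF A False] tate_aut.s_0[OF iterate_aut] by (simp add: map_mat_def)
    moreover have "E l j = 0" unfolding E_def using False by (rule if_not_P)
    ultimately show ?thesis by simp
  qed (use G(2) in \<open>simp add: E_def map_mat_def\<close>)
  ultimately show ?thesis by blast
qed

text \<open>A nonempty \<open>S\<close> supplies a resolution at some n0. Its twist by -n0 resolves
  S^e modulo \<open>R\<close>, and twisting that by n serves every n, so the differentials at all n
  interpolate to one complex.\<close>

theorem tor_progressions:
  fixes i :: nat
  assumes R: "R \<subseteq> Vec d e" and Q: "Q \<subseteq> Vec d f"
  defines "S \<equiv> {n. tor_nonzero av d e (vec_coeffs ` map_row (iterate n) ` R) f (vec_coeffs ` Q) (Suc i)}"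
  shows "\<exists>r. \<exists>B. finite B \<and> finite ((S - (\<Union>a\<in>B. resid a r)) \<union> ((\<Union>a\<in>B. resid a r) - S))"
proof (cases "S = {}")
  case True
  thus ?thesis by (intro exI[of _ 0] exI[of _ "{}"]) simp
next
  case False
  then obtain n0 where "n0 \<in> S" by blast
  then obtain k B where B: "is_res d e (map_row (iterate n0) ` R) k B" unfolding S_def tor_nonzero_iff by blast
  have RV: "map_row (iterate n0) ` R \<subseteq> Vec d e" using tate_aut.map_row_Vec[OF iterate_aut] R by blast
  have comp: "map_row (iterate n) (map_row (iterate m) v) = map_row (iterate (n + m)) v" if "v \<in> Vec d a" for n m v a
    using Vec_T[OF that] by (simp add: map_row_def iterate_iterate)
  have "map_row (iterate (- n0)) ` map_row (iterate n0) ` R = R"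
  proof -
    have "map_row (iterate (- n0)) (map_row (iterate n0) v) = v" if "v \<in> R" for v
    proof -
      have "v \<in> Vec d e" using R that by blast
      moreover have "map_row (iterate 0) v = v" by (simp add: map_row_def iterate_def)
      ultimately show ?thesis using comp[of v e "- n0" n0] by simp
    qed
    thus ?thesis by (simp add: image_image)
  qed
  moreover define A where "A = (\<lambda>j. map_mat (iterate (- n0)) (B j))"
  ultimately have A: "is_res d e R k A" using tate_aut.is_res_map_mat[OF iterate_aut B RV, of "- n0"] by simp
  have An: "is_res d e (map_row (iterate n) ` R) k (\<lambda>j. map_mat (iterate n) (A j))" for n
    by (rule tate_aut.is_res_map_mat[OF iterate_aut A R])
  \<comment> \<open>The definition offers a separate resolution for each n; independence replaces it
    by the twist of the fixed one.\<close>
  have S: "S = {n. hom_nz d f Q (k i) (k (Suc i)) (k (Suc (Suc i))) (map_mat (iterate n) (A i)) (map_mat (iterate n) (A (Suc i)))}"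
    unfolding S_def tor_nonzero_iff using An hom_nz_independent by blast
  obtain E0 where E0: "E0 \<in> Mat (Suc d) (k i) (k (Suc i))"
    "\<forall>n l j. cong_lin d (of_int n) (E0 l j) (map_mat (iterate n) (A i) l j)" using interpolation_mat[OF is_res_Mat[OF A]] by blast
  obtain E1 where E1: "E1 \<in> Mat (Suc d) (k (Suc i)) (k (Suc (Suc i)))"
    "\<forall>n l j. cong_lin d (of_int n) (E1 l j) (map_mat (iterate n) (A (Suc i)) l j)" using interpolation_mat[OF is_res_Mat[OF A]] by blast
  show ?thesis unfolding S
    by (rule homology_progressions[OF E0(1) E1(1) is_res_Mat[OF An] is_res_Mat[OF An] _ _ is_res_complex[OF An] Q])
       (use E0(2) E1(2) in blast)+
qed

end

theorem theorem1p2: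
  fixes av :: "'k::field \<Rightarrow> real" and p :: nat and d :: nat
    and \<sigma> :: "'k tate \<Rightarrow> 'k tate" and c :: real
    and e f :: nat and R Q :: "'k tvec set" and i :: nat
  assumes "prime p"
    and "nonarch_abs av" and "complete_abs av"
    and "av (of_nat p) = 1 / real p"
    and "K_alg_aut av d \<sigma>"
    and "\<forall>j<d. gauss av (\<sigma> (tvar j) - tvar j) < real p powr (- c)"
    and "c > 1 / (real p - 1)"
    and "R \<subseteq> vecs av d e" and "Q \<subseteq> vecs av d f"
    and "1 \<le> i"
  shows "\<exists>r::nat. \<exists>B::int set. finite B \<and>
    (let T = {n::int. tor_nonzero av d e (pull_rel (spow av d \<sigma> n) R) f Q i};
         U = (\<Union>a\<in>B. {a + int p ^ r * m | m. True})
     in finite ((T - U) \<union> (U - T)))"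
proof -
  interpret padic av p using assms(1-4) by unfold_locales
  have \<sigma>bij: "bij_betw \<sigma> (tate av d) (tate av d)" using assms(5) by (simp add: K_alg_aut_def)
  have \<sigma>t: "\<sigma> f \<in> tate av d" if "f \<in> tate av d" for f using \<sigma>bij that by (auto simp: bij_betw_def)
  \<comment> \<open>\<sigma> acts on coefficient functions, and \<open>s\<close> is its transport to
    \<open>ps\<close>, with controlled values on \<open>T d\<close>.\<close>
  define s where "s f = Abs_ps (\<sigma> (cf f))" for f
  have cs: "cf (s f) = \<sigma> (cf f)" "s f \<in> T d" if "f \<in> T d" for f
    using Abs_tate[OF \<sigma>t[OF cf_tate[OF that]]] by (simp_all add: s_def)
  have Tt: "\<exists>f\<in>T d. cf f = g" if "g \<in> tate av d" for g using Abs_tate[OF that] by blast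
  interpret tate_aut av d s
  proof
    show "bij_betw s (T d) (T d)"
      unfolding bij_betw_def
    proof
      show "inj_on s (T d)"
      proof (rule inj_onI)
        fix f g assume fg: "f \<in> T d" "g \<in> T d" "s f = s g"
        hence "\<sigma> (cf f) = \<sigma> (cf g)" using cs(1) by metis
        hence "cf f = cf g" using \<sigma>bij cf_tate fg by (auto simp: bij_betw_def dest: inj_onD)
        thus "f = g" by (simp add: cf_inject)
      qed
      show "s ` T d = T d"
      proof
        show "s ` T d \<subseteq> T d" using cs(2) by blast
        show "T d \<subseteq> s ` T d"
        proof
          fix g assume g: "g \<in> T d"
          then obtain h where "h \<in> tate av d" "\<sigma> h = cf g" using \<sigma>bij cf_tate[OF g] unfolding bij_betw_def by (metis imageE)
          then obtain f where f: "f \<in> T d" "\<sigma> (cf f) = cf g" using Tt by blast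
          hence "s f = g" using cs(1)[OF f(1)] by (simp add: cf_inject)
          thus "g \<in> s ` T d" using f(1) by blast
        qed
      qed
    qed
    fix f g assume fg: "f \<in> T d" "g \<in> T d"
    have 1: "\<sigma> (cf f + cf g) = \<sigma> (cf f) + \<sigma> (cf g)" "\<sigma> (tmul (cf f) (cf g)) = tmul (\<sigma> (cf f)) (\<sigma> (cf g))"
      using assms(5) cf_tate fg by (auto simp: K_alg_aut_def)
    have "cf (s (f + g)) = cf (s f + s g)" using cs(1)[OF T_add[OF fg]] 1 cs(1) fg by (simp add: cf_add_fun)
    thus "s (f + g) = s f + s g" by (simp add: cf_inject)
    have "cf (s (f * g)) = cf (s f * s g)" using cs(1)[OF T_mult[OF fg]] 1 cs(1) fg by (simp add: cf_mult)
    thus "s (f * g) = s f * s g" by (simp add: cf_inject)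
  next
    fix c
    have "cf (s (Cc c)) = cf (Cc c)"
      using cs(1)[OF T_Cc] assms(5) by (simp add: cf_Cc_tconst K_alg_aut_def)
    thus "s (Cc c) = Cc c" by (simp add: cf_inject)
  qed
  define \<delta> where "\<delta> = real p powr (- c)"
  interpret near_aut av p d s \<delta>
  proof
    show "0 < \<delta>" using p_gt1 by (simp add: \<delta>_def)
    have "\<delta> * q = real p powr (1 / (real p - 1) - c)" by (simp add: \<delta>_def q_def flip: powr_add)
    also have "\<dots> < real p powr 0" using assms(7) p_gt1 by (intro powr_less_mono) auto
    finally show "\<delta> * q < 1" using p_gt1 by simp
    fix j assume j: "j < d"
    have XT: "X j \<in> T d" using j by (rule T_X)
    have cx: "cf (s (X j) - X j) = \<sigma> (tvar j) - tvar j" using cs(1)[OF XT] by (simp add: cf_diff_fun cf_X)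
    obtain r where r: "bd r (s (X j) - X j)" using T_bdd[OF T_diff[OF cs(2)[OF XT] XT]] by blast
    have "av (cf (s (X j) - X j) \<alpha>) \<le> \<delta>" for \<alpha>
    proof -
      \<comment> \<open>The supremum in \<open>gauss\<close> dominates the coefficients only if
        these are bounded, which membership in the Tate algebra provides.\<close>
      have "bdd_above (range (\<lambda>\<alpha>. av ((\<sigma> (tvar j) - tvar j) \<alpha>)))"
        using bdD[OF r] unfolding cx by (intro bdd_aboveI[of _ r]) blast
      hence "av ((\<sigma> (tvar j) - tvar j) \<alpha>) \<le> gauss av (\<sigma> (tvar j) - tvar j)"
        unfolding gauss_def by (intro cSup_upper) auto
      also have "\<dots> \<le> \<delta>" using assms(6) j by (auto simp: \<delta>_def intro: less_imp_le)
      finally show ?thesis unfolding cx .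
    qed
    thus "bd \<delta> (s (X j) - X j)" by (simp add: bd_def)
  qed
  have cinv: "cf (inv_into (T d) s f) = inv_into (tate av d) \<sigma> (cf f)" if f: "f \<in> T d" for f
  proof -
    have gT: "inv_into (T d) s f \<in> T d" by (rule tate_aut.s_T[OF inv_aut f])
    have "\<sigma> (cf (inv_into (T d) s f)) = cf f" using cs(1)[OF gT] s_inv[OF f] by simp
    thus ?thesis using inv_into_f_eq[of \<sigma> "tate av d"] \<sigma>bij cf_tate[OF gT] by (metis bij_betw_def)
  qed
  have csn: "cf (iterate n f) = spow av d \<sigma> n (cf f)" if f: "f \<in> T d" for n f
  proof -
    have 1: "cf ((s ^^ m) f) = (\<sigma> ^^ m) (cf f)" for m
      by (induction m) (simp_all add: cs(1) tate_aut.s_T[OF tate_aut_funpow[OF tate_aut_axioms] f])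
    have 2: "cf ((inv_into (T d) s ^^ m) f) = (inv_into (tate av d) \<sigma> ^^ m) (cf f)" for m
      by (induction m) (simp_all add: cinv tate_aut.s_T[OF tate_aut_funpow[OF inv_aut] f])
    show ?thesis using 1 2 by (simp add: iterate_def spow_def)
  qed
  define R' where "R' = {r \<in> Vec d e. vec_coeffs r \<in> R}"
  define Q' where "Q' = {r \<in> Vec d f. vec_coeffs r \<in> Q}"
  have R': "R' \<subseteq> Vec d e" "R = vec_coeffs ` R'" using assms(8) unfolding vecs_eq R'_def by auto
  have Q': "Q' \<subseteq> Vec d f" "Q = vec_coeffs ` Q'" using assms(9) unfolding vecs_eq Q'_def by auto
  have pull: "pull_rel (spow av d \<sigma> n) R = vec_coeffs ` map_row (iterate n) ` R'" for n
    unfolding R'(2) pull_rel_def image_image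
  proof (rule image_cong[OF refl])
    fix r assume "r \<in> R'"
    hence "r j \<in> T d" for j using R'(1) Vec_T by blast
    thus "(\<lambda>j. spow av d \<sigma> n (vec_coeffs r j)) = vec_coeffs (map_row (iterate n) r)" by (simp add: vec_coeffs_def map_row_def csn)
  qed
  obtain i0 where i0: "i = Suc i0" using assms(10) by (cases i) auto
  show ?thesis
    unfolding Let_def pull Q'(2) i0 using tor_progressions[OF R'(1) Q'(1), of i0] unfolding resid_def .
qed

end
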